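(* Let $(G,X)$ be a self-similar action. There is an isomorphism $\phi:\mathcal{T}(G,X)\to C^*(X^*\bowtie G)$ such that $\phi(u_g)=s_g$ for all $g\in G$ and $\phi(v_x)=t_x$ for all $x\in X$. Moreover, $\phi$ descends to an isomorphism of $\mathcal{O}(G,X)$ onto the boundary quotient $\mathcal{Q}(X^*\bowtie G)$.
   Context: Let $X$ be a finite alphabet, $X^n$ the set of words of length $n$ in $X$, and $X^*=\bigcup_{n\ge0}X^n$, a semigroup under concatenation with identity the empty word $\varnothing$. A faithful action of a group $G$ on $X^*$ (by automorphisms of the rooted tree $X^*$, so preserving word length and prefixes) is self-similar if for every $g\in G$ and $x\in X$ there exists a unique $g|_x\in G$ such that $g\cdot(xw)=(g\cdot x)(g|_x\cdot w)$ for all $w\in X^*$; then $(G,X)$ is called a self-similar action (or self-similar group). Restriction extends to words by $g|_{\varnothing}=g$ and $g|_{vw}=(g|_v)|_w$. The Zappa--Szép product $X^*\bowtie G$ is the set $X^*\times G$ with multiplication $(x,g)(y,h)=(x(g\cdot y),\,g|_y h)$; it is a right LCM semigroup with identity $(\varnothing,e)$ (left cancellative, and two elements with a right common multiple have a right least common multiple, so that a nonempty intersection of two principal right ideals is a principal right ideal). $\mathcal{T}(G,X)$ is the universal $C^*$-algebra generated by a Toeplitz--Cuntz family of isometries $\{v_x:x\in X\}$ (i.e. $v_x^*v_y=\delta_{x,y}1$) and a unitary representation $u$ of $G$ satisfying $u_gv_x=v_{g\cdot x}u_{g|_x}$ for all $g\in G$, $x\in X$. $\mathcal{O}(G,X)$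 is the quotient of $\mathcal{T}(G,X)$ by the ideal generated by $1-\sum_{x\in X}v_xv_x^*$. For a right LCM semigroup $P$, put $pY=\{py:y\in Y\}$ for $Y\subseteq P$, and $\mathcal{J}(P)=\{pP:p\in P\}\cup\{\varnothing\}$. $C^*(P)$ is the universal $C^*$-algebra generated by isometries $\{w_p:p\in P\}$ and projections $\{e_Y:Y\in\mathcal{J}(P)\}$ satisfying $w_pw_q=w_{pq}$; $w_pe_Yw_p^*=e_{pY}$; $e_P=1$, $e_\varnothing=0$; $e_Ye_Z=e_{Y\cap Z}$. A subset $F\subseteq P$ is a foundation set if it is finite and for each $p\in P$ there is $q\in F$ with $pP\cap qP\ne\varnothing$. The boundary quotient $\mathcal{Q}(P)$ is the quotient of $C^*(P)$ obtained by adding the relations $\prod_{p\in F}(1-e_{pP})=0$ for all foundation sets $F\subseteq P$. In $C^*(X^*\bowtie G)$ (and its quotient) write $t_x:=w_{(x,e)}$ for $x\in X^*$ and $s_g:=w_{(\varnothing,g)}$ for $g\in G$ (the canonical generators). *)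

theory Defs
  imports Complex_Main "HOL-Algebra.Group_Action" "HOL-Algebra.QuotRing" "HOL-Library.Poly_Mapping"
    "HOL-Library.Sublist"
begin

section \<open>Unital C*-algebras with explicit carrier\<close>

record 'a star_alg = "'a ring" +
  scl :: "complex \<Rightarrow> 'a \<Rightarrow> 'a"
  adj :: "'a \<Rightarrow> 'a"

record 'a normed_star_alg = "'a star_alg" +
  nrm :: "'a \<Rightarrow> real"

locale star_algebra = ring A for A :: "('a, 'm) star_alg_scheme" (structure) +
  assumes scl_closed: "a \<in> carrier A \<Longrightarrow> scl A c a \<in> carrier A"
    and scl_add_right: "\<lbrakk>a \<in> carrier A; b \<in> carrier A\<rbrakk> \<Longrightarrow> scl A c (a \<oplus> b) = scl A c a \<oplus> scl A c b"
    and scl_add_left: "a \<in> carrier A \<Longrightarrow> scl A (c + d) a = scl A c a \<oplus> scl A d a"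
    and scl_scl: "a \<in> carrier A \<Longrightarrow> scl A c (scl A d a) = scl A (c * d) a"
    and scl_one: "a \<in> carrier A \<Longrightarrow> scl A 1 a = a"
    and scl_mult_left: "\<lbrakk>a \<in> carrier A; b \<in> carrier A\<rbrakk> \<Longrightarrow> scl A c a \<otimes> b = scl A c (a \<otimes> b)"
    and scl_mult_right: "\<lbrakk>a \<in> carrier A; b \<in> carrier A\<rbrakk> \<Longrightarrow> a \<otimes> scl A c b = scl A c (a \<otimes> b)"
    and adj_closed: "a \<in> carrier A \<Longrightarrow> adj A a \<in> carrier A"
    and adj_adj: "a \<in> carrier A \<Longrightarrow> adj A (adj A a) = a"
    and adj_add: "\<lbrakk>a \<in> carrier A; b \<in> carrier A\<rbrakk> \<Longrightarrow> adj A (a \<oplus> b) = adj A a \<oplus> adj A b"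
    and adj_mult: "\<lbrakk>a \<in> carrier A; b \<in> carrier A\<rbrakk> \<Longrightarrow> adj A (a \<otimes> b) = adj A b \<otimes> adj A a"
    and adj_scl: "a \<in> carrier A \<Longrightarrow> adj A (scl A c a) = scl A (cnj c) (adj A a)"

definition cstar_seminorm :: "('a, 'm) star_alg_scheme \<Rightarrow> ('a \<Rightarrow> real) \<Rightarrow> bool" where
  "cstar_seminorm A p \<longleftrightarrow>
     (\<forall>a\<in>carrier A. 0 \<le> p a) \<and>
     (\<forall>a\<in>carrier A. \<forall>b\<in>carrier A. p (a \<oplus>\<^bsub>A\<^esub> b) \<le> p a + p b) \<and>
     (\<forall>c. \<forall>a\<in>carrier A. p (scl A c a) = cmod c * p a) \<and>
     (\<forall>a\<in>carrier A. \<forall>b\<in>carrier A. p (a \<otimes>\<^bsub>A\<^esub> b) \<le> p a * p b) \<and>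
     (\<forall>a\<in>carrier A. p (adj A a \<otimes>\<^bsub>A\<^esub> a) = (p a)\<^sup>2)"

definition cauchy_seqs :: "('a, 'm) normed_star_alg_scheme \<Rightarrow> (nat \<Rightarrow> 'a) set" where
  "cauchy_seqs A = {s. (\<forall>n. s n \<in> carrier A) \<and>
     (\<forall>\<epsilon>>0. \<exists>N. \<forall>m\<ge>N. \<forall>n\<ge>N. nrm A (s m \<ominus>\<^bsub>A\<^esub> s n) < \<epsilon>)}"

locale seminormed_star_algebra = star_algebra A
  for A :: "('a, 'm) normed_star_alg_scheme" (structure) +
  assumes seminorm: "cstar_seminorm A (nrm A)"

locale cstar_algebra = seminormed_star_algebra +
  assumes norm_zero_imp: "\<lbrakk>a \<in> carrier A; nrm A a = 0\<rbrakk> \<Longrightarrow> a = \<zero>"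
    and complete: "s \<in> cauchy_seqs A \<Longrightarrow>
      \<exists>a\<in>carrier A. (\<lambda>n. nrm A (s n \<ominus> a)) \<longlonglongrightarrow> 0"

definition star_hom ::
  "('a, 'm) normed_star_alg_scheme \<Rightarrow> ('b, 'k) normed_star_alg_scheme \<Rightarrow> ('a \<Rightarrow> 'b) \<Rightarrow> bool" where
  "star_hom A B f \<longleftrightarrow> f \<in> ring_hom A B \<and>
     (\<forall>c. \<forall>a\<in>carrier A. f (scl A c a) = scl B c (f a)) \<and>
     (\<forall>a\<in>carrier A. f (adj A a) = adj B (f a))"

text \<open>Between C*-algebras the isometry clause follows from the other two.\<close>

definition cstar_iso ::
  "('a, 'm) normed_star_alg_scheme \<Rightarrow> ('b, 'k) normed_star_alg_scheme \<Rightarrow> ('a \<Rightarrow> 'b) \<Rightarrow> bool" where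
  "cstar_iso A B f \<longleftrightarrow> star_hom A B f \<and> bij_betw f (carrier A) (carrier B) \<and>
     (\<forall>a\<in>carrier A. nrm B (f a) = nrm A a)"

subsection \<open>Ideals and quotients\<close>

definition closed_ideal :: "('a, 'm) normed_star_alg_scheme \<Rightarrow> 'a set \<Rightarrow> bool" where
  "closed_ideal A I \<longleftrightarrow> ideal I A \<and>
     (\<forall>s a. (\<forall>n. s n \<in> I) \<and> a \<in> carrier A \<and> (\<lambda>n. nrm A (s n \<ominus>\<^bsub>A\<^esub> a)) \<longlonglongrightarrow> 0 \<longrightarrow> a \<in> I)"

definition gen_closed_ideal :: "('a, 'm) normed_star_alg_scheme \<Rightarrow> 'a set \<Rightarrow> 'a set" where
  "gen_closed_ideal A M = \<Inter>{I. closed_ideal A I \<and> M \<subseteq> I}"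

text \<open>The ring part is that of \<^const>\<open>FactRing\<close>. Adding \<open>I\<close> in the scalar multiplication only
  matters for the scalar \<open>0\<close>.\<close>

definition quot_alg ::
  "('a, 'm) normed_star_alg_scheme \<Rightarrow> 'a set \<Rightarrow> 'a set normed_star_alg" where
  "quot_alg A I =
     \<lparr>carrier = carrier (A Quot I), mult = mult (A Quot I), one = one (A Quot I),
      zero = zero (A Quot I), add = add (A Quot I),
      scl = (\<lambda>c Y. I <+>\<^bsub>A\<^esub> scl A c ` Y),
      adj = (\<lambda>Y. adj A ` Y),
      nrm = (\<lambda>Y. Inf (nrm A ` Y))\<rparr>"

definition quot_map :: "('a, 'm) normed_star_alg_scheme \<Rightarrow> 'a set \<Rightarrow> 'a \<Rightarrow> 'a set" where
  "quot_map A I a = I +>\<^bsub>A\<^esub> a"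

subsection \<open>Hausdorff completion\<close>

definition cauchy_alg :: "('a, 'm) normed_star_alg_scheme \<Rightarrow> (nat \<Rightarrow> 'a) normed_star_alg" where
  "cauchy_alg A =
     \<lparr>carrier = cauchy_seqs A, mult = (\<lambda>s t n. s n \<otimes>\<^bsub>A\<^esub> t n), one = (\<lambda>n. \<one>\<^bsub>A\<^esub>),
      zero = (\<lambda>n. \<zero>\<^bsub>A\<^esub>), add = (\<lambda>s t n. s n \<oplus>\<^bsub>A\<^esub> t n),
      scl = (\<lambda>c s n. scl A c (s n)),
      adj = (\<lambda>s n. adj A (s n)),
      nrm = (\<lambda>s. lim (\<lambda>n. nrm A (s n)))\<rparr>"

definition null_seqs :: "('a, 'm) normed_star_alg_scheme \<Rightarrow> (nat \<Rightarrow> 'a) set" where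
  "null_seqs A = {s \<in> cauchy_seqs A. (\<lambda>n. nrm A (s n)) \<longlonglongrightarrow> 0}"

definition completion :: "('a, 'm) normed_star_alg_scheme \<Rightarrow> (nat \<Rightarrow> 'a) set normed_star_alg" where
  "completion A = quot_alg (cauchy_alg A) (null_seqs A)"

definition completion_map :: "('a, 'm) normed_star_alg_scheme \<Rightarrow> 'a \<Rightarrow> (nat \<Rightarrow> 'a) set" where
  "completion_map A a = quot_map (cauchy_alg A) (null_seqs A) (\<lambda>n. a)"


section \<open>Universal C*-algebras given by generators and relations\<close>

text \<open>The free unital *-algebra on a set is the monoid algebra of words in the letters and their
  formal adjoints; the product of \<^typ>\<open>'a \<Rightarrow>\<^sub>0 complex\<close> is the convolution product
  once words form an (additively written) monoid.\<close>

instantiation list :: (type) monoid_add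
begin
definition zero_list :: "'a list" where "zero_list = []"
definition plus_list :: "'a list \<Rightarrow> 'a list \<Rightarrow> 'a list" where "plus_list = (@)"
instance by standard (auto simp: zero_list_def plus_list_def)
end

datatype 'a letter = Ltr 'a | Ltr_adj 'a

primrec letter_adj :: "'a letter \<Rightarrow> 'a letter" where
  "letter_adj (Ltr s) = Ltr_adj s"
| "letter_adj (Ltr_adj s) = Ltr s"

type_synonym 'a free_elt = "'a letter list \<Rightarrow>\<^sub>0 complex"

definition word_adj :: "'a letter list \<Rightarrow> 'a letter list" where
  "word_adj w = rev (map letter_adj w)"

definition free_adj :: "'a free_elt \<Rightarrow> 'a free_elt" where
  "free_adj f = Poly_Mapping.map cnj (Poly_Mapping.map_key word_adj f)"

definition free_gen :: "'a \<Rightarrow> 'a free_elt" where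
  "free_gen s = Poly_Mapping.single [Ltr s] 1"

definition free_alg :: "'a set \<Rightarrow> 'a free_elt star_alg" where
  "free_alg S =
     \<lparr>carrier = {f. Poly_Mapping.keys f \<subseteq> lists (Ltr ` S \<union> Ltr_adj ` S)},
      mult = (*), one = 1, zero = 0, add = (+),
      scl = (\<lambda>c. Poly_Mapping.map ((*) c)),
      adj = free_adj\<rparr>"

text \<open>Relations are equations \<open>l = r\<close> between elements of the free *-algebra, given as pairs
  \<open>(l, r)\<close>. The universal C*-algebra is the Hausdorff completion of the free *-algebra in the largest
  C*-seminorm that respects the relations. The supremum is finite as soon as the relations bound
  the norm of each generator.\<close>

definition rel_seminorm :: "'a set \<Rightarrow> ('a free_elt \<times> 'a free_elt) set \<Rightarrow> ('a free_elt \<Rightarrow> real) \<Rightarrow> bool" where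
  "rel_seminorm S R p \<longleftrightarrow> cstar_seminorm (free_alg S) p \<and> (\<forall>(l, r)\<in>R. p (l - r) = 0)"

definition max_seminorm :: "'a set \<Rightarrow> ('a free_elt \<times> 'a free_elt) set \<Rightarrow> 'a free_elt \<Rightarrow> real" where
  "max_seminorm S R f = (SUP p\<in>Collect (rel_seminorm S R). p f)"

definition free_normed :: "'a set \<Rightarrow> ('a free_elt \<times> 'a free_elt) set \<Rightarrow> 'a free_elt normed_star_alg" where
  "free_normed S R = star_alg.extend (free_alg S) \<lparr>nrm = max_seminorm S R\<rparr>"

type_synonym 'a univ_elt = "(nat \<Rightarrow> 'a free_elt) set"

definition univ_cstar :: "'a set \<Rightarrow> ('a free_elt \<times> 'a free_elt) set \<Rightarrow> 'a univ_elt normed_star_alg" where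
  "univ_cstar S R = completion (free_normed S R)"

definition univ_gen :: "'a set \<Rightarrow> ('a free_elt \<times> 'a free_elt) set \<Rightarrow> 'a \<Rightarrow> 'a univ_elt" where
  "univ_gen S R s = completion_map (free_normed S R) (free_gen s)"


section \<open>Self-similar actions\<close>

locale self_similar_action = faithful_action G "lists X" act
  for G :: "('g, 'm) monoid_scheme" (structure)
    and X :: "'x set" and act :: "'g \<Rightarrow> 'x list \<Rightarrow> 'x list" +
  assumes finite_alphabet: "finite X"
    and length_act: "\<lbrakk>g \<in> carrier G; w \<in> lists X\<rbrakk> \<Longrightarrow> length (act g w) = length w"
    and prefix_act: "\<lbrakk>g \<in> carrier G; v \<in> lists X; w \<in> lists X; prefix v w\<rbrakk> \<Longrightarrow>
      prefix (act g v) (act g w)"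
    and self_similar: "\<lbrakk>g \<in> carrier G; x \<in> X\<rbrakk> \<Longrightarrow>
      \<exists>!h. h \<in> carrier G \<and> (\<forall>w\<in>lists X. act g (x # w) = act g [x] @ act h w)"

definition restr :: "('g, 'm) monoid_scheme \<Rightarrow> 'x set \<Rightarrow> ('g \<Rightarrow> 'x list \<Rightarrow> 'x list) \<Rightarrow> 'g \<Rightarrow> 'x \<Rightarrow> 'g" where
  "restr G X act g x =
     (THE h. h \<in> carrier G \<and> (\<forall>w\<in>lists X. act g (x # w) = act g [x] @ act h w))"

primrec restr_word ::
  "('g, 'm) monoid_scheme \<Rightarrow> 'x set \<Rightarrow> ('g \<Rightarrow> 'x list \<Rightarrow> 'x list) \<Rightarrow> 'g \<Rightarrow> 'x list \<Rightarrow> 'g" where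
  "restr_word G X act g [] = g"
| "restr_word G X act g (x # w) = restr_word G X act (restr G X act g x) w"

definition zappa_szep ::
  "('g, 'm) monoid_scheme \<Rightarrow> 'x set \<Rightarrow> ('g \<Rightarrow> 'x list \<Rightarrow> 'x list) \<Rightarrow> ('x list \<times> 'g) monoid" where
  "zappa_szep G X act =
     \<lparr>carrier = lists X \<times> carrier G,
      mult = (\<lambda>(x, g) (y, h). (x @ act g y, restr_word G X act g y \<otimes>\<^bsub>G\<^esub> h)),
      one = ([], \<one>\<^bsub>G\<^esub>)\<rparr>"

subsection \<open>The Toeplitz and Cuntz--Pimsner algebras of a self-similar action\<close>

datatype ('x, 'g) ss_gen = Gen_v 'x | Gen_u 'g

definition ss_gens :: "('g, 'm) monoid_scheme \<Rightarrow> 'x set \<Rightarrow> ('x, 'g) ss_gen set" where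
  "ss_gens G X = Gen_v ` X \<union> Gen_u ` carrier G"

definition toeplitz_rels ::
  "('g, 'm) monoid_scheme \<Rightarrow> 'x set \<Rightarrow> ('g \<Rightarrow> 'x list \<Rightarrow> 'x list) \<Rightarrow>
   (('x, 'g) ss_gen free_elt \<times> ('x, 'g) ss_gen free_elt) set" where
  "toeplitz_rels G X act = (let v = (\<lambda>x. free_gen (Gen_v x)); u = (\<lambda>g. free_gen (Gen_u g)) in
     {(free_adj (v x) * v y, if x = y then 1 else 0) | x y. x \<in> X \<and> y \<in> X} \<union>
     {(u g * u h, u (g \<otimes>\<^bsub>G\<^esub> h)) | g h. g \<in> carrier G \<and> h \<in> carrier G} \<union>
     {(free_adj (u g) * u g, 1) | g. g \<in> carrier G} \<union>
     {(u g * free_adj (u g), 1) | g. g \<in> carrier G} \<union>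
     {(u g * v x, v (hd (act g [x])) * u (restr G X act g x)) | g x. g \<in> carrier G \<and> x \<in> X})"

definition toeplitz_alg ::
  "('g, 'm) monoid_scheme \<Rightarrow> 'x set \<Rightarrow> ('g \<Rightarrow> 'x list \<Rightarrow> 'x list) \<Rightarrow>
   ('x, 'g) ss_gen univ_elt normed_star_alg" where
  "toeplitz_alg G X act = univ_cstar (ss_gens G X) (toeplitz_rels G X act)"

definition toeplitz_v ::
  "('g, 'm) monoid_scheme \<Rightarrow> 'x set \<Rightarrow> ('g \<Rightarrow> 'x list \<Rightarrow> 'x list) \<Rightarrow> 'x \<Rightarrow> ('x, 'g) ss_gen univ_elt" where
  "toeplitz_v G X act x = univ_gen (ss_gens G X) (toeplitz_rels G X act) (Gen_v x)"

definition toeplitz_u ::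
  "('g, 'm) monoid_scheme \<Rightarrow> 'x set \<Rightarrow> ('g \<Rightarrow> 'x list \<Rightarrow> 'x list) \<Rightarrow> 'g \<Rightarrow> ('x, 'g) ss_gen univ_elt" where
  "toeplitz_u G X act g = univ_gen (ss_gens G X) (toeplitz_rels G X act) (Gen_u g)"

definition cuntz_pimsner_ideal ::
  "('g, 'm) monoid_scheme \<Rightarrow> 'x set \<Rightarrow> ('g \<Rightarrow> 'x list \<Rightarrow> 'x list) \<Rightarrow> ('x, 'g) ss_gen univ_elt set" where
  "cuntz_pimsner_ideal G X act = (let T = toeplitz_alg G X act; v = toeplitz_v G X act in
     gen_closed_ideal T {\<one>\<^bsub>T\<^esub> \<ominus>\<^bsub>T\<^esub> (\<Oplus>\<^bsub>T\<^esub>x\<in>X. v x \<otimes>\<^bsub>T\<^esub> adj T (v x))})"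

definition cuntz_pimsner_alg ::
  "('g, 'm) monoid_scheme \<Rightarrow> 'x set \<Rightarrow> ('g \<Rightarrow> 'x list \<Rightarrow> 'x list) \<Rightarrow>
   ('x, 'g) ss_gen univ_elt set normed_star_alg" where
  "cuntz_pimsner_alg G X act = quot_alg (toeplitz_alg G X act) (cuntz_pimsner_ideal G X act)"


section \<open>The C*-algebra and the boundary quotient of a right LCM semigroup\<close>

definition principal :: "('p, 'm) monoid_scheme \<Rightarrow> 'p \<Rightarrow> 'p set" where
  "principal P p = p <#\<^bsub>P\<^esub> carrier P"

definition constructible :: "('p, 'm) monoid_scheme \<Rightarrow> 'p set set" where
  "constructible P = principal P ` carrier P \<union> {{}}"

datatype 'p sg_gen = Gen_w 'p | Gen_e "'p set"

definition sg_gens :: "('p, 'm) monoid_scheme \<Rightarrow> 'p sg_gen set" where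
  "sg_gens P = Gen_w ` carrier P \<union> Gen_e ` constructible P"

definition semigroup_rels ::
  "('p, 'm) monoid_scheme \<Rightarrow> ('p sg_gen free_elt \<times> 'p sg_gen free_elt) set" where
  "semigroup_rels P = (let w = (\<lambda>p. free_gen (Gen_w p)); e = (\<lambda>Y. free_gen (Gen_e Y)) in
     {(free_adj (w p) * w p, 1) | p. p \<in> carrier P} \<union>
     {(free_adj (e Y), e Y) | Y. Y \<in> constructible P} \<union>
     {(e Y * e Y, e Y) | Y. Y \<in> constructible P} \<union>
     {(w p * w q, w (p \<otimes>\<^bsub>P\<^esub> q)) | p q. p \<in> carrier P \<and> q \<in> carrier P} \<union>
     {(w p * e Y * free_adj (w p), e (p <#\<^bsub>P\<^esub> Y)) | p Y. p \<in> carrier P \<and> Y \<in> constructible P} \<union>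
     {(e (carrier P), 1), (e {}, 0)} \<union>
     {(e Y * e Z, e (Y \<inter> Z)) | Y Z. Y \<in> constructible P \<and> Z \<in> constructible P})"

definition semigroup_alg :: "('p, 'm) monoid_scheme \<Rightarrow> 'p sg_gen univ_elt normed_star_alg" where
  "semigroup_alg P = univ_cstar (sg_gens P) (semigroup_rels P)"

definition semigroup_w :: "('p, 'm) monoid_scheme \<Rightarrow> 'p \<Rightarrow> 'p sg_gen univ_elt" where
  "semigroup_w P p = univ_gen (sg_gens P) (semigroup_rels P) (Gen_w p)"

definition semigroup_e :: "('p, 'm) monoid_scheme \<Rightarrow> 'p set \<Rightarrow> 'p sg_gen univ_elt" where
  "semigroup_e P Y = univ_gen (sg_gens P) (semigroup_rels P) (Gen_e Y)"

definition foundation_set :: "('p, 'm) monoid_scheme \<Rightarrow> 'p set \<Rightarrow> bool" where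
  "foundation_set P F \<longleftrightarrow> F \<subseteq> carrier P \<and> finite F \<and>
     (\<forall>p\<in>carrier P. \<exists>q\<in>F. principal P p \<inter> principal P q \<noteq> {})"

text \<open>The product over \<open>F\<close> is unambiguous because the \<open>e\<^sub>Y\<close> commute.\<close>

definition boundary_ideal :: "('p, 'm) monoid_scheme \<Rightarrow> 'p sg_gen univ_elt set" where
  "boundary_ideal P = (let C = semigroup_alg P in
     gen_closed_ideal C
       {\<Otimes>\<^bsub>C\<^esub>p\<in>F. (\<one>\<^bsub>C\<^esub> \<ominus>\<^bsub>C\<^esub> semigroup_e P (principal P p)) | F. foundation_set P F})"

definition boundary_quotient :: "('p, 'm) monoid_scheme \<Rightarrow> 'p sg_gen univ_elt set normed_star_alg" where
  "boundary_quotient P = quot_alg (semigroup_alg P) (boundary_ideal P)"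

end

theory Submission
  imports Defs
begin

text \<open>Both C*-algebras are universal for a presentation, so the isomorphism comes from comparing the
  presentations inside an arbitrary unital *-algebra, where no analysis is involved. Given a Toeplitz
  family \<open>(v, u)\<close>, let \<open>V x\<close> be the product of the \<open>v\<close> along the letters of a word \<open>x\<close>. Since
  \<open>u g\<close> moves past \<open>V y\<close> at the price of acting on \<open>y\<close> and restricting \<open>g\<close> (\<open>u_V\<close>), the elements
  \<open>V x u g\<close> multiply as the pairs \<open>(x, g)\<close> do. The principal right ideal of \<open>(x, g)\<close> consists of all
  pairs whose word starts with \<open>x\<close> (\<open>principal_eq_cyl\<close>), so it depends on \<open>x\<close> only, and the range
  projections of the \<open>V x\<close> multiply as these cylinders intersect: they are nested when one word is a
  prefix of the other, and orthogonal otherwise. This gives a semigroup family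
  (\<open>semigroup_family_WE\<close>). Conversely, in a semigroup family the letters and the group elements form
  a Toeplitz family (\<open>toeplitz_family_w\<close>): distinct letters have disjoint right ideals, which makes
  their isometries orthogonal, and \<open>([], g)\<close> generates the whole semigroup as a right ideal, which
  makes its isometry unitary. The two constructions undo each other.

  The passage to C*-algebras is \<open>univ_cstar_iso\<close>. If \<open>p\<close> is a C*-seminorm on a free *-algebra that
  respects the relations, then the quotient by its null ideal is a *-algebra in which the relations
  hold exactly, and the algebraic comparison applies there. It shows that substituting generators
  pulls admissible seminorms back to admissible seminorms, in both directions, and that the two
  substitutions are inverse to each other up to elements of seminorm zero. So they are isometric for
  the maximal seminorms and extend to mutually inverse maps of the completions.

  For the boundary quotient, an isomorphism carries generated closed ideals to generated closed
  ideals, so it suffices to compare two ideals of the semigroup algebra: the one generated by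
  \<open>1 - \<Sum>x. e x\<close>, where \<open>e x\<close> belongs to the right ideal of the letter \<open>x\<close>, and the one generated by
  the products of the \<open>1 - e\<close> over foundation sets. The letters are a foundation set, and their product
  is \<open>1 - \<Sum>x. e x\<close> by orthogonality (\<open>letter_defects\<close>). In the other direction
  (\<open>finprod_defect_in_ideal\<close>), modulo \<open>1 - \<Sum>x. e x\<close> the unit is the sum of the projections of all
  words of any fixed length; if that length is at least that of every word in the foundation set \<open>F\<close>,
  then every such word has a prefix from \<open>F\<close>, so its projection annihilates the product over \<open>F\<close>.\<close>

section \<open>Quotients of seminormed *-algebras\<close>

text \<open>The ring axioms mention the five ring operations only, so they pass between records of different
  types that agree in these fields.\<close>

lemma ring_transfer:
  assumes "ring R" and "carrier S = carrier R" "mult S = mult R" "one S = one R"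
    "zero S = zero R" "add S = add R"
  shows "ring S"
proof -
  interpret R: ring R by fact
  show ?thesis
  proof (rule ringI)
    show "abelian_group S"
      by (rule abelian_groupI)
        (use assms in \<open>auto simp: R.a_ac intro: R.l_neg\<close>)
    show "Group.monoid S"
      by (rule monoidI) (use assms in \<open>auto simp: R.m_assoc\<close>)
  qed (use assms in \<open>auto simp: R.l_distr R.r_distr\<close>)
qed

context star_algebra
begin

lemma scl_zero_left: "a \<in> carrier A \<Longrightarrow> scl A 0 a = \<zero>"
  using scl_add_left[of a 0 0] scl_closed[of a 0] by simp

lemma scl_minus_one:
  assumes "a \<in> carrier A" shows "scl A (-1) a = \<ominus> a"
proof -
  have "a \<oplus> scl A (-1) a = scl A (1 + (-1)) a"
    using assms by (simp only: scl_add_left scl_one)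
  then have "a \<oplus> scl A (-1) a = \<zero>"
    using assms by (simp add: scl_zero_left)
  then show ?thesis
    using assms scl_closed minus_equality[of "scl A (-1) a" a] a_comm by simp
qed

lemma minus_eq_scl: "\<lbrakk>a \<in> carrier A; b \<in> carrier A\<rbrakk> \<Longrightarrow> a \<ominus> b = a \<oplus> scl A (-1) b"
  by (simp add: a_minus_def scl_minus_one)

lemma adj_one: "adj A \<one> = \<one>"
proof -
  have "adj A (adj A \<one> \<otimes> \<one>) = adj A \<one> \<otimes> adj A (adj A \<one>)"
    by (rule adj_mult) (auto simp: adj_closed)
  then show ?thesis by (simp add: adj_adj adj_closed)
qed

lemma adj_zero: "adj A \<zero> = \<zero>"
  using adj_scl[of \<one> 0] by (simp add: scl_zero_left adj_closed)

lemma scl_minus: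
  "\<lbrakk>a \<in> carrier A; b \<in> carrier A\<rbrakk> \<Longrightarrow> scl A c (a \<ominus> b) = scl A c a \<ominus> scl A c b"
  by (simp add: minus_eq_scl scl_closed scl_add_right scl_scl)

lemma adj_minus:
  "\<lbrakk>a \<in> carrier A; b \<in> carrier A\<rbrakk> \<Longrightarrow> adj A (a \<ominus> b) = adj A a \<ominus> adj A b"
  by (simp add: minus_eq_scl scl_closed adj_closed adj_add adj_scl)

end

lemma star_homD:
  assumes "star_hom A B f"
  shows "a \<in> carrier A \<Longrightarrow> f a \<in> carrier B"
    and "\<lbrakk>a \<in> carrier A; b \<in> carrier A\<rbrakk> \<Longrightarrow> f (a \<otimes>\<^bsub>A\<^esub> b) = f a \<otimes>\<^bsub>B\<^esub> f b"
    and "\<lbrakk>a \<in> carrier A; b \<in> carrier A\<rbrakk> \<Longrightarrow> f (a \<oplus>\<^bsub>A\<^esub> b) = f a \<oplus>\<^bsub>B\<^esub> f b"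
    and "f \<one>\<^bsub>A\<^esub> = \<one>\<^bsub>B\<^esub>"
    and "a \<in> carrier A \<Longrightarrow> f (scl A c a) = scl B c (f a)"
    and "a \<in> carrier A \<Longrightarrow> f (adj A a) = adj B (f a)"
  using assms unfolding star_hom_def
  by (auto simp: ring_hom_closed ring_hom_mult ring_hom_add ring_hom_one)

lemma star_homI:
  assumes "\<And>a. a \<in> carrier A \<Longrightarrow> f a \<in> carrier B"
    and "\<And>a b. \<lbrakk>a \<in> carrier A; b \<in> carrier A\<rbrakk> \<Longrightarrow> f (a \<otimes>\<^bsub>A\<^esub> b) = f a \<otimes>\<^bsub>B\<^esub> f b"
    and "\<And>a b. \<lbrakk>a \<in> carrier A; b \<in> carrier A\<rbrakk> \<Longrightarrow> f (a \<oplus>\<^bsub>A\<^esub> b) = f a \<oplus>\<^bsub>B\<^esub> f b"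
    and "f \<one>\<^bsub>A\<^esub> = \<one>\<^bsub>B\<^esub>"
    and "\<And>c a. a \<in> carrier A \<Longrightarrow> f (scl A c a) = scl B c (f a)"
    and "\<And>a. a \<in> carrier A \<Longrightarrow> f (adj A a) = adj B (f a)"
  shows "star_hom A B f"
  using assms unfolding star_hom_def by (auto intro: ring_hom_memI)

lemma star_hom_comp:
  "\<lbrakk>star_hom A B f; star_hom B C g\<rbrakk> \<Longrightarrow> star_hom A C (g \<circ> f)"
  by (rule star_homI) (simp_all add: star_homD)

lemma star_hom_zero_minus:
  assumes "star_algebra A" "star_algebra B" "star_hom A B f"
  shows "f \<zero>\<^bsub>A\<^esub> = \<zero>\<^bsub>B\<^esub>"
    and "\<lbrakk>a \<in> carrier A; b \<in> carrier A\<rbrakk> \<Longrightarrow> f (a \<ominus>\<^bsub>A\<^esub> b) = f a \<ominus>\<^bsub>B\<^esub> f b"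
proof -
  interpret A: star_algebra A by fact
  interpret B: star_algebra B by fact
  note h = star_homD[OF assms(3)]
  show "f \<zero>\<^bsub>A\<^esub> = \<zero>\<^bsub>B\<^esub>"
    using h(5)[OF A.one_closed, of 0] by (simp add: A.scl_zero_left B.scl_zero_left h)
  show "\<lbrakk>a \<in> carrier A; b \<in> carrier A\<rbrakk> \<Longrightarrow> f (a \<ominus>\<^bsub>A\<^esub> b) = f a \<ominus>\<^bsub>B\<^esub> f b"
    by (simp add: A.minus_eq_scl B.minus_eq_scl h A.scl_closed)
qed

lemma cstar_seminormD:
  assumes "cstar_seminorm A p"
  shows "a \<in> carrier A \<Longrightarrow> 0 \<le> p a"
    and "\<lbrakk>a \<in> carrier A; b \<in> carrier A\<rbrakk> \<Longrightarrow> p (a \<oplus>\<^bsub>A\<^esub> b) \<le> p a + p b"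
    and "a \<in> carrier A \<Longrightarrow> p (scl A c a) = cmod c * p a"
    and "\<lbrakk>a \<in> carrier A; b \<in> carrier A\<rbrakk> \<Longrightarrow> p (a \<otimes>\<^bsub>A\<^esub> b) \<le> p a * p b"
    and "a \<in> carrier A \<Longrightarrow> p (adj A a \<otimes>\<^bsub>A\<^esub> a) = (p a)\<^sup>2"
  using assms by (auto simp: cstar_seminorm_def)

context seminormed_star_algebra
begin

lemmas nrm_nonneg = cstar_seminormD(1)[OF seminorm]
  and nrm_triangle = cstar_seminormD(2)[OF seminorm]
  and nrm_scl = cstar_seminormD(3)[OF seminorm]
  and nrm_mult = cstar_seminormD(4)[OF seminorm]
  and nrm_cstar = cstar_seminormD(5)[OF seminorm]

lemma nrm_zero: "nrm A \<zero> = 0"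
  using nrm_scl[of \<one> 0] by (simp add: scl_zero_left)

lemma nrm_minus_commute:
  assumes "a \<in> carrier A" "b \<in> carrier A" shows "nrm A (a \<ominus> b) = nrm A (b \<ominus> a)"
proof -
  have "a \<ominus> b = scl A (-1) (b \<ominus> a)"
    using assms by (simp add: scl_minus_one minus_add a_minus_def a_comm)
  then show ?thesis using assms by (simp add: nrm_scl)
qed

lemma nrm_minus_trans:
  assumes "a \<in> carrier A" "b \<in> carrier A" "c \<in> carrier A"
  shows "nrm A (a \<ominus> c) \<le> nrm A (a \<ominus> b) + nrm A (b \<ominus> c)"
proof -
  have "a \<ominus> c = (a \<ominus> b) \<oplus> (b \<ominus> c)"
    using assms by (simp add: a_minus_def a_assoc r_neg1)
  then show ?thesis using assms nrm_triangle[of "a \<ominus> b" "b \<ominus> c"] by simp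
qed

lemma nrm_diff_le:
  assumes "a \<in> carrier A" "b \<in> carrier A"
  shows "\<bar>nrm A a - nrm A b\<bar> \<le> nrm A (a \<ominus> b)"
proof -
  have "a = (a \<ominus> b) \<oplus> b" "b = (b \<ominus> a) \<oplus> a"
    using assms by (simp_all add: a_minus_def a_assoc l_neg)
  then have "nrm A a \<le> nrm A (a \<ominus> b) + nrm A b" "nrm A b \<le> nrm A (b \<ominus> a) + nrm A a"
    using assms nrm_triangle[of "a \<ominus> b" b] nrm_triangle[of "b \<ominus> a" a] by simp_all
  then show ?thesis using nrm_minus_commute[OF assms] by simp
qed

text \<open>The C*-identity forces the involution to be isometric: \<open>\<parallel>a\<parallel>\<^sup>2 = \<parallel>a\<^sup>* a\<parallel> \<le> \<parallel>a\<^sup>*\<parallel> \<parallel>a\<parallel>\<close>.\<close>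

lemma nrm_adj_le:
  assumes "a \<in> carrier A" shows "nrm A a \<le> nrm A (adj A a)"
proof -
  have "nrm A a * nrm A a \<le> nrm A (adj A a) * nrm A a"
    using nrm_cstar[OF assms] nrm_mult[of "adj A a" a] assms by (simp add: adj_closed power2_eq_square)
  then show ?thesis
    using nrm_nonneg[OF assms] nrm_nonneg[of "adj A a"] assms adj_closed
    by (cases "nrm A a = 0") (auto simp: mult_le_cancel_right)
qed

lemma nrm_adj: "a \<in> carrier A \<Longrightarrow> nrm A (adj A a) = nrm A a"
  using nrm_adj_le[of a] nrm_adj_le[of "adj A a"] by (simp add: adj_closed adj_adj)

end

definition null_ideal :: "('a, 'm) normed_star_alg_scheme \<Rightarrow> 'a set" where
  "null_ideal A = {a \<in> carrier A. nrm A a = 0}"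

lemma quot_alg_simps:
  "carrier (quot_alg A I) = (quot_map A I) ` carrier A"
  "mult (quot_alg A I) = mult (A Quot I)"
  "one (quot_alg A I) = quot_map A I \<one>\<^bsub>A\<^esub>"
  "zero (quot_alg A I) = I"
  "add (quot_alg A I) = set_add A"
  "scl (quot_alg A I) = (\<lambda>c Y. I <+>\<^bsub>A\<^esub> scl A c ` Y)"
  "adj (quot_alg A I) = (\<lambda>Y. adj A ` Y)"
  "nrm (quot_alg A I) = (\<lambda>Y. Inf (nrm A ` Y))"
  by (auto simp: quot_alg_def FactRing_def quot_map_def A_RCOSETS_def')

context seminormed_star_algebra
begin

lemma ideal_null: "ideal (null_ideal A) A"
proof (rule idealI[OF ring_axioms])
  have "\<And>a b. \<lbrakk>a \<in> null_ideal A; b \<in> null_ideal A\<rbrakk> \<Longrightarrow> a \<oplus> b \<in> null_ideal A"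
    using nrm_triangle nrm_nonneg unfolding null_ideal_def
    by (metis (mono_tags, lifting) a_closed add.right_neutral mem_Collect_eq order_antisym)
  moreover have "\<And>a. a \<in> null_ideal A \<Longrightarrow> \<ominus> a \<in> null_ideal A"
    unfolding null_ideal_def by (auto simp: scl_minus_one[symmetric] scl_closed nrm_scl)
  ultimately show "subgroup (null_ideal A) (add_monoid A)"
    by (intro add.subgroupI) (auto simp: null_ideal_def a_inv_def intro: nrm_zero)
next
  fix a x assume ax: "a \<in> null_ideal A" "x \<in> carrier A"
  then have "nrm A (x \<otimes> a) \<le> 0" "nrm A (a \<otimes> x) \<le> 0"
    using nrm_mult[of x a] nrm_mult[of a x] by (auto simp: null_ideal_def)
  then show "x \<otimes> a \<in> null_ideal A" "a \<otimes> x \<in> null_ideal A"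
    using ax nrm_nonneg[of "x \<otimes> a"] nrm_nonneg[of "a \<otimes> x"] by (auto simp: null_ideal_def)
qed

text \<open>Describing a coset of the null ideal as the set of elements at distance zero turns all statements
  about the operations on cosets into norm estimates.\<close>

lemma quot_map_null_eq:
  assumes "a \<in> carrier A"
  shows "quot_map A (null_ideal A) a = {b \<in> carrier A. nrm A (b \<ominus> a) = 0}"
proof (intro equalityI subsetI)
  fix b assume "b \<in> quot_map A (null_ideal A) a"
  then obtain n where n: "n \<in> carrier A" "nrm A n = 0" "b = n \<oplus> a"
    by (auto simp: quot_map_def a_r_coset_def' null_ideal_def)
  moreover have "n \<oplus> a \<ominus> a = n"
    using n(1) assms by (simp add: a_minus_def a_assoc r_neg)
  ultimately show "b \<in> {b \<in> carrier A. nrm A (b \<ominus> a) = 0}" using assms by simp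
next
  fix b assume b: "b \<in> {b \<in> carrier A. nrm A (b \<ominus> a) = 0}"
  then have "b = (b \<ominus> a) \<oplus> a" using assms by (simp add: a_minus_def a_assoc l_neg)
  with b assms show "b \<in> quot_map A (null_ideal A) a"
    by (auto simp: quot_map_def a_r_coset_def' null_ideal_def intro: bexI[of _ "b \<ominus> a"])
qed

lemma quot_map_null_self: "a \<in> carrier A \<Longrightarrow> a \<in> quot_map A (null_ideal A) a"
  by (simp add: quot_map_null_eq nrm_zero r_neg a_minus_def)

lemma quot_map_null_eq_iff:
  assumes "a \<in> carrier A" "b \<in> carrier A"
  shows "quot_map A (null_ideal A) a = quot_map A (null_ideal A) b \<longleftrightarrow> nrm A (a \<ominus> b) = 0"
proof
  show "quot_map A (null_ideal A) a = quot_map A (null_ideal A) b \<Longrightarrow> nrm A (a \<ominus> b) = 0"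
    using quot_map_null_self[of a] assms by (simp add: quot_map_null_eq)
  assume 0: "nrm A (a \<ominus> b) = 0"
  have "nrm A (c \<ominus> a) = nrm A (c \<ominus> b)" if "c \<in> carrier A" for c
    using nrm_minus_trans[of c a b] nrm_minus_trans[of c b a] nrm_minus_commute[of a b] 0 assms that
    by simp
  then show "quot_map A (null_ideal A) a = quot_map A (null_ideal A) b"
    using assms by (auto simp: quot_map_null_eq)
qed

lemma quot_null_scl:
  assumes a: "a \<in> carrier A"
  shows "scl (quot_alg A (null_ideal A)) c (quot_map A (null_ideal A) a)
    = quot_map A (null_ideal A) (scl A c a)"
proof -
  let ?N = "null_ideal A"
  have "?N <+>\<^bsub>A\<^esub> scl A c ` quot_map A ?N a = quot_map A ?N (scl A c a)"
  proof (intro equalityI subsetI)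
    fix d assume "d \<in> ?N <+>\<^bsub>A\<^esub> scl A c ` quot_map A ?N a"
    then obtain n b where n: "n \<in> carrier A" "nrm A n = 0" and b: "b \<in> carrier A" "nrm A (b \<ominus> a) = 0"
      and d: "d = n \<oplus> scl A c b"
      using a by (auto simp: set_add_def' quot_map_null_eq) (auto simp: null_ideal_def)
    have "d \<ominus> scl A c a = n \<oplus> scl A c (b \<ominus> a)"
      using n b a d by (simp add: scl_minus scl_closed) (simp add: a_minus_def scl_closed a_assoc)
    moreover have "nrm A (n \<oplus> scl A c (b \<ominus> a)) \<le> 0"
      using nrm_triangle[of n "scl A c (b \<ominus> a)"] n b a by (simp add: nrm_scl scl_closed)
    moreover have "0 \<le> nrm A (n \<oplus> scl A c (b \<ominus> a))"
      using n b a by (intro nrm_nonneg) (simp add: scl_closed)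
    ultimately show "d \<in> quot_map A ?N (scl A c a)"
      using n b a d by (simp add: quot_map_null_eq scl_closed)
  next
    fix d assume "d \<in> quot_map A ?N (scl A c a)"
    then obtain n where "n \<in> ?N" "d = n \<oplus> scl A c a" by (auto simp: quot_map_def a_r_coset_def')
    then show "d \<in> ?N <+>\<^bsub>A\<^esub> scl A c ` quot_map A ?N a"
      using quot_map_null_self[OF a] unfolding set_add_def' by blast
  qed
  then show ?thesis by (simp add: quot_alg_simps)
qed

lemma quot_null_adj:
  assumes a: "a \<in> carrier A"
  shows "adj (quot_alg A (null_ideal A)) (quot_map A (null_ideal A) a)
    = quot_map A (null_ideal A) (adj A a)"
proof -
  have *: "nrm A (adj A b \<ominus> adj A c) = nrm A (b \<ominus> c)" if "b \<in> carrier A" "c \<in> carrier A" for b c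
    using that nrm_adj[of "b \<ominus> c"] by (simp add: adj_minus)
  have "d \<in> adj A ` quot_map A (null_ideal A) a" if "d \<in> quot_map A (null_ideal A) (adj A a)" for d
    using that a *[of "adj A d" a] *[of d "adj A a"]
    by (intro image_eqI[of _ _ "adj A d"]) (auto simp: quot_map_null_eq adj_closed adj_adj)
  then have "adj A ` quot_map A (null_ideal A) a = quot_map A (null_ideal A) (adj A a)"
    using a * by (auto simp: quot_map_null_eq adj_closed)
  then show ?thesis by (simp add: quot_alg_simps)
qed

lemma quot_null_nrm:
  assumes a: "a \<in> carrier A"
  shows "nrm (quot_alg A (null_ideal A)) (quot_map A (null_ideal A) a) = nrm A a"
proof -
  have eq: "nrm A b = nrm A a" if "b \<in> quot_map A (null_ideal A) a" for b
  proof -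
    have "b \<in> carrier A" "nrm A (b \<ominus> a) = 0" using that a by (simp_all add: quot_map_null_eq)
    then show ?thesis using nrm_diff_le[of b a] a by simp
  qed
  have "nrm A ` quot_map A (null_ideal A) a = {nrm A a}"
    using quot_map_null_self[OF a] eq by blast
  then show ?thesis by (simp add: quot_alg_simps)
qed

lemma quot_null_ops:
  assumes "a \<in> carrier A" "b \<in> carrier A"
  shows "quot_map A (null_ideal A) a \<otimes>\<^bsub>quot_alg A (null_ideal A)\<^esub> quot_map A (null_ideal A) b
      = quot_map A (null_ideal A) (a \<otimes> b)"
    and "quot_map A (null_ideal A) a \<oplus>\<^bsub>quot_alg A (null_ideal A)\<^esub> quot_map A (null_ideal A) b
      = quot_map A (null_ideal A) (a \<oplus> b)"
proof -
  interpret N: ideal "null_ideal A" A by (rule ideal_null)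
  show "quot_map A (null_ideal A) a \<otimes>\<^bsub>quot_alg A (null_ideal A)\<^esub> quot_map A (null_ideal A) b
      = quot_map A (null_ideal A) (a \<otimes> b)"
    and "quot_map A (null_ideal A) a \<oplus>\<^bsub>quot_alg A (null_ideal A)\<^esub> quot_map A (null_ideal A) b
      = quot_map A (null_ideal A) (a \<oplus> b)"
    using assms by (simp_all add: quot_alg_simps FactRing_def quot_map_def N.rcoset_mult_add N.a_rcos_sum)
qed

lemma star_hom_quot_map_null:
  "star_hom A (quot_alg A (null_ideal A)) (quot_map A (null_ideal A))"
  by (rule star_homI) (auto simp: quot_null_scl quot_null_adj quot_null_ops, auto simp: quot_alg_simps)

lemma star_algebra_quot_null: "star_algebra (quot_alg A (null_ideal A))"
proof -
  interpret N: ideal "null_ideal A" A by (rule ideal_null)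
  have "ring (quot_alg A (null_ideal A))"
    by (rule ring_transfer[OF N.quotient_is_ring]) (auto simp: quot_alg_def)
  moreover have *: "\<exists>a\<in>carrier A. Y = quot_map A (null_ideal A) a" if "Y \<in> carrier (quot_alg A (null_ideal A))" for Y
    using that by (auto simp: quot_alg_simps)
  have c: "quot_map A (null_ideal A) a \<in> carrier (quot_alg A (null_ideal A))" if "a \<in> carrier A" for a
    using that by (simp add: quot_alg_simps)
  note ops = quot_null_scl quot_null_adj quot_null_ops scl_closed adj_closed c scl_add_right scl_add_left
    scl_scl scl_one scl_mult_left scl_mult_right adj_adj adj_add adj_mult adj_scl
  have "star_algebra_axioms (quot_alg A (null_ideal A))"
    by (rule star_algebra_axioms.intro) (auto dest!: * simp: ops)
  ultimately show ?thesis by (simp add: star_algebra_def)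
qed

end

text \<open>Elements of seminorm zero disappear in the quotient, so an isometric homomorphism is injective there,
  and hitting every element up to seminorm zero is enough for surjectivity.\<close>

lemma quot_null_iso:
  assumes "seminormed_star_algebra A" "seminormed_star_algebra B" and f: "star_hom A B f"
    and iso: "\<And>a. a \<in> carrier A \<Longrightarrow> nrm B (f a) = nrm A a"
    and dense: "\<And>b. b \<in> carrier B \<Longrightarrow> \<exists>a\<in>carrier A. nrm B (f a \<ominus>\<^bsub>B\<^esub> b) = 0"
  shows "\<exists>\<phi>. cstar_iso (quot_alg A (null_ideal A)) (quot_alg B (null_ideal B)) \<phi> \<and>
    (\<forall>a\<in>carrier A. \<phi> (quot_map A (null_ideal A) a) = quot_map B (null_ideal B) (f a))"
proof -
  interpret A: seminormed_star_algebra A by fact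
  interpret B: seminormed_star_algebra B by fact
  note f' = star_homD[OF f] star_hom_zero_minus[OF A.star_algebra_axioms B.star_algebra_axioms f]
  let ?QA = "quot_alg A (null_ideal A)" and ?QB = "quot_alg B (null_ideal B)"
  let ?a = "quot_map A (null_ideal A)" and ?b = "quot_map B (null_ideal B)"
  define \<phi> where "\<phi> Y = ?b (f (SOME a. a \<in> Y))" for Y
  have eq: "?b (f a) = ?b (f a') \<longleftrightarrow> ?a a = ?a a'" if "a \<in> carrier A" "a' \<in> carrier A" for a a'
    using that iso[of "a \<ominus>\<^bsub>A\<^esub> a'"] by (simp add: A.quot_map_null_eq_iff B.quot_map_null_eq_iff f')
  have \<phi>: "\<phi> (?a a) = ?b (f a)" if a: "a \<in> carrier A" for a
  proof -
    have "(SOME a'. a' \<in> ?a a) \<in> ?a a" using A.quot_map_null_self[OF a] by (rule someI)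
    then obtain a' where a': "a' = (SOME a'. a' \<in> ?a a)" "a' \<in> ?a a" by blast
    from a'(2) have "a' \<in> carrier A" "nrm A (a' \<ominus>\<^bsub>A\<^esub> a) = 0"
      using a by (simp_all add: A.quot_map_null_eq)
    then have "a' \<in> carrier A" "?a a' = ?a a"
      using a by (simp_all add: A.quot_map_null_eq_iff)
    then show ?thesis unfolding \<phi>_def a'(1)[symmetric] using a by (simp only: eq)
  qed
  have cA: "carrier ?QA = ?a ` carrier A" and cB: "carrier ?QB = ?b ` carrier B"
    by (simp_all add: quot_alg_simps)
  have one: "\<one>\<^bsub>?QA\<^esub> = ?a \<one>\<^bsub>A\<^esub>" "\<one>\<^bsub>?QB\<^esub> = ?b \<one>\<^bsub>B\<^esub>"
    by (simp_all add: quot_alg_simps)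
  have "star_hom ?QA ?QB \<phi>"
    by (rule star_homI)
      (auto simp: cA cB \<phi> A.quot_null_ops B.quot_null_ops A.quot_null_scl B.quot_null_scl A.quot_null_adj
        B.quot_null_adj A.scl_closed A.adj_closed f' one)
  moreover have "bij_betw \<phi> (carrier ?QA) (carrier ?QB)"
    unfolding bij_betw_def
  proof
    show "inj_on \<phi> (carrier ?QA)" by (auto simp: inj_on_def cA \<phi> eq)
    have "?b b \<in> \<phi> ` ?a ` carrier A" if b: "b \<in> carrier B" for b
    proof -
      obtain a where "a \<in> carrier A" "nrm B (f a \<ominus>\<^bsub>B\<^esub> b) = 0" using dense[OF b] by blast
      then have "?b b = \<phi> (?a a)" using b B.nrm_minus_commute[of b "f a"]
        by (simp add: \<phi> B.quot_map_null_eq_iff f')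
      then show ?thesis using \<open>a \<in> carrier A\<close> by blast
    qed
    then show "\<phi> ` carrier ?QA = carrier ?QB" by (auto simp: cA cB \<phi> f')
  qed
  moreover have "\<forall>Y\<in>carrier ?QA. nrm ?QB (\<phi> Y) = nrm ?QA Y"
    by (auto simp: cA \<phi> A.quot_null_nrm B.quot_null_nrm f' iso)
  ultimately show ?thesis using \<phi> unfolding cstar_iso_def by blast
qed

section \<open>Completions\<close>

lemma cauchy_alg_simps [simp]:
  "carrier (cauchy_alg A) = cauchy_seqs A"
  "mult (cauchy_alg A) = (\<lambda>s t n. s n \<otimes>\<^bsub>A\<^esub> t n)"
  "one (cauchy_alg A) = (\<lambda>n. \<one>\<^bsub>A\<^esub>)"
  "zero (cauchy_alg A) = (\<lambda>n. \<zero>\<^bsub>A\<^esub>)"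
  "add (cauchy_alg A) = (\<lambda>s t n. s n \<oplus>\<^bsub>A\<^esub> t n)"
  "scl (cauchy_alg A) = (\<lambda>c s n. scl A c (s n))"
  "adj (cauchy_alg A) = (\<lambda>s n. adj A (s n))"
  "nrm (cauchy_alg A) = (\<lambda>s. lim (\<lambda>n. nrm A (s n)))"
  by (simp_all add: cauchy_alg_def)

lemma cauchy_seqs_closed: "s \<in> cauchy_seqs A \<Longrightarrow> s n \<in> carrier A"
  by (simp add: cauchy_seqs_def)

lemma cauchy_seqsD:
  "\<lbrakk>s \<in> cauchy_seqs A; 0 < \<epsilon>\<rbrakk> \<Longrightarrow> \<exists>N. \<forall>m\<ge>N. \<forall>n\<ge>N. nrm A (s m \<ominus>\<^bsub>A\<^esub> s n) < \<epsilon>"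
  by (simp add: cauchy_seqs_def)

text \<open>The pointwise sum, product, multiple and adjoint of Cauchy sequences are Cauchy by this comparison.\<close>

lemma cauchy_seqs_dominated:
  assumes s: "s \<in> cauchy_seqs A" and t: "t \<in> cauchy_seqs B"
    and r: "\<And>n. r n \<in> carrier C" and K: "0 < K" "0 < L"
    and le: "\<And>m n. nrm C (r m \<ominus>\<^bsub>C\<^esub> r n) \<le> K * nrm A (s m \<ominus>\<^bsub>A\<^esub> s n) + L * nrm B (t m \<ominus>\<^bsub>B\<^esub> t n)"
  shows "r \<in> cauchy_seqs C"
  unfolding cauchy_seqs_def
proof (intro CollectI conjI allI impI r)
  fix \<epsilon> :: real assume e: "\<epsilon> > 0"
  obtain M where M: "nrm A (s m \<ominus>\<^bsub>A\<^esub> s n) < \<epsilon> / (2 * K)" if "m \<ge> M" "n \<ge> M" for m n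
    using cauchy_seqsD[OF s, of "\<epsilon> / (2 * K)"] e K by auto
  obtain N where N: "nrm B (t m \<ominus>\<^bsub>B\<^esub> t n) < \<epsilon> / (2 * L)" if "m \<ge> N" "n \<ge> N" for m n
    using cauchy_seqsD[OF t, of "\<epsilon> / (2 * L)"] e K by auto
  have "nrm C (r m \<ominus>\<^bsub>C\<^esub> r n) < \<epsilon>" if "m \<ge> max M N" "n \<ge> max M N" for m n
  proof -
    have "K * nrm A (s m \<ominus>\<^bsub>A\<^esub> s n) < K * (\<epsilon> / (2 * K))" "L * nrm B (t m \<ominus>\<^bsub>B\<^esub> t n) < L * (\<epsilon> / (2 * L))"
      using M[of m n] N[of m n] that K by (intro mult_strict_left_mono; simp)+
    then have "K * nrm A (s m \<ominus>\<^bsub>A\<^esub> s n) + L * nrm B (t m \<ominus>\<^bsub>B\<^esub> t n) < \<epsilon>"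
      using K by (simp add: field_simps)
    then show ?thesis using le[of m n] by linarith
  qed
  then show "\<exists>N. \<forall>m\<ge>N. \<forall>n\<ge>N. nrm C (r m \<ominus>\<^bsub>C\<^esub> r n) < \<epsilon>" by blast
qed

context seminormed_star_algebra
begin

lemma cauchy_seqs_const: "a \<in> carrier A \<Longrightarrow> (\<lambda>n. a) \<in> cauchy_seqs A"
  by (auto simp: cauchy_seqs_def r_neg a_minus_def nrm_zero)

lemma cauchy_seqs_nrm_convergent:
  assumes s: "s \<in> cauchy_seqs A" shows "convergent (\<lambda>n. nrm A (s n))"
proof -
  have "Cauchy (\<lambda>n. nrm A (s n))"
  proof (rule metric_CauchyI)
    fix e :: real assume "e > 0"
    then obtain N where "\<forall>m\<ge>N. \<forall>n\<ge>N. nrm A (s m \<ominus> s n) < e" using cauchy_seqsD[OF s] by blast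
    then show "\<exists>M. \<forall>m\<ge>M. \<forall>n\<ge>M. dist (nrm A (s m)) (nrm A (s n)) < e"
      using nrm_diff_le cauchy_seqs_closed[OF s] unfolding dist_real_def by (meson le_less_trans)
  qed
  then show ?thesis by (simp add: Cauchy_convergent_iff)
qed

lemma cauchy_seqs_nrm_lim:
  "s \<in> cauchy_seqs A \<Longrightarrow> (\<lambda>n. nrm A (s n)) \<longlonglongrightarrow> lim (\<lambda>n. nrm A (s n))"
  using cauchy_seqs_nrm_convergent convergent_LIMSEQ_iff by blast

lemma cauchy_seqs_bounded:
  assumes s: "s \<in> cauchy_seqs A" obtains K where "0 < K" "\<And>n. nrm A (s n) \<le> K"
proof -
  have "Bseq (\<lambda>n. nrm A (s n))"
    using cauchy_seqs_nrm_convergent[OF s] by (rule convergent_imp_Bseq)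
  then obtain K where "0 < K" "\<forall>n. norm (nrm A (s n)) \<le> K" by (rule BseqE)
  then have "nrm A (s n) \<le> K" for n
    using abs_ge_self[of "nrm A (s n)"] by (metis order_trans real_norm_def)
  then show thesis using that[of K] \<open>0 < K\<close> by blast
qed

lemma cauchy_seqs_add:
  assumes s: "s \<in> cauchy_seqs A" and t: "t \<in> cauchy_seqs A"
  shows "(\<lambda>n. s n \<oplus> t n) \<in> cauchy_seqs A"
proof (rule cauchy_seqs_dominated[OF s t, where K = 1 and L = 1])
  note c = cauchy_seqs_closed[OF s] cauchy_seqs_closed[OF t]
  show "s n \<oplus> t n \<in> carrier A" for n by (simp add: c)
  fix m n
  have "s m \<oplus> t m \<ominus> (s n \<oplus> t n) = (s m \<ominus> s n) \<oplus> (t m \<ominus> t n)"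
    using c by (simp add: a_minus_def minus_add a_ac)
  then show "nrm A (s m \<oplus> t m \<ominus> (s n \<oplus> t n)) \<le> 1 * nrm A (s m \<ominus> s n) + 1 * nrm A (t m \<ominus> t n)"
    using nrm_triangle[of "s m \<ominus> s n" "t m \<ominus> t n"] c by simp
qed simp_all

lemma cauchy_seqs_mult:
  assumes s: "s \<in> cauchy_seqs A" and t: "t \<in> cauchy_seqs A"
  shows "(\<lambda>n. s n \<otimes> t n) \<in> cauchy_seqs A"
proof -
  obtain K where K: "0 < K" "\<And>n. nrm A (s n) \<le> K" using cauchy_seqs_bounded[OF s] by blast
  obtain L where L: "0 < L" "\<And>n. nrm A (t n) \<le> L" using cauchy_seqs_bounded[OF t] by blast
  note c = cauchy_seqs_closed[OF s] cauchy_seqs_closed[OF t]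
  show ?thesis
  proof (rule cauchy_seqs_dominated[OF s t _ L(1) K(1)])
    fix m n
    have "s m \<otimes> t m \<ominus> s n \<otimes> t n = (s m \<ominus> s n) \<otimes> t m \<oplus> s n \<otimes> (t m \<ominus> t n)"
      using c by (simp add: a_minus_def l_distr r_distr l_minus r_minus a_assoc r_neg1)
    moreover have "nrm A ((s m \<ominus> s n) \<otimes> t m) \<le> nrm A (s m \<ominus> s n) * L"
      using nrm_mult[of "s m \<ominus> s n" "t m"] c L(2)[of m] nrm_nonneg[of "s m \<ominus> s n"]
        mult_left_mono[OF L(2)[of m], of "nrm A (s m \<ominus> s n)"] by simp
    moreover have "nrm A (s n \<otimes> (t m \<ominus> t n)) \<le> K * nrm A (t m \<ominus> t n)"
      using nrm_mult[of "s n" "t m \<ominus> t n"] c nrm_nonneg[of "t m \<ominus> t n"]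
        mult_right_mono[OF K(2)[of n], of "nrm A (t m \<ominus> t n)"] by simp
    moreover have "nrm A ((s m \<ominus> s n) \<otimes> t m \<oplus> s n \<otimes> (t m \<ominus> t n))
        \<le> nrm A ((s m \<ominus> s n) \<otimes> t m) + nrm A (s n \<otimes> (t m \<ominus> t n))"
      using c by (intro nrm_triangle) simp_all
    ultimately show "nrm A (s m \<otimes> t m \<ominus> s n \<otimes> t n) \<le> L * nrm A (s m \<ominus> s n) + K * nrm A (t m \<ominus> t n)"
      by (simp add: mult.commute)
  qed (simp add: c)
qed

lemma cauchy_seqs_scl:
  assumes s: "s \<in> cauchy_seqs A" shows "(\<lambda>n. scl A c (s n)) \<in> cauchy_seqs A"
proof (rule cauchy_seqs_dominated[OF s s, where K = "cmod c + 1" and L = 1])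
  note c = cauchy_seqs_closed[OF s]
  show "scl A c (s n) \<in> carrier A" for n by (simp add: c scl_closed)
  show "0 < cmod c + 1" by (simp add: add_nonneg_pos)
  fix m n
  have "nrm A (scl A c (s m) \<ominus> scl A c (s n)) = cmod c * nrm A (s m \<ominus> s n)"
    using c by (simp flip: scl_minus add: nrm_scl)
  then show "nrm A (scl A c (s m) \<ominus> scl A c (s n))
      \<le> (cmod c + 1) * nrm A (s m \<ominus> s n) + 1 * nrm A (s m \<ominus> s n)"
    using nrm_nonneg[of "s m \<ominus> s n"] c by (simp add: algebra_simps)
qed simp

lemma cauchy_seqs_adj:
  assumes s: "s \<in> cauchy_seqs A" shows "(\<lambda>n. adj A (s n)) \<in> cauchy_seqs A"
proof (rule cauchy_seqs_dominated[OF s s, where K = 1 and L = 1])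
  note c = cauchy_seqs_closed[OF s]
  show "adj A (s n) \<in> carrier A" for n by (simp add: c adj_closed)
  fix m n
  have "nrm A (adj A (s m) \<ominus> adj A (s n)) = nrm A (s m \<ominus> s n)"
    using c by (simp flip: adj_minus add: nrm_adj)
  then show "nrm A (adj A (s m) \<ominus> adj A (s n))
      \<le> 1 * nrm A (s m \<ominus> s n) + 1 * nrm A (s m \<ominus> s n)"
    using nrm_nonneg[of "s m \<ominus> s n"] c by simp
qed simp_all

lemma star_algebra_cauchy: "star_algebra (cauchy_alg A)"
proof -
  note c = cauchy_seqs_closed
  note cl = cauchy_seqs_add cauchy_seqs_mult cauchy_seqs_scl cauchy_seqs_adj cauchy_seqs_const
  have inv: "\<exists>t\<in>cauchy_seqs A. (\<lambda>n. t n \<oplus> s n) = (\<lambda>n. \<zero>)" if s: "s \<in> cauchy_seqs A" for s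
  proof (rule bexI[of _ "\<lambda>n. scl A (-1) (s n)"])
    show "(\<lambda>n. scl A (-1) (s n) \<oplus> s n) = (\<lambda>n. \<zero>)"
      using c[OF s] by (simp add: scl_minus_one l_neg)
  qed (rule cl(3)[OF s])
  have "abelian_group (cauchy_alg A)"
    by (rule abelian_groupI) (use inv in \<open>auto simp: cl c a_ac intro!: ext\<close>)
  moreover have "Group.monoid (cauchy_alg A)"
    by (rule monoidI) (auto simp: cl c m_assoc intro!: ext)
  ultimately have "ring (cauchy_alg A)"
    by (rule ringI) (auto simp: cl c l_distr r_distr intro!: ext)
  moreover have "star_algebra_axioms (cauchy_alg A)"
    by (rule star_algebra_axioms.intro)
      (auto simp: cl c scl_add_right scl_add_left
    scl_scl scl_one scl_mult_left scl_mult_right adj_adj adj_add adj_mult adj_scl intro!: ext)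
  ultimately show ?thesis by (simp add: star_algebra_def)
qed

lemma seminormed_cauchy: "seminormed_star_algebra (cauchy_alg A)"
proof -
  note c = cauchy_seqs_closed and L = cauchy_seqs_nrm_lim
  note cl = cauchy_seqs_add cauchy_seqs_mult cauchy_seqs_scl cauchy_seqs_adj cauchy_seqs_const
  let ?l = "\<lambda>s. lim (\<lambda>n. nrm A (s n))"
  have "cstar_seminorm (cauchy_alg A) ?l"
    unfolding cstar_seminorm_def cauchy_alg_simps
  proof (intro conjI ballI allI)
    fix s assume s: "s \<in> cauchy_seqs A"
    show "0 \<le> ?l s"
      using c[OF s] by (intro LIMSEQ_le_const[OF L[OF s]]) (auto intro: nrm_nonneg)
    show "?l (\<lambda>n. scl A k (s n)) = cmod k * ?l s" for k
      using c[OF s] tendsto_mult[OF tendsto_const[of "cmod k"] L[OF s]]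
      by (intro limI) (simp add: nrm_scl)
    show "?l (\<lambda>n. adj A (s n) \<otimes> s n) = (?l s)\<^sup>2"
      using c[OF s] tendsto_power[OF L[OF s], of 2] by (intro limI) (simp add: nrm_cstar)
    fix t assume t: "t \<in> cauchy_seqs A"
    show "?l (\<lambda>n. s n \<oplus> t n) \<le> ?l s + ?l t"
      using c[OF s] c[OF t]
      by (intro LIMSEQ_le[OF L[OF cl(1)[OF s t]] tendsto_add[OF L[OF s] L[OF t]]]) (auto intro: nrm_triangle)
    show "?l (\<lambda>n. s n \<otimes> t n) \<le> ?l s * ?l t"
      using c[OF s] c[OF t]
      by (intro LIMSEQ_le[OF L[OF cl(2)[OF s t]] tendsto_mult[OF L[OF s] L[OF t]]]) (auto intro: nrm_mult)
  qed
  then show ?thesis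
    using star_algebra_cauchy
    by (simp add: seminormed_star_algebra_def seminormed_star_algebra_axioms_def)
qed

text \<open>With the limit of the seminorms as seminorm, the null sequences are a null ideal; so the completion
  is a quotient of the kind treated above, applied to the algebra of Cauchy sequences.\<close>

lemma null_seqs_eq: "null_seqs A = null_ideal (cauchy_alg A)"
proof -
  have "(\<lambda>n. nrm A (s n)) \<longlonglongrightarrow> 0 \<longleftrightarrow> lim (\<lambda>n. nrm A (s n)) = 0" if "s \<in> cauchy_seqs A" for s
    using cauchy_seqs_nrm_lim[OF that] limI by metis
  then show ?thesis unfolding null_seqs_def null_ideal_def by simp blast
qed

lemma cauchy_minus:
  assumes "s \<in> cauchy_seqs A" "t \<in> cauchy_seqs A"
  shows "s \<ominus>\<^bsub>cauchy_alg A\<^esub> t = (\<lambda>n. s n \<ominus> t n)"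
proof -
  interpret C: star_algebra "cauchy_alg A" by (rule star_algebra_cauchy)
  show ?thesis
    using assms cauchy_seqs_closed[OF assms(1)] cauchy_seqs_closed[OF assms(2)]
    by (simp add: C.minus_eq_scl minus_eq_scl)
qed

lemma star_algebra_completion: "star_algebra (completion A)"
  unfolding completion_def null_seqs_eq
  by (rule seminormed_star_algebra.star_algebra_quot_null[OF seminormed_cauchy])

lemma star_hom_completion_map: "star_hom A (completion A) (completion_map A)"
proof -
  have "star_hom A (cauchy_alg A) (\<lambda>a n. a)"
    by (rule star_homI) (simp_all add: cauchy_seqs_const)
  from star_hom_comp[OF this seminormed_star_algebra.star_hom_quot_map_null[OF seminormed_cauchy]]
  show ?thesis by (simp add: completion_def null_seqs_eq completion_map_def[abs_def] comp_def)
qed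

lemma completion_map_eqI:
  assumes "a \<in> carrier A" "b \<in> carrier A" "nrm A (a \<ominus> b) = 0"
  shows "completion_map A a = completion_map A b"
proof -
  interpret C: seminormed_star_algebra "cauchy_alg A" by (rule seminormed_cauchy)
  show ?thesis using assms
    by (simp add: completion_map_def null_seqs_eq C.quot_map_null_eq_iff cauchy_seqs_const cauchy_minus)
qed

end

text \<open>The homomorphism acts termwise on Cauchy sequences. A preimage of a Cauchy sequence, up to seminorm
  zero, is chosen term by term and is again Cauchy because the homomorphism is isometric.\<close>

lemma completion_iso:
  assumes "seminormed_star_algebra A" "seminormed_star_algebra B" and f: "star_hom A B f"
    and iso: "\<And>a. a \<in> carrier A \<Longrightarrow> nrm B (f a) = nrm A a"
    and dense: "\<And>b. b \<in> carrier B \<Longrightarrow> \<exists>a\<in>carrier A. nrm B (f a \<ominus>\<^bsub>B\<^esub> b) = 0"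
  shows "\<exists>\<phi>. cstar_iso (completion A) (completion B) \<phi> \<and>
    (\<forall>a\<in>carrier A. \<phi> (completion_map A a) = completion_map B (f a))"
proof -
  interpret A: seminormed_star_algebra A by fact
  interpret B: seminormed_star_algebra B by fact
  note f' = star_homD[OF f] star_hom_zero_minus[OF A.star_algebra_axioms B.star_algebra_axioms f]
  have dom: "nrm B (f a \<ominus>\<^bsub>B\<^esub> f a') = nrm A (a \<ominus>\<^bsub>A\<^esub> a')" if "a \<in> carrier A" "a' \<in> carrier A" for a a'
    using that iso[of "a \<ominus>\<^bsub>A\<^esub> a'"] by (simp add: f')
  have fs: "(\<lambda>n. f (s n)) \<in> cauchy_seqs B" if s: "s \<in> cauchy_seqs A" for s
    using s by (simp add: cauchy_seqs_def dom f')
  have hom: "star_hom (cauchy_alg A) (cauchy_alg B) (\<lambda>s n. f (s n))"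
    by (rule star_homI) (simp_all add: fs f' cauchy_seqs_closed)
  have "\<exists>s\<in>carrier (cauchy_alg A). nrm (cauchy_alg B) ((\<lambda>n. f (s n)) \<ominus>\<^bsub>cauchy_alg B\<^esub> t) = 0"
    if t: "t \<in> carrier (cauchy_alg B)" for t
  proof -
    have t': "t n \<in> carrier B" for n using t by (simp add: cauchy_seqs_closed)
    obtain s where s: "s n \<in> carrier A" "nrm B (f (s n) \<ominus>\<^bsub>B\<^esub> t n) = 0" for n
      using dense[OF t'] by metis
    have "nrm A (s m \<ominus>\<^bsub>A\<^esub> s n) \<le> nrm B (t m \<ominus>\<^bsub>B\<^esub> t n)" for m n
    proof -
      have "nrm B (f (s m) \<ominus>\<^bsub>B\<^esub> f (s n)) \<le> nrm B (f (s m) \<ominus>\<^bsub>B\<^esub> t m) + nrm B (t m \<ominus>\<^bsub>B\<^esub> f (s n))"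
        "nrm B (t m \<ominus>\<^bsub>B\<^esub> f (s n)) \<le> nrm B (t m \<ominus>\<^bsub>B\<^esub> t n) + nrm B (t n \<ominus>\<^bsub>B\<^esub> f (s n))"
        by (rule B.nrm_minus_trans; simp add: s t' f')+
      then show ?thesis using s t' by (simp add: dom B.nrm_minus_commute[of "t n"] f')
    qed
    then have "s \<in> cauchy_seqs A"
      using t s(1) unfolding cauchy_alg_simps cauchy_seqs_def by simp (meson le_less_trans)
    moreover from this have "nrm (cauchy_alg B) ((\<lambda>n. f (s n)) \<ominus>\<^bsub>cauchy_alg B\<^esub> t) = 0"
      using t fs s by (simp add: B.cauchy_minus)
    ultimately show ?thesis by auto
  qed
  from quot_null_iso[OF A.seminormed_cauchy B.seminormed_cauchy hom _ this]
  obtain \<phi> where "cstar_iso (completion A) (completion B) \<phi>"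
    "\<And>s. s \<in> cauchy_seqs A \<Longrightarrow> \<phi> (quot_map (cauchy_alg A) (null_seqs A) s)
      = quot_map (cauchy_alg B) (null_seqs B) (\<lambda>n. f (s n))"
    by (auto simp: cauchy_seqs_closed iso completion_def A.null_seqs_eq B.null_seqs_eq)
  then show ?thesis by (intro exI[of _ \<phi>]) (simp add: completion_map_def A.cauchy_seqs_const)
qed

section \<open>The free *-algebra\<close>

lemma word_adj_append: "word_adj (u @ v) = word_adj v @ word_adj u"
  by (simp add: word_adj_def)

lemma letter_adj_adj [simp]: "letter_adj (letter_adj l) = l"
  by (cases l) simp_all

lemma word_adj_adj [simp]: "word_adj (word_adj w) = w"
  by (simp add: word_adj_def rev_map comp_def)

lemma inj_word_adj: "inj word_adj"
  by (metis injI word_adj_adj)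

lemma lookup_free_adj: "Poly_Mapping.lookup (free_adj f) w = cnj (Poly_Mapping.lookup f (word_adj w))"
  by (simp add: free_adj_def map.rep_eq map_key.rep_eq[OF inj_word_adj] when_def)

lemma free_adj_add: "free_adj (a + b) = free_adj a + free_adj b"
  by (rule poly_mapping_eqI) (simp add: lookup_free_adj lookup_add)

lemma free_adj_zero [simp]: "free_adj 0 = 0"
  by (rule poly_mapping_eqI) (simp add: lookup_free_adj)

lemma free_adj_single [simp]:
  "free_adj (Poly_Mapping.single w c) = Poly_Mapping.single (word_adj w) (cnj c)"
  by (rule poly_mapping_eqI) (auto simp: lookup_free_adj lookup_single when_def)

lemma free_adj_adj [simp]: "free_adj (free_adj a) = a"
  by (rule poly_mapping_eqI) (simp add: lookup_free_adj)

abbreviation letters :: "'a set \<Rightarrow> 'a letter set" where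
  "letters S \<equiv> Ltr ` S \<union> Ltr_adj ` S"

lemma letters_UNIV: "letters UNIV = UNIV"
  by (auto, metis letter.exhaust rangeI)

lemma free_alg_simps [simp]:
  "carrier (free_alg S) = {f. Poly_Mapping.keys f \<subseteq> lists (letters S)}"
  "mult (free_alg S) = (*)" "one (free_alg S) = 1" "zero (free_alg S) = 0"
  "add (free_alg S) = (+)" "adj (free_alg S) = free_adj"
  "scl (free_alg S) = (\<lambda>c a. Poly_Mapping.single [] c * a)"
  by (simp_all add: free_alg_def mult_map_scale_conv_mult zero_list_def fun_eq_iff)

lemma poly_mapping_sum_single:
  fixes a :: "'k \<Rightarrow>\<^sub>0 'v::comm_monoid_add"
  shows "(\<Sum>w\<in>Poly_Mapping.keys a. Poly_Mapping.single w (Poly_Mapping.lookup a w)) = a"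
proof (rule poly_mapping_eqI)
  fix k
  show "Poly_Mapping.lookup (\<Sum>w\<in>Poly_Mapping.keys a. Poly_Mapping.single w (Poly_Mapping.lookup a w)) k
    = Poly_Mapping.lookup a k"
    by (simp add: lookup_sum lookup_single when_def in_keys_iff)
qed

text \<open>Linear induction: every element is a finite sum of multiples of words.\<close>

lemma free_alg_induct [consumes 1, case_names zero single add]:
  fixes a :: "'a free_elt"
  assumes a: "a \<in> carrier (free_alg S)"
    and 0: "P 0"
    and single: "\<And>w c. w \<in> lists (letters S) \<Longrightarrow> P (Poly_Mapping.single w c)"
    and add: "\<And>a b. \<lbrakk>a \<in> carrier (free_alg S); b \<in> carrier (free_alg S); P a; P b\<rbrakk> \<Longrightarrow> P (a + b)"
  shows "P a"
proof -
  have "P (\<Sum>w\<in>K. Poly_Mapping.single w (Poly_Mapping.lookup a w)) \<and>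
      (\<Sum>w\<in>K. Poly_Mapping.single w (Poly_Mapping.lookup a w)) \<in> carrier (free_alg S)"
    if "finite K" "K \<subseteq> lists (letters S)" for K
    using that
  proof (induction K rule: finite_induct)
    case (insert w K)
    then have "Poly_Mapping.single w (Poly_Mapping.lookup a w) \<in> carrier (free_alg S)" by simp
    moreover from insert have "P (\<Sum>w\<in>K. Poly_Mapping.single w (Poly_Mapping.lookup a w))"
      "(\<Sum>w\<in>K. Poly_Mapping.single w (Poly_Mapping.lookup a w)) \<in> carrier (free_alg S)"
      "w \<in> lists (letters S)" by auto
    ultimately show ?case using insert.hyps add single keys_add
      by (simp add: subset_trans[OF keys_add])
  qed (simp add: 0)
  from this[of "Poly_Mapping.keys a"] show ?thesis
    using a by (simp add: poly_mapping_sum_single)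
qed

lemmas free_elt_induct =
  free_alg_induct[where S = UNIV, unfolded free_alg_simps letters_UNIV lists_UNIV, simplified,
    case_names zero single add]

lemma free_adj_mult: "free_adj (a * b) = free_adj b * free_adj a"
proof (induction a rule: free_elt_induct)
  case (single w c)
  show ?case
    by (induction b rule: free_elt_induct)
      (simp_all add: mult_single free_adj_add plus_list_def word_adj_append mult.commute distrib_left distrib_right)
qed (simp_all add: free_adj_add distrib_left distrib_right)

text \<open>The multiples of the empty word are the scalars, hence central.\<close>

lemma single_Nil_commute: "Poly_Mapping.single [] c * a = a * Poly_Mapping.single [] c"
  for a :: "'a free_elt"
  by (induction a rule: free_elt_induct)
    (simp_all add: mult_single plus_list_def distrib_left distrib_right mult.commute)

lemma single_Nil_one: "Poly_Mapping.single [] 1 = (1 :: 'a free_elt)"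
  using single_one[where 'a = "'a letter list"] by (simp add: zero_list_def)

lemma word_adj_Nil [simp]: "word_adj [] = []"
  by (simp add: word_adj_def)

lemma free_adj_one [simp]: "free_adj 1 = 1"
  using free_adj_single[of "[]" 1] by (simp add: single_Nil_one)

lemma word_adj_lists: "w \<in> lists (letters S) \<Longrightarrow> word_adj w \<in> lists (letters S)"
  by (auto simp: word_adj_def lists_eq_set image_iff)

lemma star_algebra_free: "star_algebra (free_alg S)"
proof -
  have add: "Poly_Mapping.keys (a + b) \<subseteq> lists (letters S)"
    if "Poly_Mapping.keys a \<subseteq> lists (letters S)" "Poly_Mapping.keys b \<subseteq> lists (letters S)" for a b :: "'a free_elt"
    using that keys_add[of a b] by blast
  have mult: "Poly_Mapping.keys (a * b) \<subseteq> lists (letters S)"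
    if "Poly_Mapping.keys a \<subseteq> lists (letters S)" "Poly_Mapping.keys b \<subseteq> lists (letters S)" for a b :: "'a free_elt"
  proof -
    have "\<And>u v. \<lbrakk>u \<in> Poly_Mapping.keys a; v \<in> Poly_Mapping.keys b\<rbrakk> \<Longrightarrow> u + v \<in> lists (letters S)"
      using that unfolding plus_list_def by (metis append_in_lists_conv subset_iff)
    then show ?thesis using keys_mult[of a b] by blast
  qed
  have one: "Poly_Mapping.keys (1 :: 'a free_elt) \<subseteq> lists (letters S)" by (simp add: zero_list_def)
  have sc: "Poly_Mapping.keys (Poly_Mapping.single [] c) \<subseteq> lists (letters S)" for c :: complex by simp
  have adj: "Poly_Mapping.keys (free_adj a) \<subseteq> lists (letters S)"
    if "Poly_Mapping.keys a \<subseteq> lists (letters S)" for a :: "'a free_elt"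
  proof
    fix w assume "w \<in> Poly_Mapping.keys (free_adj a)"
    then have "word_adj w \<in> lists (letters S)"
      using that by (auto simp: in_keys_iff lookup_free_adj)
    from word_adj_lists[OF this] show "w \<in> lists (letters S)" by simp
  qed
  have inv: "\<exists>b. Poly_Mapping.keys b \<subseteq> lists (letters S) \<and> b + a = 0"
    if "Poly_Mapping.keys a \<subseteq> lists (letters S)" for a :: "'a free_elt"
    using that by (intro exI[of _ "- a"]) (auto simp: in_keys_iff subset_iff)
  have "abelian_group (free_alg S)"
    by (rule abelian_groupI) (use inv in \<open>simp_all add: add ac_simps\<close>)
  moreover have "Group.monoid (free_alg S)"
    by (rule monoidI) (simp_all only: free_alg_simps mem_Collect_eq mult one mult.assoc mult_1_left mult_1_right)
  ultimately have "ring (free_alg S)"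
    by (rule ringI) (simp_all add: distrib_left distrib_right)
  moreover have "star_algebra_axioms (free_alg S)"
  proof (rule star_algebra_axioms.intro, goal_cases)
    case (7 a b c)
    then show ?case by (simp add: mult.assoc[symmetric] single_Nil_commute)
  next
    case (12 a c)
    then show ?case by (simp add: free_adj_mult single_Nil_commute)
  qed (simp_all only: free_alg_simps mem_Collect_eq mult sc adj free_adj_adj free_adj_add free_adj_mult
      distrib_left distrib_right single_add mult.assoc[symmetric] mult_single plus_list_def append_Nil
      single_Nil_one mult_1_left)
  ultimately show ?thesis by (simp add: star_algebra_def)
qed

text \<open>The type of C*-seminormed algebras has a norm field, so homomorphisms out of the free *-algebra are
  taken from this version, for whichever seminorm \<open>p\<close> is at hand.\<close>

definition free_with :: "'a set \<Rightarrow> ('a free_elt \<Rightarrow> real) \<Rightarrow> 'a free_elt normed_star_alg" where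
  "free_with S p = star_alg.extend (free_alg S) \<lparr>nrm = p\<rparr>"

lemma free_with_simps [simp]:
  "carrier (free_with S p) = carrier (free_alg S)"
  "mult (free_with S p) = (*)" "one (free_with S p) = 1" "zero (free_with S p) = 0"
  "add (free_with S p) = (+)" "adj (free_with S p) = free_adj"
  "scl (free_with S p) = (\<lambda>c a. Poly_Mapping.single [] c * a)"
  "nrm (free_with S p) = p"
  using free_alg_simps[of S] by (simp_all add: free_with_def star_alg.defs)

lemma free_normed_eq: "free_normed S R = free_with S (max_seminorm S R)"
  by (simp add: free_normed_def free_with_def)

lemma star_algebra_free_with: "star_algebra (free_with S p)"
proof -
  interpret F: star_algebra "free_alg S" by (rule star_algebra_free)
  have "ring (free_with S p)"
    by (rule ring_transfer[OF F.ring_axioms]) simp_all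
  moreover have "star_algebra_axioms (free_with S p)"
    using F.star_algebra_axioms unfolding star_algebra_def star_algebra_axioms_def
    by (simp del: free_alg_simps(1))
  ultimately show ?thesis by (simp add: star_algebra_def)
qed

lemma free_minus:
  assumes "a \<in> carrier (free_alg S)" "b \<in> carrier (free_alg S)"
  shows "a \<ominus>\<^bsub>free_with S p\<^esub> b = a - b"
proof -
  interpret F: star_algebra "free_with S p" by (rule star_algebra_free_with)
  show ?thesis
    using F.minus_eq_scl[of a b] assms by (simp add: single_uminus single_Nil_one del: free_alg_simps(1))
qed

lemma free_closed:
  shows free_mult_closed: "\<lbrakk>a \<in> carrier (free_alg S); b \<in> carrier (free_alg S)\<rbrakk> \<Longrightarrow> a * b \<in> carrier (free_alg S)"
    and free_add_closed: "\<lbrakk>a \<in> carrier (free_alg S); b \<in> carrier (free_alg S)\<rbrakk> \<Longrightarrow> a + b \<in> carrier (free_alg S)"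
    and free_minus_closed: "\<lbrakk>a \<in> carrier (free_alg S); b \<in> carrier (free_alg S)\<rbrakk> \<Longrightarrow> a - b \<in> carrier (free_alg S)"
    and free_adj_closed: "a \<in> carrier (free_alg S) \<Longrightarrow> free_adj a \<in> carrier (free_alg S)"
    and free_one_closed: "1 \<in> carrier (free_alg S)"
    and free_zero_closed: "0 \<in> carrier (free_alg S)"
    and free_gen_closed: "s \<in> S \<Longrightarrow> free_gen s \<in> carrier (free_alg S)"
    and free_single_Nil_closed: "Poly_Mapping.single [] c \<in> carrier (free_alg S)"
proof -
  interpret F: star_algebra "free_with S (\<lambda>_. 0)" by (rule star_algebra_free_with)
  show "\<lbrakk>a \<in> carrier (free_alg S); b \<in> carrier (free_alg S)\<rbrakk> \<Longrightarrow> a * b \<in> carrier (free_alg S)"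
    using F.m_closed[of a b] by (simp del: free_alg_simps(1))
  show "\<lbrakk>a \<in> carrier (free_alg S); b \<in> carrier (free_alg S)\<rbrakk> \<Longrightarrow> a + b \<in> carrier (free_alg S)"
    using F.a_closed[of a b] by (simp del: free_alg_simps(1))
  show "\<lbrakk>a \<in> carrier (free_alg S); b \<in> carrier (free_alg S)\<rbrakk> \<Longrightarrow> a - b \<in> carrier (free_alg S)"
    using F.minus_closed[of a b] free_minus[of a S b] by (simp del: free_alg_simps(1))
  show "a \<in> carrier (free_alg S) \<Longrightarrow> free_adj a \<in> carrier (free_alg S)"
    using F.adj_closed[of a] by (simp del: free_alg_simps(1))
  show "1 \<in> carrier (free_alg S)" using F.one_closed by (simp del: free_alg_simps(1))
  show "0 \<in> carrier (free_alg S)" by simp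
  show "s \<in> S \<Longrightarrow> free_gen s \<in> carrier (free_alg S)" by (simp add: free_gen_def)
  show "Poly_Mapping.single [] c \<in> carrier (free_alg S)" by simp
qed

declare free_alg_simps(1) [simp del]
declare free_closed(1-8) [simp, intro]

lemma single_letter: "Poly_Mapping.single [Ltr s] 1 = free_gen s" "Poly_Mapping.single [Ltr_adj s] 1 = free_adj (free_gen s)"
  by (simp_all add: free_gen_def word_adj_def)

lemma single_Cons: "Poly_Mapping.single (l # w) c = Poly_Mapping.single [l] 1 * Poly_Mapping.single w (c :: complex)"
  by (simp add: mult_single plus_list_def)

lemma single_closed: "w \<in> lists (letters S) \<Longrightarrow> Poly_Mapping.single w c \<in> carrier (free_alg S)"
  by (simp add: free_alg_simps(1))

subsection \<open>Substitution\<close>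

primrec word_val :: "('a \<Rightarrow> 'b free_elt) \<Rightarrow> 'a letter list \<Rightarrow> 'b free_elt" where
  "word_val F [] = 1"
| "word_val F (l # w) = (case l of Ltr s \<Rightarrow> F s | Ltr_adj s \<Rightarrow> free_adj (F s)) * word_val F w"

definition free_subst :: "('a \<Rightarrow> 'b free_elt) \<Rightarrow> 'a free_elt \<Rightarrow> 'b free_elt" where
  "free_subst F a = (\<Sum>w\<in>Poly_Mapping.keys a. Poly_Mapping.single [] (Poly_Mapping.lookup a w) * word_val F w)"

lemma word_val_append: "word_val F (u @ v) = word_val F u * word_val F v"
  by (induction u) (simp_all add: mult.assoc)

lemma word_val_adj: "free_adj (word_val F w) = word_val F (word_adj w)"
proof (induction w)
  case (Cons l w)
  have "word_adj (l # w) = word_adj w @ [letter_adj l]" by (simp add: word_adj_def)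
  then show ?case using Cons by (cases l) (simp_all add: free_adj_mult word_val_append)
qed simp

lemma free_subst_superset:
  assumes "finite K" "Poly_Mapping.keys a \<subseteq> K"
  shows "free_subst F a = (\<Sum>w\<in>K. Poly_Mapping.single [] (Poly_Mapping.lookup a w) * word_val F w)"
  unfolding free_subst_def using assms by (intro sum.mono_neutral_left) (auto simp: in_keys_iff)

lemma free_subst_add: "free_subst F (a + b) = free_subst F a + free_subst F b"
proof -
  let ?K = "Poly_Mapping.keys a \<union> Poly_Mapping.keys b"
  have "free_subst F c = (\<Sum>w\<in>?K. Poly_Mapping.single [] (Poly_Mapping.lookup c w) * word_val F w)"
    if "c \<in> {a, b, a + b}" for c
    using that keys_add[of a b] by (intro free_subst_superset) auto
  then show ?thesis by (simp add: lookup_add single_add distrib_right sum.distrib)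
qed

lemma free_subst_zero [simp]: "free_subst F 0 = 0"
  by (simp add: free_subst_def)

lemma free_subst_single: "free_subst F (Poly_Mapping.single w c) = Poly_Mapping.single [] c * word_val F w"
  using free_subst_superset[of "{w}" "Poly_Mapping.single w c" F] by simp

lemma free_subst_mult:
  fixes F :: "'a \<Rightarrow> 'b free_elt"
  shows "free_subst F (a * b) = free_subst F a * free_subst F b"
proof (induction a rule: free_elt_induct)
  case (single w c)
  have 1: "Poly_Mapping.single [] (c * d) * (x * y) = Poly_Mapping.single [] c * x * (Poly_Mapping.single [] d * y)"
    for d :: complex and x y :: "'b free_elt"
  proof -
    have "Poly_Mapping.single [] c * x * (Poly_Mapping.single [] d * y)
      = Poly_Mapping.single [] c * (x * Poly_Mapping.single [] d) * y" by (simp add: mult.assoc)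
    also have "\<dots> = Poly_Mapping.single [] c * Poly_Mapping.single [] d * (x * y)"
      by (simp only: single_Nil_commute[of d x, symmetric] mult.assoc)
    finally show ?thesis by (simp add: mult_single plus_list_def)
  qed
  show ?case
    by (induction b rule: free_elt_induct)
      (simp_all add: mult_single plus_list_def free_subst_single free_subst_add word_val_append distrib_left 1)
qed (simp_all add: free_subst_add distrib_right)

lemma free_subst_adj: "free_subst F (free_adj a) = free_adj (free_subst F a)"
  by (induction a rule: free_elt_induct)
    (simp_all add: free_subst_add free_adj_add free_subst_single free_adj_mult word_val_adj single_Nil_commute)

lemma free_subst_one [simp]: "free_subst F 1 = 1"
  using free_subst_single[of F "[]" 1] by (simp add: single_Nil_one)

lemma free_subst_gen [simp]: "free_subst F (free_gen s) = F s"
  by (simp add: free_gen_def free_subst_single single_Nil_one)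

lemma free_subst_closed:
  assumes F: "\<And>s. s \<in> S \<Longrightarrow> F s \<in> carrier (free_alg T)" and a: "a \<in> carrier (free_alg S)"
  shows "free_subst F a \<in> carrier (free_alg T)"
  using a
proof (induction a rule: free_alg_induct)
  case (single w c)
  have "word_val F w \<in> carrier (free_alg T)"
    using single
  proof (induction w)
    case (Cons l w)
    then have "(case l of Ltr s \<Rightarrow> F s | Ltr_adj s \<Rightarrow> free_adj (F s)) \<in> carrier (free_alg T)"
      by (auto intro!: F free_adj_closed)
    then show ?case using Cons by auto
  qed simp
  then show ?case by (simp add: free_subst_single)
qed (simp_all add: free_subst_add)

lemma star_hom_free_subst:
  assumes "\<And>s. s \<in> S \<Longrightarrow> F s \<in> carrier (free_alg T)"
  shows "star_hom (free_with S p) (free_with T q) (free_subst F)"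
  by (rule star_homI)
    (simp_all add: free_subst_closed[OF assms] free_subst_mult free_subst_add free_subst_adj
      free_subst_single)

text \<open>A word is a product of generators and adjoints of generators, so a homomorphism is determined by its
  values on generators.\<close>

lemma star_hom_free_eqI:
  assumes f: "star_hom (free_with S p) D f" and g: "star_hom (free_with S q) D g"
    and gen: "\<And>s. s \<in> S \<Longrightarrow> f (free_gen s) = g (free_gen s)"
    and a: "a \<in> carrier (free_alg S)"
  shows "f a = g a"
proof -
  note f' = star_homD[OF f, simplified] and g' = star_homD[OF g, simplified]
  have scl: "f (Poly_Mapping.single [] c) = g (Poly_Mapping.single [] c)" for c
    using f'(5)[of 1 c] g'(5)[of 1 c] f'(4) g'(4) by simp
  from a show ?thesis
  proof (induction a rule: free_alg_induct)
    case zero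
    then show ?case using scl[of 0] by simp
  next
    case (single w c)
    then show ?case
    proof (induction w)
      case Nil
      then show ?case using scl by simp
    next
      case (Cons l w)
      have "f (Poly_Mapping.single [l] 1) = g (Poly_Mapping.single [l] 1)"
      proof (cases l)
        case (Ltr s)
        then have "s \<in> S" using Cons.hyps Ltr by auto
        then show ?thesis using Ltr by (simp add: single_letter gen)
      next
        case (Ltr_adj s)
        then have "s \<in> S" using Cons.hyps Ltr_adj by auto
        then show ?thesis using Ltr_adj by (simp add: single_letter gen f' g')
      qed
      moreover have "Poly_Mapping.single [l] 1 \<in> carrier (free_alg S)" "Poly_Mapping.single w c \<in> carrier (free_alg S)"
        using Cons.hyps by (auto intro: single_closed)
      ultimately show ?case
        using Cons by (subst (1 2) single_Cons) (auto simp: f' g')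
    qed
  qed (simp add: f' g')
qed

section \<open>Universal C*-algebras\<close>

lemma rel_seminormD:
  assumes "rel_seminorm S R p"
  shows "cstar_seminorm (free_alg S) p" and "(l, r) \<in> R \<Longrightarrow> p (l - r) = 0"
  using assms by (auto simp: rel_seminorm_def)

lemma cstar_seminorm_free_with: "cstar_seminorm (free_with S p) q = cstar_seminorm (free_alg S) q"
  by (simp add: cstar_seminorm_def)

lemma seminormed_free_with:
  "cstar_seminorm (free_alg S) p \<Longrightarrow> seminormed_star_algebra (free_with S p)"
  by (simp add: seminormed_star_algebra_def seminormed_star_algebra_axioms_def
      star_algebra_free_with cstar_seminorm_free_with)

lemma rel_seminorm_zero: "rel_seminorm S R (\<lambda>_. 0)"
  by (auto simp: rel_seminorm_def cstar_seminorm_def)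

definition gens_bounded :: "'a set \<Rightarrow> ('a free_elt \<times> 'a free_elt) set \<Rightarrow> bool" where
  "gens_bounded S R \<longleftrightarrow> (\<forall>s\<in>S. \<exists>K. \<forall>p. rel_seminorm S R p \<longrightarrow> p (free_gen s) \<le> K)"

text \<open>Bounds for the generators that are uniform in the admissible seminorms extend to words by
  submultiplicativity and to sums by the triangle inequality.\<close>

lemma gens_bounded_bdd_above:
  assumes "gens_bounded S R" "a \<in> carrier (free_alg S)"
  shows "bdd_above ((\<lambda>p. p a) ` Collect (rel_seminorm S R))"
proof -
  let ?b = "\<lambda>a K. \<forall>p. rel_seminorm S R p \<longrightarrow> p a \<le> (K::real)"
  have mult: "\<exists>K. ?b (a * b) K" if K: "?b a K" and L: "?b b L"
    and ab: "a \<in> carrier (free_alg S)" "b \<in> carrier (free_alg S)" for a b K L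
  proof (intro exI allI impI)
    fix p assume p: "rel_seminorm S R p"
    note p' = cstar_seminormD[OF rel_seminormD(1)[OF p], simplified]
    have "p (a * b) \<le> p a * p b" using ab by (rule p')
    also have "\<dots> \<le> K * L"
      using K L p p'(1)[OF ab(1)] p'(1)[OF ab(2)] by (intro mult_mono) (auto intro: order_trans)
    finally show "p (a * b) \<le> K * L" .
  qed
  have scal: "?b (Poly_Mapping.single [] c) (cmod c)" for c
  proof (intro allI impI)
    fix p assume p: "rel_seminorm S R p"
    note p' = cstar_seminormD[OF rel_seminormD(1)[OF p], simplified]
    \<comment> \<open>The C*-identity at the unit leaves only the values \<open>0\<close> and \<open>1\<close> for \<open>p 1\<close>.\<close>
    have "p 1 = (p 1)\<^sup>2" using p'(5)[of 1] by simp
    then have "p 1 \<le> 1" using p'(1)[of 1] by (cases "p 1 = 0") (auto simp: power2_eq_square)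
    then show "p (Poly_Mapping.single [] c) \<le> cmod c"
      using p'(3)[of 1 c] mult_left_mono[of "p 1" 1 "cmod c"] by simp
  qed
  have letter: "\<exists>K. ?b (Poly_Mapping.single [l] 1) K" if l: "l \<in> letters S" for l
  proof -
    obtain s where s: "s \<in> S" "l = Ltr s \<or> l = Ltr_adj s" using l by auto
    obtain K where K: "?b (free_gen s) K" using assms(1) s(1) unfolding gens_bounded_def by blast
    have "p (Poly_Mapping.single [l] 1) = p (free_gen s)" if p: "rel_seminorm S R p" for p
    proof -
      interpret seminormed_star_algebra "free_with S p"
        by (rule seminormed_free_with[OF rel_seminormD(1)[OF p]])
      show ?thesis using s nrm_adj[of "free_gen s"] by (auto simp: single_letter)
    qed
    then show ?thesis using K by metis
  qed
  have "\<exists>K. ?b a K"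
    using assms(2)
  proof (induction a rule: free_alg_induct)
    case zero
    show ?case using scal[of 0] by auto
  next
    case (single w c)
    then show ?case
    proof (induction w)
      case Nil
      then show ?case using scal by blast
    next
      case (Cons l w)
      then obtain K L where "?b (Poly_Mapping.single [l] 1) K" "?b (Poly_Mapping.single w c) L"
        using letter[of l] by auto
      then show ?case
        using Cons.hyps mult[of "Poly_Mapping.single [l] 1" K "Poly_Mapping.single w c" L]
          single_closed[of "[l]" S 1] single_closed[of w S c]
        by (simp add: single_Cons[of l w])
    qed
  next
    case (add a b)
    obtain K where K: "?b a K" using add(3) by (rule exE)
    obtain L where L: "?b b L" using add(4) by (rule exE)
    have "p (a + b) \<le> K + L" if p: "rel_seminorm S R p" for p
    proof -
      have "p (a + b) \<le> p a + p b"
        using cstar_seminormD(2)[OF rel_seminormD(1)[OF p] add(1,2)] by simp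
      then show ?thesis using K L p by (meson add_mono order_trans)
    qed
    then show ?case by metis
  qed
  then show ?thesis by (auto simp: bdd_above_def)
qed

context
  fixes S :: "'a set" and R
  assumes bdd: "gens_bounded S R"
begin

lemma max_seminorm_upper: "\<lbrakk>rel_seminorm S R p; a \<in> carrier (free_alg S)\<rbrakk> \<Longrightarrow> p a \<le> max_seminorm S R a"
  unfolding max_seminorm_def by (intro cSUP_upper gens_bounded_bdd_above bdd) auto

lemma max_seminorm_least: "(\<And>p. rel_seminorm S R p \<Longrightarrow> p a \<le> K) \<Longrightarrow> max_seminorm S R a \<le> K"
  unfolding max_seminorm_def using rel_seminorm_zero by (intro cSUP_least) auto

text \<open>Each of the required properties is stable under suprema. For the C*-identity this holds because
  squaring is monotone on nonnegative reals, so that the supremum of \<open>p (a\<^sup>* a) = (p a)\<^sup>2\<close> is the square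
  of the supremum.\<close>

lemma rel_seminorm_max: "rel_seminorm S R (max_seminorm S R)"
proof -
  note D = cstar_seminormD[OF rel_seminormD(1), simplified]
  let ?m = "max_seminorm S R"
  have nn: "0 \<le> ?m a" if "a \<in> carrier (free_alg S)" for a
    using max_seminorm_upper[OF rel_seminorm_zero that] .
  have "cstar_seminorm (free_alg S) ?m"
    unfolding cstar_seminorm_def
  proof (intro conjI ballI allI, simp_all)
    fix a assume a: "a \<in> carrier (free_alg S)"
    show "0 \<le> ?m a" by (rule nn[OF a])
    show "?m (Poly_Mapping.single [] c * a) = cmod c * ?m a" for c
    proof (rule antisym)
      show "?m (Poly_Mapping.single [] c * a) \<le> cmod c * ?m a"
        by (rule max_seminorm_least) (use a in \<open>simp add: D mult_left_mono max_seminorm_upper\<close>)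
      have "cmod c * p a \<le> ?m (Poly_Mapping.single [] c * a)" if "rel_seminorm S R p" for p
        using max_seminorm_upper[OF that, of "Poly_Mapping.single [] c * a"] a D[OF that] by simp
      then have "?m a \<le> ?m (Poly_Mapping.single [] c * a) / cmod c" if "c \<noteq> 0"
        using that by (intro max_seminorm_least) (simp add: field_simps)
      then show "cmod c * ?m a \<le> ?m (Poly_Mapping.single [] c * a)"
        using a nn[of "Poly_Mapping.single [] c * a"] by (cases "c = 0") (simp_all add: field_simps)
    qed
    show "?m (free_adj a * a) = (?m a)\<^sup>2"
    proof (rule antisym)
      show "?m (free_adj a * a) \<le> (?m a)\<^sup>2"
        by (rule max_seminorm_least) (use a in \<open>simp add: D power_mono max_seminorm_upper\<close>)
      have "p a \<le> sqrt (?m (free_adj a * a))" if "rel_seminorm S R p" for p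
        using max_seminorm_upper[OF that, of "free_adj a * a"] a D[OF that] by (simp add: real_le_rsqrt)
      then have "?m a \<le> sqrt (?m (free_adj a * a))" by (rule max_seminorm_least)
      then show "(?m a)\<^sup>2 \<le> ?m (free_adj a * a)"
        using a nn[of "free_adj a * a"] nn[OF a] by (metis free_adj_closed free_mult_closed power_mono real_sqrt_pow2)
    qed
    fix b assume b: "b \<in> carrier (free_alg S)"
    show "?m (a + b) \<le> ?m a + ?m b"
      using D(2)[OF _ a b] max_seminorm_upper[OF _ a] max_seminorm_upper[OF _ b]
      by (intro max_seminorm_least) (rule order_trans[OF _ add_mono])
    show "?m (a * b) \<le> ?m a * ?m b"
    proof (rule max_seminorm_least)
      fix p assume p: "rel_seminorm S R p"
      have "p a * p b \<le> ?m a * ?m b"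
        using a b p by (intro mult_mono max_seminorm_upper D(1) nn)
      then show "p (a * b) \<le> ?m a * ?m b" using D(4)[OF p a b] by simp
    qed
  qed
  moreover have "?m (l - r) = 0" if "(l, r) \<in> R" for l r
  proof -
    have "(\<lambda>p. p (l - r)) ` Collect (rel_seminorm S R) = {0}"
      using that rel_seminorm_zero[of S R] by (force simp: rel_seminorm_def)
    then show ?thesis by (simp add: max_seminorm_def)
  qed
  ultimately show ?thesis by (auto simp: rel_seminorm_def)
qed

lemma seminormed_free_normed: "seminormed_star_algebra (free_normed S R)"
  unfolding free_normed_eq by (rule seminormed_free_with[OF rel_seminormD(1)[OF rel_seminorm_max]])

end

text \<open>The targets range over *-algebras, because the quotients of the free *-algebra by null ideals, to
  which the comparison of presentations is applied, are in general not complete.\<close>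

definition star_representation ::
  "'a set \<Rightarrow> ('a free_elt \<times> 'a free_elt) set \<Rightarrow> ('d, 'k) normed_star_alg_scheme \<Rightarrow> ('a free_elt \<Rightarrow> 'd) \<Rightarrow> bool" where
  "star_representation S R D \<pi> \<longleftrightarrow> star_algebra D \<and> star_hom (free_with S (\<lambda>_. 0)) D \<pi> \<and> (\<forall>(l, r)\<in>R. \<pi> l = \<pi> r)"

lemma star_hom_free_with: "star_hom (free_with S p) D f \<longleftrightarrow> star_hom (free_with S q) D f"
  by (auto simp: star_hom_def ring_hom_def)

definition rel_quot :: "'a set \<Rightarrow> ('a free_elt \<Rightarrow> real) \<Rightarrow> 'a free_elt set normed_star_alg" where
  "rel_quot S p = quot_alg (free_with S p) (null_ideal (free_with S p))"

definition rel_quot_map :: "'a set \<Rightarrow> ('a free_elt \<Rightarrow> real) \<Rightarrow> 'a free_elt \<Rightarrow> 'a free_elt set" where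
  "rel_quot_map S p = quot_map (free_with S p) (null_ideal (free_with S p))"

lemma rel_quot_map_eq_iff:
  assumes "cstar_seminorm (free_alg S) p" "a \<in> carrier (free_alg S)" "b \<in> carrier (free_alg S)"
  shows "rel_quot_map S p a = rel_quot_map S p b \<longleftrightarrow> p (a - b) = 0"
proof -
  interpret seminormed_star_algebra "free_with S p" by (rule seminormed_free_with[OF assms(1)])
  show ?thesis using assms quot_map_null_eq_iff[of a b] by (simp add: rel_quot_map_def free_minus)
qed

text \<open>A seminorm that respects the relations vanishes on \<open>l - r\<close> for each of them, so \<open>l\<close> and \<open>r\<close> have the same
  coset. This turns statements about admissible seminorms into statements about representations.\<close>

lemma representation_rel_quot:
  assumes R: "R \<subseteq> carrier (free_alg S) \<times> carrier (free_alg S)" and p: "rel_seminorm S R p"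
  shows "star_representation S R (rel_quot S p) (rel_quot_map S p)"
proof -
  interpret seminormed_star_algebra "free_with S p" by (rule seminormed_free_with[OF rel_seminormD(1)[OF p]])
  have "rel_quot_map S p l = rel_quot_map S p r" if "(l, r) \<in> R" for l r
    using that R rel_seminormD[OF p] by (subst rel_quot_map_eq_iff) auto
  then show ?thesis
    using star_algebra_quot_null star_hom_free_with[THEN iffD1, OF star_hom_quot_map_null]
    unfolding star_representation_def rel_quot_def[symmetric] rel_quot_map_def[symmetric] by blast
qed

lemma representation_univ_cstar:
  assumes R: "R \<subseteq> carrier (free_alg S) \<times> carrier (free_alg S)" and b: "gens_bounded S R"
  shows "star_representation S R (univ_cstar S R) (completion_map (free_normed S R))"
proof -
  interpret seminormed_star_algebra "free_normed S R" by (rule seminormed_free_normed[OF b])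
  have "completion_map (free_normed S R) l = completion_map (free_normed S R) r" if "(l, r) \<in> R" for l r
    using that R rel_seminormD[OF rel_seminorm_max[OF b]]
    by (intro completion_map_eqI) (auto simp: free_normed_eq free_minus)
  then show ?thesis
    using star_algebra_completion star_hom_free_with[THEN iffD1, OF star_hom_completion_map[unfolded free_normed_eq]]
    unfolding star_representation_def univ_cstar_def free_normed_eq by blast
qed

lemma seminorm_pullback:
  assumes A: "star_algebra A" and f: "star_hom A B f" and p: "cstar_seminorm B p"
  shows "cstar_seminorm A (p \<circ> f)"
proof -
  interpret star_algebra A by fact
  show ?thesis
    unfolding cstar_seminorm_def
    by (auto simp: star_homD[OF f] cstar_seminormD[OF p] adj_closed)
qed

text \<open>The representation carried by \<open>p\<close> composed with the substitution sends both sides of each relation in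
  \<open>R\<close> to the same coset, which means that \<open>p\<close> vanishes on the substituted difference.\<close>

lemma rel_seminorm_pullback:
  assumes F: "\<And>s. s \<in> S \<Longrightarrow> F s \<in> carrier (free_alg T)"
    and p: "rel_seminorm T Q p"
    and R: "R \<subseteq> carrier (free_alg S) \<times> carrier (free_alg S)"
    and rep: "star_representation S R (rel_quot T p) (rel_quot_map T p \<circ> free_subst F)"
  shows "rel_seminorm S R (p \<circ> free_subst F)"
proof -
  have cF: "\<And>a. a \<in> carrier (free_alg S) \<Longrightarrow> free_subst F a \<in> carrier (free_alg T)"
    by (rule free_subst_closed) (rule F)
  have hF: "star_hom (free_with S p) (free_with T q) (free_subst F)" for p q
    by (rule star_hom_free_subst) (rule F)
  note p' = rel_seminormD(1)[OF p]
  have "cstar_seminorm (free_with S (\<lambda>_. 0)) (p \<circ> free_subst F)"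
    using seminorm_pullback[OF star_algebra_free_with hF, of p] p'
    by (simp add: cstar_seminorm_free_with)
  moreover have "(p \<circ> free_subst F) (l - r) = 0" if lr: "(l, r) \<in> R" for l r
  proof -
    have "l \<in> carrier (free_alg S)" "r \<in> carrier (free_alg S)" using lr R by auto
    note c = cF[OF this(1)] cF[OF this(2)]
    have "free_subst F (l - r) + free_subst F r = free_subst F l"
      by (simp flip: free_subst_add)
    then have "free_subst F (l - r) = free_subst F l - free_subst F r" by (simp add: eq_diff_eq)
    moreover have "rel_quot_map T p (free_subst F l) = rel_quot_map T p (free_subst F r)"
      using rep lr by (auto simp: star_representation_def)
    ultimately show ?thesis using rel_quot_map_eq_iff[OF p' c] by simp
  qed
  ultimately show ?thesis by (auto simp: rel_seminorm_def cstar_seminorm_free_with)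
qed

text \<open>Both sides are homomorphisms into the quotient by the null ideal of \<open>p\<close>, and they agree on generators.\<close>

lemma rel_seminorm_subst_inverse:
  assumes F: "\<And>s. s \<in> S \<Longrightarrow> F s \<in> carrier (free_alg T)"
    and G: "\<And>t. t \<in> T \<Longrightarrow> G t \<in> carrier (free_alg S)"
    and p: "rel_seminorm T Q p" and QT: "Q \<subseteq> carrier (free_alg T) \<times> carrier (free_alg T)"
    and gen: "\<And>t. t \<in> T \<Longrightarrow> rel_quot_map T p (free_subst F (G t)) = rel_quot_map T p (free_gen t)"
    and a: "a \<in> carrier (free_alg T)"
  shows "p (free_subst F (free_subst G a) - a) = 0"
proof -
  have cF: "\<And>a. a \<in> carrier (free_alg S) \<Longrightarrow> free_subst F a \<in> carrier (free_alg T)"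
    by (rule free_subst_closed) (rule F)
  have cG: "\<And>a. a \<in> carrier (free_alg T) \<Longrightarrow> free_subst G a \<in> carrier (free_alg S)"
    by (rule free_subst_closed) (rule G)
  have hF: "star_hom (free_with S p) (free_with T q) (free_subst F)" for p q
    by (rule star_hom_free_subst) (rule F)
  have hG: "star_hom (free_with T p) (free_with S q) (free_subst G)" for p q
    by (rule star_hom_free_subst) (rule G)
  let ?\<pi> = "rel_quot_map T p"
  have \<pi>: "star_hom (free_with T (\<lambda>_. 0)) (rel_quot T p) ?\<pi>"
    using representation_rel_quot[OF QT p] by (simp add: star_representation_def)
  have "star_hom (free_with T (\<lambda>_. 0)) (free_with T (\<lambda>_. 0)) (free_subst F \<circ> free_subst G)"
    by (rule star_hom_comp[OF hG hF])
  from star_hom_free_eqI[OF star_hom_comp[OF this \<pi>] \<pi> _ a]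
  have "?\<pi> (free_subst F (free_subst G a)) = ?\<pi> a" using gen by simp
  then show ?thesis
    using rel_quot_map_eq_iff[OF rel_seminormD(1)[OF p] cF[OF cG[OF a]] a] by simp
qed

text \<open>Two presentations define the same universal C*-algebra if substituting \<open>F\<close> turns every representation
  of \<open>(T, Q)\<close> into one of \<open>(S, R)\<close>, substituting \<open>G\<close> does the reverse, and the round trips fix the
  generators in every representation. Each substitution is contractive for the maximal seminorms because
  it pulls admissible seminorms back to admissible ones; being inverse to each other up to seminorm zero,
  they are then isometric. The representations may be restricted to one type of target because only the
  quotients of the free *-algebras by null ideals are needed.\<close>

theorem univ_cstar_iso:
  fixes S :: "'a set" and T :: "'b set"
  assumes RS: "R \<subseteq> carrier (free_alg S) \<times> carrier (free_alg S)"
    and QT: "Q \<subseteq> carrier (free_alg T) \<times> carrier (free_alg T)"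
    and bS: "gens_bounded S R" and bT: "gens_bounded T Q"
    and F: "\<And>s. s \<in> S \<Longrightarrow> F s \<in> carrier (free_alg T)"
    and G: "\<And>t. t \<in> T \<Longrightarrow> G t \<in> carrier (free_alg S)"
    and rF: "\<And>D (\<pi> :: _ \<Rightarrow> 'b free_elt set). star_representation T Q (D :: _ normed_star_alg) \<pi> \<Longrightarrow>
      star_representation S R D (\<pi> \<circ> free_subst F) \<and> (\<forall>t\<in>T. \<pi> (free_subst F (G t)) = \<pi> (free_gen t))"
    and rG: "\<And>D (\<pi> :: _ \<Rightarrow> 'a free_elt set). star_representation S R (D :: _ normed_star_alg) \<pi> \<Longrightarrow>
      star_representation T Q D (\<pi> \<circ> free_subst G) \<and> (\<forall>s\<in>S. \<pi> (free_subst G (F s)) = \<pi> (free_gen s))"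
  shows "\<exists>\<phi>. cstar_iso (univ_cstar S R) (univ_cstar T Q) \<phi> \<and>
    (\<forall>a\<in>carrier (free_alg S). \<phi> (completion_map (free_normed S R) a)
      = completion_map (free_normed T Q) (free_subst F a))"
proof -
  have cF: "\<And>a. a \<in> carrier (free_alg S) \<Longrightarrow> free_subst F a \<in> carrier (free_alg T)"
    by (rule free_subst_closed) (rule F)
  have cG: "\<And>a. a \<in> carrier (free_alg T) \<Longrightarrow> free_subst G a \<in> carrier (free_alg S)"
    by (rule free_subst_closed) (rule G)
  have hF: "star_hom (free_with S p) (free_with T q) (free_subst F)" for p q
    by (rule star_hom_free_subst) (rule F)
  have leF: "max_seminorm T Q (free_subst F a) \<le> max_seminorm S R a" if a: "a \<in> carrier (free_alg S)" for a
  proof (rule max_seminorm_least[OF bT])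
    fix p assume p: "rel_seminorm T Q p"
    have "rel_seminorm S R (p \<circ> free_subst F)"
      using rF[OF representation_rel_quot[OF QT p]] by (intro rel_seminorm_pullback[OF F p RS]) auto
    from max_seminorm_upper[OF bS this a] show "p (free_subst F a) \<le> max_seminorm S R a" by simp
  qed
  have leG: "max_seminorm S R (free_subst G a) \<le> max_seminorm T Q a" if a: "a \<in> carrier (free_alg T)" for a
  proof (rule max_seminorm_least[OF bS])
    fix p assume p: "rel_seminorm S R p"
    have "rel_seminorm T Q (p \<circ> free_subst G)"
      using rG[OF representation_rel_quot[OF RS p]] by (intro rel_seminorm_pullback[OF G p QT]) auto
    from max_seminorm_upper[OF bT this a] show "p (free_subst G a) \<le> max_seminorm T Q a" by simp
  qed
  have invF: "max_seminorm T Q (free_subst F (free_subst G a) - a) = 0" if "a \<in> carrier (free_alg T)" for a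
    using rF[OF representation_rel_quot[OF QT rel_seminorm_max[OF bT]]]
    by (intro rel_seminorm_subst_inverse[OF F G rel_seminorm_max[OF bT] QT _ that]) auto
  have invG: "max_seminorm S R (free_subst G (free_subst F a) - a) = 0" if "a \<in> carrier (free_alg S)" for a
    using rG[OF representation_rel_quot[OF RS rel_seminorm_max[OF bS]]]
    by (intro rel_seminorm_subst_inverse[OF G F rel_seminorm_max[OF bS] RS _ that]) auto
  interpret S: seminormed_star_algebra "free_normed S R" by (rule seminormed_free_normed[OF bS])
  have nrm: "nrm (free_normed T Q) (free_subst F a) = nrm (free_normed S R) a"
    if a: "a \<in> carrier (free_normed S R)" for a
  proof -
    have a': "a \<in> carrier (free_alg S)" using a by (simp add: free_normed_eq)
    have Fa: "free_subst F a \<in> carrier (free_alg T)" by (rule cF[OF a'])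
    have GFa: "free_subst G (free_subst F a) \<in> carrier (free_alg S)" by (rule cG[OF Fa])
    have "\<bar>max_seminorm S R (free_subst G (free_subst F a)) - max_seminorm S R a\<bar> \<le> 0"
      using S.nrm_diff_le[of "free_subst G (free_subst F a)" a] a' GFa invG[OF a']
      by (simp add: free_normed_eq free_minus)
    then show ?thesis using leF[OF a'] leG[OF Fa] by (simp add: free_normed_eq)
  qed
  have "\<exists>a\<in>carrier (free_normed S R). nrm (free_normed T Q) (free_subst F a \<ominus>\<^bsub>free_normed T Q\<^esub> b) = 0"
    if b: "b \<in> carrier (free_normed T Q)" for b
    using b invF[of b] cG[of b] cF[OF cG, of b]
    by (intro bexI[of _ "free_subst G b"]) (simp_all add: free_normed_eq free_minus)
  from completion_iso[OF seminormed_free_normed[OF bS] seminormed_free_normed[OF bT] _ nrm this]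
  show ?thesis
    using hF by (simp add: univ_cstar_def free_normed_eq)
qed

section \<open>The Zappa--Szep product\<close>

text \<open>These turn out to be the principal right ideals of the semigroup; see \<open>principal_eq_cyl\<close>.\<close>

definition cylinder :: "('g, 'm) monoid_scheme \<Rightarrow> 'x set \<Rightarrow> 'x list \<Rightarrow> ('x list \<times> 'g) set" where
  "cylinder G X y = (\<lambda>z. y @ z) ` lists X \<times> carrier G"

context self_similar_action
begin

sublocale G: group G
  using group_hom by (rule group_hom.axioms)

lemma act_closed [simp, intro]: "\<lbrakk>g \<in> carrier G; w \<in> lists X\<rbrakk> \<Longrightarrow> act g w \<in> lists X"
  using element_image by blast

lemma restr_props:
  assumes "g \<in> carrier G" "x \<in> X"
  shows "restr G X act g x \<in> carrier G"
    and "w \<in> lists X \<Longrightarrow> act g (x # w) = act g [x] @ act (restr G X act g x) w"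
  using theI'[OF self_similar[OF assms]] unfolding restr_def by blast+

declare restr_props(1) [simp, intro]

lemma act_Nil [simp]: "g \<in> carrier G \<Longrightarrow> act g [] = []"
  using length_act[of g "[]"] by simp

lemma act_letter:
  assumes "g \<in> carrier G" "x \<in> X"
  shows "act g [x] = [hd (act g [x])]" and "hd (act g [x]) \<in> X"
proof -
  have "length (act g [x]) = 1" "act g [x] \<in> lists X"
    using assms length_act[of g "[x]"] act_closed[of g "[x]"] by auto
  then show "act g [x] = [hd (act g [x])]" "hd (act g [x]) \<in> X"
    by (auto simp: length_Suc_conv)
qed

lemma act_Cons:
  "\<lbrakk>g \<in> carrier G; x \<in> X; w \<in> lists X\<rbrakk> \<Longrightarrow> act g (x # w) = hd (act g [x]) # act (restr G X act g x) w"
  using restr_props(2)[of g x w] act_letter(1)[of g x] by (metis append_Cons append_Nil)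

lemma restr_word_closed [simp, intro]:
  "\<lbrakk>g \<in> carrier G; w \<in> lists X\<rbrakk> \<Longrightarrow> restr_word G X act g w \<in> carrier G"
proof (induction w arbitrary: g rule: list.induct)
  case (Cons x w)
  then show ?case by simp
qed simp

lemma act_append:
  "\<lbrakk>g \<in> carrier G; v \<in> lists X; w \<in> lists X\<rbrakk> \<Longrightarrow>
    act g (v @ w) = act g v @ act (restr_word G X act g v) w"
proof (induction v arbitrary: g rule: list.induct)
  case (Cons x v)
  then show ?case using act_Cons[of g x "v @ w"] act_Cons[of g x v] by simp
qed simp

lemma act_one [simp]: "w \<in> lists X \<Longrightarrow> act \<one> w = w"
  using id_eq_one by (metis restrict_apply')

lemma restr_one [simp]: "x \<in> X \<Longrightarrow> restr G X act \<one> x = \<one>"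
  using self_similar[of \<one> x] restr_props[of \<one> x] by (auto simp del: restr_props(1))

lemma restr_word_one [simp]: "w \<in> lists X \<Longrightarrow> restr_word G X act \<one> w = \<one>"
  by (induction w rule: list.induct) auto

abbreviation P where "P \<equiv> zappa_szep G X act"

lemma P_carrier [simp]: "p \<in> carrier P \<longleftrightarrow> fst p \<in> lists X \<and> snd p \<in> carrier G"
  by (cases p) (simp add: zappa_szep_def)

lemma P_mult [simp]: "(x, g) \<otimes>\<^bsub>P\<^esub> (y, h) = (x @ act g y, restr_word G X act g y \<otimes> h)"
  by (simp add: zappa_szep_def)

lemma P_mult_closed: "\<lbrakk>p \<in> carrier P; q \<in> carrier P\<rbrakk> \<Longrightarrow> p \<otimes>\<^bsub>P\<^esub> q \<in> carrier P"
  by (cases p; cases q) auto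

abbreviation cyl where "cyl \<equiv> cylinder G X"

lemma cyl_Nil: "cyl [] = carrier P"
  by (auto simp: cylinder_def)

text \<open>Translating by \<open>(x, g)\<close> puts \<open>x\<close> in front of the image of the word under \<open>g\<close>. All of the larger
  cylinder is reached because the restriction of \<open>g\<close> acts bijectively on words and the group component
  can be corrected by an inverse.\<close>

lemma coset_cyl:
  assumes xg: "x \<in> lists X" "g \<in> carrier G" and y: "y \<in> lists X"
  shows "(x, g) <#\<^bsub>P\<^esub> cyl y = cyl (x @ act g y)"
proof (intro equalityI subsetI)
  fix q assume "q \<in> (x, g) <#\<^bsub>P\<^esub> cyl y"
  then obtain z h where "z \<in> lists X" "h \<in> carrier G" "q = (x, g) \<otimes>\<^bsub>P\<^esub> (y @ z, h)"
    by (auto simp: l_coset_def cylinder_def)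
  then show "q \<in> cyl (x @ act g y)"
    using xg y by (auto simp: cylinder_def act_append)
next
  fix q assume "q \<in> cyl (x @ act g y)"
  then obtain z h where z: "z \<in> lists X" "h \<in> carrier G" "q = (x @ act g y @ z, h)"
    by (auto simp: cylinder_def)
  let ?g = "restr_word G X act g y"
  have gy: "?g \<in> carrier G" using xg y by simp
  then obtain z' where z': "z' \<in> lists X" "act ?g z' = z"
    using bij_prop1[OF gy z(1)] by blast
  \<comment> \<open>The factor \<open>inv ?k \<otimes> h\<close> makes the group component of the product equal to \<open>h\<close>.\<close>
  let ?k = "restr_word G X act g (y @ z')"
  have k: "?k \<in> carrier G" using xg y z' by simp
  have "(x, g) \<otimes>\<^bsub>P\<^esub> (y @ z', inv ?k \<otimes> h) = q"
    using xg y z z' k by (simp add: act_append flip: G.m_assoc)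
  moreover have "(y @ z', inv ?k \<otimes> h) \<in> cyl y" using k z z' by (auto simp: cylinder_def)
  ultimately show "q \<in> (x, g) <#\<^bsub>P\<^esub> cyl y" unfolding l_coset_def by blast
qed

lemma principal_eq_cyl: "\<lbrakk>x \<in> lists X; g \<in> carrier G\<rbrakk> \<Longrightarrow> principal P (x, g) = cyl x"
  using coset_cyl[of x g "[]"] by (simp add: principal_def cyl_Nil)

lemma cyl_nonempty: "cyl y \<noteq> {}"
  by (auto simp: cylinder_def)

lemma constructible_P: "constructible P = cyl ` lists X \<union> {{}}"
proof -
  have "principal P ` carrier P = cyl ` lists X"
  proof (intro equalityI subsetI)
    fix Y assume "Y \<in> cyl ` lists X"
    then obtain y where "y \<in> lists X" "Y = principal P (y, \<one>)" by (auto simp: principal_eq_cyl)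
    then show "Y \<in> principal P ` carrier P" by auto
  qed (auto simp: principal_eq_cyl)
  then show ?thesis by (simp add: constructible_def)
qed

lemma constructible_cases:
  assumes "Y \<in> constructible P"
  obtains "Y = {}" | y where "y \<in> lists X" "Y = cyl y"
  using assms by (auto simp: constructible_P)

lemma cyl_constructible [simp]: "y \<in> lists X \<Longrightarrow> cyl y \<in> constructible P"
  by (simp add: constructible_P)

lemma empty_constructible [simp]: "{} \<in> constructible P"
  by (simp add: constructible_P)

lemma cyl_memD: "(z, g) \<in> cyl y \<Longrightarrow> prefix y z"
  by (auto simp: cylinder_def)

lemma cyl_subset:
  assumes "prefix x y" "y \<in> lists X" shows "cyl y \<subseteq> cyl x"
  using assms by (auto simp: cylinder_def prefix_def image_iff)

lemma cyl_eq_iff: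
  assumes "x \<in> lists X" "y \<in> lists X" shows "cyl x = cyl y \<longleftrightarrow> x = y"
proof
  have "(x, \<one>) \<in> cyl x" "(y, \<one>) \<in> cyl y" by (auto simp: cylinder_def)
  then show "cyl x = cyl y \<Longrightarrow> x = y" using cyl_memD prefix_order.antisym by metis
qed simp

lemma the_cyl: "y \<in> lists X \<Longrightarrow> (THE y'. y' \<in> lists X \<and> cyl y = cyl y') = y"
  by (intro the_equality) (use cyl_eq_iff in blast)+

text \<open>A word has two prefixes only if one of them is a prefix of the other.\<close>

lemma cyl_inter:
  assumes "x \<in> lists X" "y \<in> lists X"
  shows "cyl x \<inter> cyl y = (if prefix x y then cyl y else if prefix y x then cyl x else {})"
proof -
  have "prefix x y \<or> prefix y x" if "q \<in> cyl x \<inter> cyl y" for q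
  proof -
    have "prefix x (fst q)" "prefix y (fst q)"
      using that cyl_memD[of "fst q" "snd q"] by simp_all
    then show ?thesis by (rule prefix_same_cases)
  qed
  then show ?thesis using cyl_subset assms by (auto; blast)
qed

lemma constructible_inter: "\<lbrakk>Y \<in> constructible P; Z \<in> constructible P\<rbrakk> \<Longrightarrow> Y \<inter> Z \<in> constructible P"
  by (elim constructible_cases) (auto simp: cyl_inter)

lemma coset_empty: "p <#\<^bsub>P\<^esub> {} = {}"
  by (simp add: l_coset_def)

lemma constructible_coset: "\<lbrakk>p \<in> carrier P; Y \<in> constructible P\<rbrakk> \<Longrightarrow> p <#\<^bsub>P\<^esub> Y \<in> constructible P"
  by (cases p; elim constructible_cases) (auto simp: coset_cyl coset_empty)

lemma carrier_constructible: "carrier P \<in> constructible P"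
  using cyl_constructible[of "[]"] by (simp add: cyl_Nil)

end

section \<open>Families satisfying the two presentations\<close>

text \<open>The setting of the algebraic comparison: a self-similar action and a *-algebra to represent it in.\<close>

locale star_family = self_similar_action G X act + D: star_algebra D
  for G :: "('g, 'm) monoid_scheme" (structure)
    and X :: "'x set" and act and D :: "('d, 'k) star_alg_scheme"
begin

abbreviation times_D (infixl \<open>\<cdot>\<close> 70) where "a \<cdot> b \<equiv> a \<otimes>\<^bsub>D\<^esub> b"
abbreviation star_D (\<open>_\<^sup>*\<close> [1000] 999) where "a\<^sup>* \<equiv> adj D a"
abbreviation one_D (\<open>1\<^sub>D\<close>) where "1\<^sub>D \<equiv> \<one>\<^bsub>D\<^esub>"
abbreviation zero_D (\<open>0\<^sub>D\<close>) where "0\<^sub>D \<equiv> \<zero>\<^bsub>D\<^esub>"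

declare D.adj_closed [simp, intro] D.adj_adj [simp]

end

locale toeplitz_family = star_family G X act D
  for G :: "('g, 'm) monoid_scheme" (structure)
    and X :: "'x set" and act and D :: "('d, 'k) star_alg_scheme" +
  fixes v :: "'x \<Rightarrow> 'd" and u :: "'g \<Rightarrow> 'd"
  assumes v_closed [simp, intro]: "x \<in> X \<Longrightarrow> v x \<in> carrier D"
    and u_closed [simp, intro]: "g \<in> carrier G \<Longrightarrow> u g \<in> carrier D"
    and v_orth: "\<lbrakk>x \<in> X; y \<in> X\<rbrakk> \<Longrightarrow> (v x)\<^sup>* \<cdot> v y = (if x = y then 1\<^sub>D else 0\<^sub>D)"
    and u_mult: "\<lbrakk>g \<in> carrier G; h \<in> carrier G\<rbrakk> \<Longrightarrow> u g \<cdot> u h = u (g \<otimes> h)"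
    and u_left: "g \<in> carrier G \<Longrightarrow> (u g)\<^sup>* \<cdot> u g = 1\<^sub>D"
    and u_right: "g \<in> carrier G \<Longrightarrow> u g \<cdot> (u g)\<^sup>* = 1\<^sub>D"
    and u_v: "\<lbrakk>g \<in> carrier G; x \<in> X\<rbrakk> \<Longrightarrow> u g \<cdot> v x = v (hd (act g [x])) \<cdot> u (restr G X act g x)"

locale semigroup_family = star_family G X act D
  for G :: "('g, 'm) monoid_scheme" (structure)
    and X :: "'x set" and act and D :: "('d, 'k) star_alg_scheme" +
  fixes w :: "'x list \<times> 'g \<Rightarrow> 'd" and e :: "('x list \<times> 'g) set \<Rightarrow> 'd"
  assumes w_closed [simp, intro]: "p \<in> carrier P \<Longrightarrow> w p \<in> carrier D"
    and e_closed [simp, intro]: "Y \<in> constructible P \<Longrightarrow> e Y \<in> carrier D"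
    and w_iso: "p \<in> carrier P \<Longrightarrow> (w p)\<^sup>* \<cdot> w p = 1\<^sub>D"
    and e_adj: "Y \<in> constructible P \<Longrightarrow> (e Y)\<^sup>* = e Y"
    and e_idem: "Y \<in> constructible P \<Longrightarrow> e Y \<cdot> e Y = e Y"
    and w_mult: "\<lbrakk>p \<in> carrier P; q \<in> carrier P\<rbrakk> \<Longrightarrow> w p \<cdot> w q = w (p \<otimes>\<^bsub>P\<^esub> q)"
    and w_e: "\<lbrakk>p \<in> carrier P; Y \<in> constructible P\<rbrakk> \<Longrightarrow> w p \<cdot> e Y \<cdot> (w p)\<^sup>* = e (p <#\<^bsub>P\<^esub> Y)"
    and e_carrier: "e (carrier P) = 1\<^sub>D"
    and e_empty: "e {} = 0\<^sub>D"
    and e_inter: "\<lbrakk>Y \<in> constructible P; Z \<in> constructible P\<rbrakk> \<Longrightarrow> e Y \<cdot> e Z = e (Y \<inter> Z)"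

context toeplitz_family
begin

definition V where "V x = foldr (\<lambda>a b. v a \<cdot> b) x 1\<^sub>D"

lemma V_simps [simp]: "V [] = 1\<^sub>D" "V (a # x) = v a \<cdot> V x"
  by (simp_all add: V_def)

lemma V_closed [simp, intro]: "x \<in> lists X \<Longrightarrow> V x \<in> carrier D"
  by (induction x rule: list.induct) auto

lemma V_append: "\<lbrakk>x \<in> lists X; y \<in> lists X\<rbrakk> \<Longrightarrow> V (x @ y) = V x \<cdot> V y"
  by (induction x rule: list.induct) (auto simp: D.m_assoc)

lemma v_orth_left:
  assumes "x \<in> X" "y \<in> X" "c \<in> carrier D"
  shows "(v x)\<^sup>* \<cdot> (v y \<cdot> c) = (if x = y then c else 0\<^sub>D)"
  using assms v_orth[of x y] by (simp flip: D.m_assoc)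

lemma V_iso: "x \<in> lists X \<Longrightarrow> (V x)\<^sup>* \<cdot> V x = 1\<^sub>D"
  by (induction x rule: list.induct) (auto simp: D.adj_one D.adj_mult D.m_assoc v_orth_left)

lemma V_iso_left: "\<lbrakk>x \<in> lists X; c \<in> carrier D\<rbrakk> \<Longrightarrow> (V x)\<^sup>* \<cdot> (V x \<cdot> c) = c"
  using V_iso[of x] by (simp flip: D.m_assoc)

text \<open>Two words of which neither is a prefix of the other differ at some first position, where the
  orthogonality of the \<open>v x\<close> applies after the common part has cancelled.\<close>

lemma V_orth:
  "\<lbrakk>x \<in> lists X; y \<in> lists X; \<not> prefix x y; \<not> prefix y x\<rbrakk> \<Longrightarrow> (V x)\<^sup>* \<cdot> V y = 0\<^sub>D"
proof (induction x arbitrary: y rule: list.induct)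
  case (Cons a x)
  then obtain b y' where y: "y = b # y'" by (cases y) auto
  show ?case using Cons.prems Cons.IH[of y'] by (auto simp: y D.adj_mult D.m_assoc v_orth_left)
qed simp

lemma u_left': "\<lbrakk>g \<in> carrier G; c \<in> carrier D\<rbrakk> \<Longrightarrow> (u g)\<^sup>* \<cdot> (u g \<cdot> c) = c"
  using u_left[of g] by (simp flip: D.m_assoc)

lemma u_right': "\<lbrakk>g \<in> carrier G; c \<in> carrier D\<rbrakk> \<Longrightarrow> u g \<cdot> ((u g)\<^sup>* \<cdot> c) = c"
  using u_right[of g] by (simp flip: D.m_assoc)

lemma u_one: "u \<one> = 1\<^sub>D"
  using u_left'[of \<one> "u \<one>"] u_mult[of \<one> \<one>] u_left[of \<one>] by simp

text \<open>The relation between \<open>u\<close> and the \<open>v x\<close>, iterated along a word; the action and the restriction on words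
  are what this iteration produces.\<close>

lemma u_V:
  "\<lbrakk>g \<in> carrier G; y \<in> lists X\<rbrakk> \<Longrightarrow> u g \<cdot> V y = V (act g y) \<cdot> u (restr_word G X act g y)"
proof (induction y arbitrary: g rule: list.induct)
  case (Cons x y)
  let ?x = "hd (act g [x])" and ?h = "restr G X act g x"
  from Cons have c: "x \<in> X" "y \<in> lists X" "g \<in> carrier G" "?x \<in> X" "?h \<in> carrier G"
    using act_letter(2)[of g x] by auto
  have "u g \<cdot> V (x # y) = (u g \<cdot> v x) \<cdot> V y" using c by (simp add: D.m_assoc)
  also have "\<dots> = v ?x \<cdot> (u ?h \<cdot> V y)" using c by (simp add: u_v D.m_assoc)
  also have "\<dots> = V (act g (x # y)) \<cdot> u (restr_word G X act g (x # y))"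
    using c Cons.IH[of ?h] act_Cons[of g x y] by (simp add: D.m_assoc)
  finally show ?case .
qed simp

text \<open>The images of the generators \<open>w p\<close> and \<open>e Y\<close> of the semigroup presentation. The word that determines a
  cylinder is unique, so \<open>THE\<close> is well defined there.\<close>

definition W where "W p = V (fst p) \<cdot> u (snd p)"

definition E where "E Y = (if Y = {} then 0\<^sub>D else let y = (THE y. y \<in> lists X \<and> Y = cyl y) in V y \<cdot> (V y)\<^sup>*)"

lemma E_cyl: "y \<in> lists X \<Longrightarrow> E (cyl y) = V y \<cdot> (V y)\<^sup>*"
  by (simp add: E_def the_cyl cyl_nonempty)

lemma E_empty: "E {} = 0\<^sub>D"
  by (simp add: E_def)

text \<open>In the nested cases the isometry of the shorter word cancels, which leaves the range projection of the
  longer word.\<close>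

lemma E_inter:
  assumes "x \<in> lists X" "y \<in> lists X" shows "E (cyl x) \<cdot> E (cyl y) = E (cyl x \<inter> cyl y)"
proof -
  consider z where "y = x @ z" | z where "x = y @ z" "\<not> prefix x y" | "\<not> prefix x y" "\<not> prefix y x"
    unfolding prefix_def by blast
  then show ?thesis
  proof cases
    case (1 z)
    then have z: "z \<in> lists X" using assms by simp
    have "E (cyl x) \<cdot> E (cyl y) = V x \<cdot> ((V x)\<^sup>* \<cdot> (V x \<cdot> (V z \<cdot> (V y)\<^sup>*)))"
      using assms z 1 by (simp add: E_cyl V_append D.m_assoc D.adj_mult)
    also have "\<dots> = E (cyl y)" using assms z 1 by (simp add: E_cyl V_iso_left V_append D.m_assoc D.adj_mult)
    finally show ?thesis using assms 1 by (simp add: cyl_inter)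
  next
    case (2 z)
    then have z: "z \<in> lists X" using assms by simp
    have "E (cyl x) \<cdot> E (cyl y) = V x \<cdot> ((V z)\<^sup>* \<cdot> ((V y)\<^sup>* \<cdot> (V y \<cdot> (V y)\<^sup>*)))"
      using assms z 2 by (simp add: E_cyl V_append D.m_assoc D.adj_mult)
    also have "\<dots> = E (cyl x)" using assms z 2 by (simp add: E_cyl V_iso_left V_append D.m_assoc D.adj_mult)
    finally show ?thesis using assms 2 by (simp add: cyl_inter)
  next
    case 3
    have "E (cyl x) \<cdot> E (cyl y) = V x \<cdot> (((V x)\<^sup>* \<cdot> V y) \<cdot> (V y)\<^sup>*)"
      using assms by (simp add: E_cyl D.m_assoc)
    then show ?thesis using assms 3 by (simp add: V_orth cyl_inter E_empty)
  qed
qed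

text \<open>In the covariance relation \<open>w p e Y (w p)\<^sup>* = e (p Y)\<close>, moving \<open>u g\<close> past \<open>V y\<close> leaves \<open>u h\<close> next to its
  adjoint, for the restriction \<open>h\<close> of \<open>g\<close>; they cancel because \<open>u h\<close> is a coisometry.\<close>

lemma semigroup_family_WE: "semigroup_family G X act D W E"
proof
  fix p assume p: "p \<in> carrier P"
  then show "W p \<in> carrier D" by (auto simp: W_def)
  show "(W p)\<^sup>* \<cdot> W p = 1\<^sub>D"
    using p by (auto simp: W_def D.adj_mult D.m_assoc V_iso_left u_left)
  fix q assume q: "q \<in> carrier P"
  obtain x g y h where xy: "p = (x, g)" "q = (y, h)" by (cases p; cases q)
  have "W p \<cdot> W q = V x \<cdot> ((u g \<cdot> V y) \<cdot> u h)"
    using p q by (simp add: W_def xy D.m_assoc)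
  also have "\<dots> = V x \<cdot> (V (act g y) \<cdot> (u (restr_word G X act g y) \<cdot> u h))"
    using p q by (simp add: xy u_V D.m_assoc)
  also have "\<dots> = W (p \<otimes>\<^bsub>P\<^esub> q)"
    using p q by (simp add: xy W_def u_mult V_append D.m_assoc)
  finally show "W p \<cdot> W q = W (p \<otimes>\<^bsub>P\<^esub> q)" .
next
  fix Y assume Y: "Y \<in> constructible P"
  show "E Y \<in> carrier D" "(E Y)\<^sup>* = E Y"
    using Y by (elim constructible_cases; simp add: E_cyl E_empty D.adj_mult D.adj_zero)+
  show "E Y \<cdot> E Y = E Y"
    using Y by (elim constructible_cases; simp add: E_inter E_empty)
  show "E Y \<cdot> E Z = E (Y \<inter> Z)" if "Z \<in> constructible P" for Z
    using Y that by (elim constructible_cases; simp add: E_inter) (simp_all add: E_empty E_cyl)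
  fix p assume p: "p \<in> carrier P"
  obtain x g where xg: "p = (x, g)" "x \<in> lists X" "g \<in> carrier G" using p by (cases p) auto
  from Y show "W p \<cdot> E Y \<cdot> (W p)\<^sup>* = E (p <#\<^bsub>P\<^esub> Y)"
  proof (cases rule: constructible_cases)
    case 1
    then show ?thesis using xg by (simp add: W_def coset_empty E_empty)
  next
    case (2 y)
    let ?h = "restr_word G X act g y"
    have c: "act g y \<in> lists X" "?h \<in> carrier G" using xg 2 by auto
    have "W p \<cdot> E Y \<cdot> (W p)\<^sup>* = V x \<cdot> ((u g \<cdot> V y) \<cdot> ((u g \<cdot> V y)\<^sup>* \<cdot> (V x)\<^sup>*))"
      using xg 2(1) by (simp add: W_def 2(2) E_cyl D.adj_mult D.m_assoc)
    also have "\<dots> = V x \<cdot> (V (act g y) \<cdot> (u ?h \<cdot> ((u ?h)\<^sup>* \<cdot> ((V (act g y))\<^sup>* \<cdot> (V x)\<^sup>*))))"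
      using xg 2(1) c by (simp add: u_V D.adj_mult D.m_assoc)
    also have "\<dots> = E (cyl (x @ act g y))"
      using xg 2(1) c by (simp add: u_right' E_cyl V_append D.adj_mult D.m_assoc)
    finally show ?thesis using xg 2 by (simp add: coset_cyl)
  qed
next
  show "E (carrier P) = 1\<^sub>D" using E_cyl[of "[]"] by (simp add: cyl_Nil D.adj_one)
  show "E {} = 0\<^sub>D" by (rule E_empty)
qed

lemma W_letter: "x \<in> X \<Longrightarrow> W ([x], \<one>) = v x" and W_group: "g \<in> carrier G \<Longrightarrow> W ([], g) = u g"
  by (simp_all add: W_def u_one)

end

context semigroup_family
begin

text \<open>The covariance relation for the whole semigroup, whose projection is the unit.\<close>

lemma e_cyl:
  assumes "x \<in> lists X" "g \<in> carrier G" shows "w (x, g) \<cdot> (w (x, g))\<^sup>* = e (cyl x)"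
  using w_e[of "(x, g)" "carrier P"] assms principal_eq_cyl[OF assms] e_carrier carrier_constructible
  by (simp add: principal_def)

text \<open>Orthogonality of different letters comes from \<open>w = (w w\<^sup>* ) w\<close>: the range projections belong to disjoint
  cylinders. The isometry of a group element is unitary because its right ideal is the whole semigroup.\<close>

lemma toeplitz_family_w: "toeplitz_family G X act D (\<lambda>x. w ([x], \<one>)) (\<lambda>g. w ([], g))"
proof
  fix x assume x: "x \<in> X"
  show "w ([x], \<one>) \<in> carrier D" using x by auto
  fix y assume y: "y \<in> X"
  show "(w ([x], \<one>))\<^sup>* \<cdot> w ([y], \<one>) = (if x = y then 1\<^sub>D else 0\<^sub>D)"
  proof (cases "x = y")
    case True
    then show ?thesis using x w_iso[of "([x], \<one>)"] by simp
  next
    case False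
    let ?x = "w ([x], \<one>)" and ?y = "w ([y], \<one>)"
    have c: "?x \<in> carrier D" "?y \<in> carrier D" using x y by auto
    have "?x\<^sup>* \<cdot> ?y = (?x\<^sup>* \<cdot> ?x) \<cdot> ?x\<^sup>* \<cdot> (?y \<cdot> (?y\<^sup>* \<cdot> ?y))"
      using c x y w_iso[of "([x], \<one>)"] w_iso[of "([y], \<one>)"] by simp
    also have "\<dots> = ?x\<^sup>* \<cdot> ((?x \<cdot> ?x\<^sup>*) \<cdot> (?y \<cdot> ?y\<^sup>*)) \<cdot> ?y"
      using c by (simp add: D.m_assoc)
    also have "\<dots> = ?x\<^sup>* \<cdot> (e (cyl [x]) \<cdot> e (cyl [y])) \<cdot> ?y"
      using x y e_cyl[of "[x]" \<one>] e_cyl[of "[y]" \<one>] by simp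
    also have "e (cyl [x]) \<cdot> e (cyl [y]) = 0\<^sub>D"
      using x y False by (simp add: e_inter cyl_inter e_empty)
    finally show ?thesis using c False by simp
  qed
next
  fix g assume g: "g \<in> carrier G"
  show "w ([], g) \<in> carrier D" "(w ([], g))\<^sup>* \<cdot> w ([], g) = 1\<^sub>D" using g by (simp_all add: w_iso)
  show "w ([], g) \<cdot> (w ([], g))\<^sup>* = 1\<^sub>D" using g e_cyl[of "[]" g] by (simp add: cyl_Nil e_carrier)
  show "w ([], g) \<cdot> w ([], h) = w ([], g \<otimes> h)" if "h \<in> carrier G" for h
    using g that by (simp add: w_mult)
  fix x assume x: "x \<in> X"
  show "w ([], g) \<cdot> w ([x], \<one>) = w ([hd (act g [x])], \<one>) \<cdot> w ([], restr G X act g x)"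
    using g x act_letter[of g x] by (simp add: w_mult)
qed

text \<open>The Toeplitz family contained in a semigroup family generates all of it: the three lemmas below say
  that extending it again gives back \<open>w\<close> and \<open>e\<close>.\<close>

sublocale T: toeplitz_family G X act D "\<lambda>x. w ([x], \<one>)" "\<lambda>g. w ([], g)"
  by (rule toeplitz_family_w)

lemma V_eq: "x \<in> lists X \<Longrightarrow> T.V x = w (x, \<one>)"
proof (induction x rule: list.induct)
  case Nil
  have "w ([], \<one>) = 1\<^sub>D" by (rule T.u_one)
  then show ?case by simp
qed (simp add: w_mult)

lemma W_eq: "p \<in> carrier P \<Longrightarrow> T.W p = w p"
  by (cases p) (simp add: T.W_def V_eq w_mult)

lemma E_eq: "Y \<in> constructible P \<Longrightarrow> T.E Y = e Y"
  by (elim constructible_cases; simp add: T.E_cyl T.E_empty V_eq e_cyl e_empty)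

end

section \<open>The two presentations are equivalent\<close>

text \<open>The sets of relations are unions of such comprehensions.\<close>

lemma rels_ball:
  "(\<forall>(l, r)\<in>{(f x, g x) | x. A x}. Q l r) \<longleftrightarrow> (\<forall>x. A x \<longrightarrow> Q (f x) (g x))"
  "(\<forall>(l, r)\<in>{(f' x y, g' x y) | x y. A x \<and> B y}. Q l r) \<longleftrightarrow> (\<forall>x. A x \<longrightarrow> (\<forall>y. B y \<longrightarrow> Q (f' x y) (g' x y)))"
  by auto

context self_similar_action
begin

lemma representation_toeplitz_iff:
  fixes D :: "('d, 'k) normed_star_alg_scheme"
  shows "star_representation (ss_gens G X) (toeplitz_rels G X act) D \<pi> \<longleftrightarrow>
    star_algebra D \<and> star_hom (free_with (ss_gens G X) (\<lambda>_. 0)) D \<pi> \<and>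
    toeplitz_family G X act D (\<lambda>x. \<pi> (free_gen (Gen_v x))) (\<lambda>g. \<pi> (free_gen (Gen_u g)))"
proof -
  have rels: "(\<forall>(l, r)\<in>toeplitz_rels G X act. \<pi> l = \<pi> r) \<longleftrightarrow>
      (\<forall>x\<in>X. \<forall>y\<in>X. \<pi> (free_adj (free_gen (Gen_v x)) * free_gen (Gen_v y)) = \<pi> (if x = y then 1 else 0)) \<and>
      (\<forall>g\<in>carrier G. \<forall>h\<in>carrier G. \<pi> (free_gen (Gen_u g) * free_gen (Gen_u h)) = \<pi> (free_gen (Gen_u (g \<otimes> h)))) \<and>
      (\<forall>g\<in>carrier G. \<pi> (free_adj (free_gen (Gen_u g)) * free_gen (Gen_u g)) = \<pi> 1) \<and>
      (\<forall>g\<in>carrier G. \<pi> (free_gen (Gen_u g) * free_adj (free_gen (Gen_u g))) = \<pi> 1) \<and>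
      (\<forall>g\<in>carrier G. \<forall>x\<in>X. \<pi> (free_gen (Gen_u g) * free_gen (Gen_v x))
        = \<pi> (free_gen (Gen_v (hd (act g [x]))) * free_gen (Gen_u (restr G X act g x))))"
    unfolding toeplitz_rels_def Let_def by (simp only: ball_Un rels_ball conj_assoc) (simp only: Ball_def)
  show ?thesis
  proof (cases "star_algebra D \<and> star_hom (free_with (ss_gens G X) (\<lambda>_. 0)) D \<pi>")
    case True
    then interpret D: star_algebra D by blast
    note \<pi> = True[THEN conjunct2]
    note h = star_homD[OF \<pi>, simplified] star_hom_zero_minus(1)[OF star_algebra_free_with D.star_algebra_axioms \<pi>, simplified]
    have gen: "\<And>x. x \<in> X \<Longrightarrow> free_gen (Gen_v x) \<in> carrier (free_alg (ss_gens G X))"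
      "\<And>g. g \<in> carrier G \<Longrightarrow> free_gen (Gen_u g) \<in> carrier (free_alg (ss_gens G X))"
      by (auto simp: ss_gens_def)
    note hd = act_letter(2)
    show ?thesis
      unfolding star_representation_def rels toeplitz_family_def star_family_def toeplitz_family_axioms_def
      using True self_similar_action_axioms by (simp add: h gen hd if_distrib[of \<pi>] Ball_def)
  qed (auto simp: star_representation_def)
qed

lemma representation_semigroup_iff:
  fixes D :: "('d, 'k) normed_star_alg_scheme"
  shows "star_representation (sg_gens P) (semigroup_rels P) D \<pi> \<longleftrightarrow>
    star_algebra D \<and> star_hom (free_with (sg_gens P) (\<lambda>_. 0)) D \<pi> \<and>
    semigroup_family G X act D (\<lambda>p. \<pi> (free_gen (Gen_w p))) (\<lambda>Y. \<pi> (free_gen (Gen_e Y)))"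
proof -
  have rels: "(\<forall>(l, r)\<in>semigroup_rels P. \<pi> l = \<pi> r) \<longleftrightarrow>
      (\<forall>p\<in>carrier P. \<pi> (free_adj (free_gen (Gen_w p)) * free_gen (Gen_w p)) = \<pi> 1) \<and>
      (\<forall>Y\<in>constructible P. \<pi> (free_adj (free_gen (Gen_e Y))) = \<pi> (free_gen (Gen_e Y))) \<and>
      (\<forall>Y\<in>constructible P. \<pi> (free_gen (Gen_e Y) * free_gen (Gen_e Y)) = \<pi> (free_gen (Gen_e Y))) \<and>
      (\<forall>p\<in>carrier P. \<forall>q\<in>carrier P. \<pi> (free_gen (Gen_w p) * free_gen (Gen_w q)) = \<pi> (free_gen (Gen_w (p \<otimes>\<^bsub>P\<^esub> q)))) \<and>
      (\<forall>p\<in>carrier P. \<forall>Y\<in>constructible P. \<pi> (free_gen (Gen_w p) * free_gen (Gen_e Y) * free_adj (free_gen (Gen_w p)))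
         = \<pi> (free_gen (Gen_e (p <#\<^bsub>P\<^esub> Y)))) \<and>
      \<pi> (free_gen (Gen_e (carrier P))) = \<pi> 1 \<and> \<pi> (free_gen (Gen_e {})) = \<pi> 0 \<and>
      (\<forall>Y\<in>constructible P. \<forall>Z\<in>constructible P. \<pi> (free_gen (Gen_e Y) * free_gen (Gen_e Z)) = \<pi> (free_gen (Gen_e (Y \<inter> Z))))"
    unfolding semigroup_rels_def Let_def
    by (simp only: ball_Un rels_ball ball_simps(5,7) prod.case conj_assoc simp_thms) (simp only: Ball_def)
  show ?thesis
  proof (cases "star_algebra D \<and> star_hom (free_with (sg_gens P) (\<lambda>_. 0)) D \<pi>")
    case True
    then interpret D: star_algebra D by blast
    note \<pi> = True[THEN conjunct2]
    note h = star_homD[OF \<pi>, simplified] star_hom_zero_minus(1)[OF star_algebra_free_with D.star_algebra_axioms \<pi>, simplified]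
    have gen: "\<And>p. p \<in> carrier P \<Longrightarrow> free_gen (Gen_w p) \<in> carrier (free_alg (sg_gens P))"
      "\<And>Y. Y \<in> constructible P \<Longrightarrow> free_gen (Gen_e Y) \<in> carrier (free_alg (sg_gens P))"
      by (auto simp: sg_gens_def)
    show ?thesis
      unfolding star_representation_def rels semigroup_family_def star_family_def semigroup_family_axioms_def
      using True self_similar_action_axioms
      by (simp add: h gen Ball_def carrier_constructible P_mult_closed constructible_coset constructible_inter
          del: P_carrier)
  qed (auto simp: star_representation_def)
qed

lemma toeplitz_rels_subset:
  "toeplitz_rels G X act \<subseteq> carrier (free_alg (ss_gens G X)) \<times> carrier (free_alg (ss_gens G X))"
proof -
  have gen: "\<And>x. x \<in> X \<Longrightarrow> free_gen (Gen_v x) \<in> carrier (free_alg (ss_gens G X))"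
    "\<And>g. g \<in> carrier G \<Longrightarrow> free_gen (Gen_u g) \<in> carrier (free_alg (ss_gens G X))"
    by (auto simp: ss_gens_def)
  show ?thesis
    by (auto simp: toeplitz_rels_def Let_def gen act_letter(2))
qed

lemma semigroup_rels_subset:
  "semigroup_rels P \<subseteq> carrier (free_alg (sg_gens P)) \<times> carrier (free_alg (sg_gens P))"
proof -
  have gen: "\<And>p. p \<in> carrier P \<Longrightarrow> free_gen (Gen_w p) \<in> carrier (free_alg (sg_gens P))"
    "\<And>Y. Y \<in> constructible P \<Longrightarrow> free_gen (Gen_e Y) \<in> carrier (free_alg (sg_gens P))"
    by (auto simp: sg_gens_def)
  show ?thesis
    by (auto simp: semigroup_rels_def Let_def gen carrier_constructible P_mult_closed constructible_coset
        constructible_inter simp del: P_carrier P_mult)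
qed

end

lemma isometry_seminorm_le_one:
  assumes p: "rel_seminorm S R p" and s: "s \<in> S" and R: "(free_adj (free_gen s) * free_gen s, 1) \<in> R"
  shows "p (free_gen s) \<le> 1"
proof -
  interpret seminormed_star_algebra "free_with S p" by (rule seminormed_free_with[OF rel_seminormD(1)[OF p]])
  have "p (free_adj (free_gen s) * free_gen s) = p 1"
    using nrm_diff_le[of "free_adj (free_gen s) * free_gen s" 1] rel_seminormD(2)[OF p R] s
    by (simp add: free_minus)
  moreover have "p 1 = (p 1)\<^sup>2" using nrm_cstar[of 1] by simp
  then have "p 1 \<le> 1" using nrm_nonneg[of 1] by (cases "p 1 = 0") (auto simp: power2_eq_square)
  ultimately have "(p (free_gen s))\<^sup>2 \<le> 1\<^sup>2" using nrm_cstar[of "free_gen s"] s by simp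
  then show ?thesis by (rule power2_le_imp_le) simp
qed

text \<open>For a projection the C*-identity reads \<open>p e = (p e)\<^sup>2\<close>; the relations hold only up to seminorm zero, so
  the products have to be compared first.\<close>

lemma projection_seminorm_le_one:
  assumes p: "rel_seminorm S R p" and s: "s \<in> S" and R: "(free_adj (free_gen s), free_gen s) \<in> R"
    "(free_gen s * free_gen s, free_gen s) \<in> R"
  shows "p (free_gen s) \<le> 1"
proof -
  interpret seminormed_star_algebra "free_with S p" by (rule seminormed_free_with[OF rel_seminormD(1)[OF p]])
  let ?e = "free_gen s"
  have "p ((free_adj ?e - ?e) * ?e) \<le> 0"
    using nrm_mult[of "free_adj ?e - ?e" ?e] rel_seminormD(2)[OF p R(1)] s by simp
  moreover have "\<bar>p (free_adj ?e * ?e) - p (?e * ?e)\<bar> \<le> p ((free_adj ?e - ?e) * ?e)"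
    using nrm_diff_le[of "free_adj ?e * ?e" "?e * ?e"] s by (simp add: free_minus left_diff_distrib)
  moreover have "\<bar>p (?e * ?e) - p ?e\<bar> \<le> 0"
    using nrm_diff_le[of "?e * ?e" ?e] rel_seminormD(2)[OF p R(2)] s by (simp add: free_minus)
  ultimately have "(p ?e)\<^sup>2 = p ?e" using nrm_cstar[of ?e] s by simp
  then show ?thesis using nrm_nonneg[of ?e] s by (cases "p ?e = 0") (auto simp: power2_eq_square)
qed

text \<open>The two substitutions between the free *-algebras. The first sends \<open>v x\<close> to \<open>w ([x], 1)\<close> and \<open>u g\<close>
  to \<open>w ([], g)\<close>; the second imitates, in the free *-algebra, the passage from a Toeplitz family to
  a semigroup family.\<close>

primrec toeplitz_to_semigroup :: "('g, 'm) monoid_scheme \<Rightarrow> ('x, 'g) ss_gen \<Rightarrow> ('x list \<times> 'g) sg_gen free_elt" where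
  "toeplitz_to_semigroup G (Gen_v x) = free_gen (Gen_w ([x], \<one>\<^bsub>G\<^esub>))"
| "toeplitz_to_semigroup G (Gen_u g) = free_gen (Gen_w ([], g))"

definition free_word :: "'x list \<Rightarrow> ('x, 'g) ss_gen free_elt" where
  "free_word x = foldr (\<lambda>a b. free_gen (Gen_v a) * b) x 1"

primrec semigroup_to_toeplitz ::
  "('g, 'm) monoid_scheme \<Rightarrow> 'x set \<Rightarrow> ('x list \<times> 'g) sg_gen \<Rightarrow> ('x, 'g) ss_gen free_elt" where
  "semigroup_to_toeplitz G X (Gen_w p) = free_word (fst p) * free_gen (Gen_u (snd p))"
| "semigroup_to_toeplitz G X (Gen_e Y) = (if Y = {} then 0 else
     let y = (THE y. y \<in> lists X \<and> Y = cylinder G X y) in free_word y * free_adj (free_word y))"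

lemma free_word_simps [simp]:
  "free_word [] = 1" "free_word (a # x) = free_gen (Gen_v a) * free_word x"
  by (simp_all add: free_word_def)

context self_similar_action
begin

lemma gens_bounded_toeplitz: "gens_bounded (ss_gens G X) (toeplitz_rels G X act)"
  unfolding gens_bounded_def
proof (intro ballI exI[of _ 1] allI impI)
  fix s p assume "s \<in> ss_gens G X" "rel_seminorm (ss_gens G X) (toeplitz_rels G X act) p"
  moreover from this have "(free_adj (free_gen s) * free_gen s, 1) \<in> toeplitz_rels G X act"
    unfolding ss_gens_def
  proof (elim UnE imageE)
    fix x assume "s = Gen_v x" "x \<in> X"
    then have "\<exists>y z. (free_adj (free_gen s) * free_gen s, 1)
      = (free_adj (free_gen (Gen_v y)) * free_gen (Gen_v z), if y = z then 1 else 0) \<and> y \<in> X \<and> z \<in> X"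
      by (intro exI[of _ x]) simp
    then show ?thesis unfolding toeplitz_rels_def Let_def by blast
  next
    fix g assume "s = Gen_u g" "g \<in> carrier G"
    then show ?thesis unfolding toeplitz_rels_def Let_def by blast
  qed
  ultimately show "p (free_gen s) \<le> 1" by (metis isometry_seminorm_le_one)
qed

lemma gens_bounded_semigroup: "gens_bounded (sg_gens P) (semigroup_rels P)"
  unfolding gens_bounded_def
proof (intro ballI exI[of _ 1] allI impI)
  fix s p assume s: "s \<in> sg_gens P" and p: "rel_seminorm (sg_gens P) (semigroup_rels P) p"
  from s consider q where "q \<in> carrier P" "s = Gen_w q" | Y where "Y \<in> constructible P" "s = Gen_e Y"
    by (auto simp: sg_gens_def simp del: P_carrier)
  then show "p (free_gen s) \<le> 1"
  proof cases
    case 1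
    then show ?thesis
      by (intro isometry_seminorm_le_one[OF p s]) (unfold semigroup_rels_def Let_def, blast)
  next
    case 2
    then show ?thesis
      by (intro projection_seminorm_le_one[OF p s]) (unfold semigroup_rels_def Let_def, blast+)
  qed
qed

lemma toeplitz_to_semigroup_closed:
  "s \<in> ss_gens G X \<Longrightarrow> toeplitz_to_semigroup G s \<in> carrier (free_alg (sg_gens P))"
  by (auto simp: ss_gens_def sg_gens_def intro!: free_gen_closed)

lemma free_word_closed: "x \<in> lists X \<Longrightarrow> free_word x \<in> carrier (free_alg (ss_gens G X))"
  by (induction x rule: list.induct) (auto simp: ss_gens_def)

lemma semigroup_to_toeplitz_closed:
  assumes "t \<in> sg_gens P" shows "semigroup_to_toeplitz G X t \<in> carrier (free_alg (ss_gens G X))"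
proof -
  have u: "free_gen (Gen_u g) \<in> carrier (free_alg (ss_gens G X))" if "g \<in> carrier G" for g
    using that by (auto simp: ss_gens_def)
  from assms show ?thesis
    unfolding sg_gens_def
  proof (elim UnE imageE)
    fix Y assume "t = Gen_e Y" "Y \<in> constructible P"
    then show ?thesis
      by (elim constructible_cases) (simp_all add: the_cyl free_word_closed)
  qed (simp add: free_word_closed u)
qed

text \<open>Through this, the relations for the substituted generators and both round trips reduce to the
  statements about families.\<close>

lemma semigroup_to_toeplitz_eval:
  fixes D :: "('d, 'k) normed_star_alg_scheme"
  assumes \<rho>: "star_hom (free_with (ss_gens G X) (\<lambda>_. 0)) D \<rho>"
    and fam: "toeplitz_family G X act D v u"
    and v: "\<And>x. x \<in> X \<Longrightarrow> \<rho> (free_gen (Gen_v x)) = v x"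
    and u: "\<And>g. g \<in> carrier G \<Longrightarrow> \<rho> (free_gen (Gen_u g)) = u g"
  shows "p \<in> carrier P \<Longrightarrow> \<rho> (semigroup_to_toeplitz G X (Gen_w p)) = toeplitz_family.W D v u p"
    and "Y \<in> constructible P \<Longrightarrow> \<rho> (semigroup_to_toeplitz G X (Gen_e Y)) = toeplitz_family.E G X D v Y"
proof -
  interpret T: toeplitz_family G X act D v u by (rule fam)
  note h = star_homD[OF \<rho>, simplified]
    star_hom_zero_minus(1)[OF star_algebra_free_with T.D.star_algebra_axioms \<rho>, simplified]
  have gen: "\<And>x. x \<in> X \<Longrightarrow> free_gen (Gen_v x) \<in> carrier (free_alg (ss_gens G X))"
    "\<And>g. g \<in> carrier G \<Longrightarrow> free_gen (Gen_u g) \<in> carrier (free_alg (ss_gens G X))"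
    by (auto simp: ss_gens_def)
  have word: "\<rho> (free_word x) = T.V x" if "x \<in> lists X" for x
    using that
  proof (induction x rule: list.induct)
    case (Cons a x)
    then show ?case by (simp add: h gen v free_word_closed)
  qed (simp add: h)
  show "p \<in> carrier P \<Longrightarrow> \<rho> (semigroup_to_toeplitz G X (Gen_w p)) = T.W p"
    by (simp add: h gen u word free_word_closed T.W_def)
  show "Y \<in> constructible P \<Longrightarrow> \<rho> (semigroup_to_toeplitz G X (Gen_e Y)) = T.E Y"
    by (elim constructible_cases)
      (simp_all add: h cyl_nonempty the_cyl word free_word_closed T.E_empty T.E_cyl)
qed

text \<open>Evaluation describes \<open>w\<close> and \<open>e\<close> only on the semigroup and its constructible ideals, which is all that the
  relations refer to.\<close>

lemma semigroup_family_cong: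
  assumes "semigroup_family G X act D w e"
    and "\<And>p. p \<in> carrier P \<Longrightarrow> w p = w' p" and "\<And>Y. Y \<in> constructible P \<Longrightarrow> e Y = e' Y"
  shows "semigroup_family G X act D w' e'"
proof -
  have "semigroup_family_axioms G X act D w e = semigroup_family_axioms G X act D w' e'"
    unfolding semigroup_family_axioms_def using assms(2,3)
    by (simp add: carrier_constructible P_mult_closed constructible_coset constructible_inter
          del: P_carrier cong: imp_cong)
  then show ?thesis using assms(1) by (simp add: semigroup_family_def)
qed

lemma representation_of_semigroup:
  assumes "star_representation (sg_gens P) (semigroup_rels P) D \<pi>"
  shows "star_representation (ss_gens G X) (toeplitz_rels G X act) D (\<pi> \<circ> free_subst (toeplitz_to_semigroup G))"
    and "t \<in> sg_gens P \<Longrightarrow>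
      \<pi> (free_subst (toeplitz_to_semigroup G) (semigroup_to_toeplitz G X t)) = \<pi> (free_gen t)"
proof -
  let ?w = "\<lambda>p. \<pi> (free_gen (Gen_w p))" and ?e = "\<lambda>Y. \<pi> (free_gen (Gen_e Y))"
  note rep = assms[unfolded representation_semigroup_iff]
  interpret S: semigroup_family G X act D ?w ?e using rep by blast
  let ?\<rho> = "\<pi> \<circ> free_subst (toeplitz_to_semigroup G)"
  have \<rho>: "star_hom (free_with (ss_gens G X) (\<lambda>_. 0)) D ?\<rho>"
    by (rule star_hom_comp[OF star_hom_free_subst])
      (use rep in \<open>auto intro: toeplitz_to_semigroup_closed\<close>)
  show "star_representation (ss_gens G X) (toeplitz_rels G X act) D ?\<rho>"
    unfolding representation_toeplitz_iff using \<rho> rep S.toeplitz_family_w by simp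
  note eval = semigroup_to_toeplitz_eval[OF \<rho> S.toeplitz_family_w]
  assume "t \<in> sg_gens P"
  then consider p where "p \<in> carrier P" "t = Gen_w p" | Y where "Y \<in> constructible P" "t = Gen_e Y"
    by (auto simp: sg_gens_def simp del: P_carrier)
  then have "?\<rho> (semigroup_to_toeplitz G X t) = \<pi> (free_gen t)"
  proof cases
    case 1
    then show ?thesis using eval(1)[of p] S.W_eq[of p] by simp
  next
    case 2
    then show ?thesis using eval(2)[of Y] S.E_eq[of Y] by simp
  qed
  then show "\<pi> (free_subst (toeplitz_to_semigroup G) (semigroup_to_toeplitz G X t)) = \<pi> (free_gen t)"
    by simp
qed

lemma representation_of_toeplitz:
  assumes "star_representation (ss_gens G X) (toeplitz_rels G X act) D \<pi>"
  shows "star_representation (sg_gens P) (semigroup_rels P) D (\<pi> \<circ> free_subst (semigroup_to_toeplitz G X))"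
    and "s \<in> ss_gens G X \<Longrightarrow>
      \<pi> (free_subst (semigroup_to_toeplitz G X) (toeplitz_to_semigroup G s)) = \<pi> (free_gen s)"
proof -
  let ?v = "\<lambda>x. \<pi> (free_gen (Gen_v x))" and ?u = "\<lambda>g. \<pi> (free_gen (Gen_u g))"
  note rep = assms[unfolded representation_toeplitz_iff]
  interpret T: toeplitz_family G X act D ?v ?u using rep by blast
  have \<pi>: "star_hom (free_with (ss_gens G X) (\<lambda>_. 0)) D \<pi>" using rep by blast
  note eval = semigroup_to_toeplitz_eval[OF \<pi> T.toeplitz_family_axioms refl refl]
  let ?\<rho> = "\<pi> \<circ> free_subst (semigroup_to_toeplitz G X)"
  have \<rho>: "star_hom (free_with (sg_gens P) (\<lambda>_. 0)) D ?\<rho>"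
    by (rule star_hom_comp[OF star_hom_free_subst \<pi>]) (rule semigroup_to_toeplitz_closed)
  have "semigroup_family G X act D (\<lambda>p. ?\<rho> (free_gen (Gen_w p))) (\<lambda>Y. ?\<rho> (free_gen (Gen_e Y)))"
    by (rule semigroup_family_cong[OF T.semigroup_family_WE]) (simp_all only: comp_apply free_subst_gen eval)
  then show "star_representation (sg_gens P) (semigroup_rels P) D ?\<rho>"
    unfolding representation_semigroup_iff using \<rho> rep by blast
  assume "s \<in> ss_gens G X"
  then show "\<pi> (free_subst (semigroup_to_toeplitz G X) (toeplitz_to_semigroup G s)) = \<pi> (free_gen s)"
    unfolding ss_gens_def
    by (elim UnE imageE) (simp_all add: eval T.W_letter T.W_group del: semigroup_to_toeplitz.simps)
qed

theorem toeplitz_iso_semigroup: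
  "\<exists>\<phi>. cstar_iso (toeplitz_alg G X act) (semigroup_alg P) \<phi> \<and>
    (\<forall>g\<in>carrier G. \<phi> (toeplitz_u G X act g) = semigroup_w P ([], g)) \<and>
    (\<forall>x\<in>X. \<phi> (toeplitz_v G X act x) = semigroup_w P ([x], \<one>))"
proof -
  have "\<exists>\<phi>. cstar_iso (toeplitz_alg G X act) (semigroup_alg P) \<phi> \<and>
    (\<forall>a\<in>carrier (free_alg (ss_gens G X)).
      \<phi> (completion_map (free_normed (ss_gens G X) (toeplitz_rels G X act)) a)
        = completion_map (free_normed (sg_gens P) (semigroup_rels P)) (free_subst (toeplitz_to_semigroup G) a))"
    unfolding toeplitz_alg_def semigroup_alg_def
    by (rule univ_cstar_iso[where G = "semigroup_to_toeplitz G X"])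
      (simp_all add: toeplitz_rels_subset semigroup_rels_subset gens_bounded_toeplitz gens_bounded_semigroup
        toeplitz_to_semigroup_closed semigroup_to_toeplitz_closed representation_of_semigroup
        representation_of_toeplitz del: free_subst_gen semigroup_to_toeplitz.simps)
  then obtain \<phi> where \<phi>: "cstar_iso (toeplitz_alg G X act) (semigroup_alg P) \<phi>"
    and eq: "\<And>a. a \<in> carrier (free_alg (ss_gens G X)) \<Longrightarrow>
      \<phi> (completion_map (free_normed (ss_gens G X) (toeplitz_rels G X act)) a)
        = completion_map (free_normed (sg_gens P) (semigroup_rels P)) (free_subst (toeplitz_to_semigroup G) a)"
    by blast
  have "\<phi> (toeplitz_u G X act g) = semigroup_w P ([], g)" if "g \<in> carrier G" for g
    using that eq[of "free_gen (Gen_u g)"]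
    by (simp add: toeplitz_u_def semigroup_w_def univ_gen_def ss_gens_def)
  moreover have "\<phi> (toeplitz_v G X act x) = semigroup_w P ([x], \<one>)" if "x \<in> X" for x
    using that eq[of "free_gen (Gen_v x)"]
    by (simp add: toeplitz_v_def semigroup_w_def univ_gen_def ss_gens_def)
  ultimately show ?thesis using \<phi> by blast
qed

lemma star_algebra_toeplitz: "star_algebra (toeplitz_alg G X act)"
  and toeplitz_family_toeplitz_alg: "toeplitz_family G X act (toeplitz_alg G X act) (toeplitz_v G X act) (toeplitz_u G X act)"
  using representation_univ_cstar[OF toeplitz_rels_subset gens_bounded_toeplitz]
  unfolding representation_toeplitz_iff toeplitz_alg_def toeplitz_v_def[abs_def] toeplitz_u_def[abs_def] univ_gen_def
  by blast+

lemma star_algebra_semigroup: "star_algebra (semigroup_alg P)"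
  and semigroup_family_semigroup_alg: "semigroup_family G X act (semigroup_alg P) (semigroup_w P) (semigroup_e P)"
  using representation_univ_cstar[OF semigroup_rels_subset gens_bounded_semigroup]
  unfolding representation_semigroup_iff semigroup_alg_def semigroup_w_def[abs_def] semigroup_e_def[abs_def] univ_gen_def
  by blast+

end

section \<open>Closed ideals and quotients along an isomorphism\<close>

lemma cstar_isoD:
  assumes "cstar_iso A B \<phi>"
  shows "star_hom A B \<phi>" "inj_on \<phi> (carrier A)" "\<phi> ` carrier A = carrier B"
    and "a \<in> carrier A \<Longrightarrow> nrm B (\<phi> a) = nrm A a"
  using assms by (auto simp: cstar_iso_def bij_betw_def)

text \<open>An isomorphism is isometric, so it preserves convergence.\<close>

lemma closed_ideal_vimage:
  assumes A: "star_algebra A" and B: "star_algebra B" and \<phi>: "cstar_iso A B \<phi>" and J: "closed_ideal B J"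
  shows "closed_ideal A {a \<in> carrier A. \<phi> a \<in> J}"
proof -
  interpret A: star_algebra A by fact
  interpret B: star_algebra B by fact
  interpret J: ideal J B using J by (simp add: closed_ideal_def)
  note iso = cstar_isoD[OF \<phi>]
  note h = star_homD[OF iso(1)] star_hom_zero_minus[OF A B iso(1)]
  have inv: "\<phi> (\<ominus>\<^bsub>A\<^esub> a) = \<ominus>\<^bsub>B\<^esub> \<phi> a" if "a \<in> carrier A" for a
    using that by (simp add: h flip: A.scl_minus_one B.scl_minus_one)
  have "ideal {a \<in> carrier A. \<phi> a \<in> J} A"
  proof (rule idealI[OF A.ring_axioms])
    show "subgroup {a \<in> carrier A. \<phi> a \<in> J} (add_monoid A)"
      by (rule A.add.subgroupI)
        (auto simp: h inv[unfolded a_inv_def] a_inv_def[symmetric] inv intro: exI[of _ "\<zero>\<^bsub>A\<^esub>"])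
  qed (auto simp: h J.I_l_closed J.I_r_closed)
  moreover have "\<phi> a \<in> J" if s: "\<forall>n. s n \<in> {a \<in> carrier A. \<phi> a \<in> J}" and a: "a \<in> carrier A"
    and lim: "(\<lambda>n. nrm A (s n \<ominus>\<^bsub>A\<^esub> a)) \<longlonglongrightarrow> 0" for s a
  proof -
    have "nrm B (\<phi> (s n) \<ominus>\<^bsub>B\<^esub> \<phi> a) = nrm A (s n \<ominus>\<^bsub>A\<^esub> a)" for n
      using s a iso(4)[of "s n \<ominus>\<^bsub>A\<^esub> a"] by (simp add: h)
    then have "(\<lambda>n. nrm B (\<phi> (s n) \<ominus>\<^bsub>B\<^esub> \<phi> a)) \<longlonglongrightarrow> 0" using lim by simp
    moreover have "\<forall>n. \<phi> (s n) \<in> J" "\<phi> a \<in> carrier B" using s a by (simp_all add: h)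
    ultimately show ?thesis using J[unfolded closed_ideal_def] by (meson)
  qed
  ultimately show ?thesis unfolding closed_ideal_def by blast
qed

lemma cstar_iso_inverse:
  assumes A: "star_algebra A" and \<phi>: "cstar_iso A B \<phi>"
  shows "cstar_iso B A (inv_into (carrier A) \<phi>)"
proof -
  interpret A: star_algebra A by fact
  note iso = cstar_isoD[OF \<phi>] and h = star_homD[OF cstar_isoD(1)[OF \<phi>]]
  define \<psi> where "\<psi> = inv_into (carrier A) \<phi>"
  have \<psi>: "\<psi> (\<phi> a) = a" if "a \<in> carrier A" for a
    using that by (simp add: \<psi>_def inv_into_f_f[OF iso(2)])
  have c: "\<psi> b \<in> carrier A" and e: "\<phi> (\<psi> b) = b" if "b \<in> carrier B" for b
    using that by (auto simp: \<psi>_def iso(3)[symmetric] inv_into_into f_inv_into_f)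
  have "star_hom B A \<psi>"
  proof (rule star_homI)
    show "\<psi> \<one>\<^bsub>B\<^esub> = \<one>\<^bsub>A\<^esub>" using \<psi>[of "\<one>\<^bsub>A\<^esub>"] by (simp add: h)
    fix b assume b: "b \<in> carrier B"
    show "\<psi> b \<in> carrier A" by (rule c[OF b])
    show "\<psi> (scl B k b) = scl A k (\<psi> b)" for k
      using \<psi>[of "scl A k (\<psi> b)"] b by (simp add: h c e A.scl_closed)
    show "\<psi> (adj B b) = adj A (\<psi> b)"
      using \<psi>[of "adj A (\<psi> b)"] b by (simp add: h c e A.adj_closed)
    fix b' assume b': "b' \<in> carrier B"
    show "\<psi> (b \<otimes>\<^bsub>B\<^esub> b') = \<psi> b \<otimes>\<^bsub>A\<^esub> \<psi> b'"
      using \<psi>[of "\<psi> b \<otimes>\<^bsub>A\<^esub> \<psi> b'"] b b' by (simp add: h c e)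
    show "\<psi> (b \<oplus>\<^bsub>B\<^esub> b') = \<psi> b \<oplus>\<^bsub>A\<^esub> \<psi> b'"
      using \<psi>[of "\<psi> b \<oplus>\<^bsub>A\<^esub> \<psi> b'"] b b' by (simp add: h c e)
  qed
  moreover have "bij_betw \<psi> (carrier B) (carrier A)"
    using \<phi> by (simp add: \<psi>_def cstar_iso_def bij_betw_inv_into)
  moreover have "nrm A (\<psi> b) = nrm B b" if "b \<in> carrier B" for b
    using iso(4)[OF c[OF that]] that by (simp add: e)
  ultimately show ?thesis by (simp add: cstar_iso_def \<psi>_def)
qed

lemma gen_closed_ideal_subset: "closed_ideal A I \<Longrightarrow> M \<subseteq> I \<Longrightarrow> gen_closed_ideal A M \<subseteq> I"
  by (auto simp: gen_closed_ideal_def)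

lemma closed_ideal_carrier: "ring A \<Longrightarrow> closed_ideal A (carrier A)"
  by (simp add: closed_ideal_def ring.oneideal)

lemma gen_closed_ideal_image_subset:
  assumes A: "star_algebra A" and B: "star_algebra B" and \<phi>: "cstar_iso A B \<phi>" and M: "M \<subseteq> carrier A"
  shows "\<phi> ` gen_closed_ideal A M \<subseteq> gen_closed_ideal B (\<phi> ` M)"
proof (rule image_subsetI, unfold gen_closed_ideal_def[of B], rule InterI)
  fix a J assume a: "a \<in> gen_closed_ideal A M" and J: "J \<in> {J. closed_ideal B J \<and> \<phi> ` M \<subseteq> J}"
  have "M \<subseteq> {a \<in> carrier A. \<phi> a \<in> J}" using J M by auto
  with closed_ideal_vimage[OF A B \<phi>, of J] J a show "\<phi> a \<in> J"
    unfolding gen_closed_ideal_def by blast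
qed

text \<open>One inclusion for the isomorphism and one for its inverse.\<close>

lemma gen_closed_ideal_image:
  assumes A: "star_algebra A" and B: "star_algebra B" and \<phi>: "cstar_iso A B \<phi>" and M: "M \<subseteq> carrier A"
  shows "\<phi> ` gen_closed_ideal A M = gen_closed_ideal B (\<phi> ` M)"
proof
  interpret B: star_algebra B by fact
  note iso = cstar_isoD[OF \<phi>]
  let ?\<psi> = "inv_into (carrier A) \<phi>"
  have \<phi>M: "\<phi> ` M \<subseteq> carrier B" using M iso(3) by blast
  have "?\<psi> ` \<phi> ` M = M" using M by (rule inv_into_image_cancel[OF iso(2)])
  then have *: "?\<psi> ` gen_closed_ideal B (\<phi> ` M) \<subseteq> gen_closed_ideal A M"
    using gen_closed_ideal_image_subset[OF B A cstar_iso_inverse[OF A \<phi>] \<phi>M] by simp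
  have "gen_closed_ideal B (\<phi> ` M) \<subseteq> \<phi> ` carrier A"
    unfolding iso(3) by (rule gen_closed_ideal_subset[OF closed_ideal_carrier[OF B.ring_axioms] \<phi>M])
  then have "gen_closed_ideal B (\<phi> ` M) = \<phi> ` ?\<psi> ` gen_closed_ideal B (\<phi> ` M)"
    by (simp add: image_inv_into_cancel[OF refl])
  with * show "gen_closed_ideal B (\<phi> ` M) \<subseteq> \<phi> ` gen_closed_ideal A M" by blast
qed (rule gen_closed_ideal_image_subset[OF assms])

text \<open>All operations of the quotient are built from the operations of the algebra by forming images of sets, so
  taking images under the isomorphism respects them.\<close>

lemma quot_alg_iso:
  assumes A: "star_algebra A" and \<phi>: "cstar_iso A B \<phi>" and I: "I \<subseteq> carrier A"
  shows "cstar_iso (quot_alg A I) (quot_alg B (\<phi> ` I)) (image \<phi>)"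
    and "a \<in> carrier A \<Longrightarrow> \<phi> ` quot_map A I a = quot_map B (\<phi> ` I) (\<phi> a)"
proof -
  interpret A: star_algebra A by fact
  note iso = cstar_isoD[OF \<phi>] and h = star_homD[OF cstar_isoD(1)[OF \<phi>]]
  have map: "\<phi> ` quot_map A I a = quot_map B (\<phi> ` I) (\<phi> a)" if "a \<in> carrier A" for a
  proof -
    have "\<phi> (i \<oplus>\<^bsub>A\<^esub> a) = \<phi> i \<oplus>\<^bsub>B\<^esub> \<phi> a" if "i \<in> I" for i
      using I that \<open>a \<in> carrier A\<close> by (intro h(3)) auto
    then show ?thesis unfolding quot_map_def a_r_coset_def' by (simp add: image_UN)
  qed
  then show "a \<in> carrier A \<Longrightarrow> \<phi> ` quot_map A I a = quot_map B (\<phi> ` I) (\<phi> a)" .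
  have sub: "quot_map A I a \<subseteq> carrier A" if "a \<in> carrier A" for a
    using that I by (auto simp: quot_map_def a_r_coset_def')
  have add: "\<phi> ` (Y <+>\<^bsub>A\<^esub> Z) = \<phi> ` Y <+>\<^bsub>B\<^esub> \<phi> ` Z" if "Y \<subseteq> carrier A" "Z \<subseteq> carrier A" for Y Z
  proof -
    have "\<phi> (y \<oplus>\<^bsub>A\<^esub> z) = \<phi> y \<oplus>\<^bsub>B\<^esub> \<phi> z" if "y \<in> Y" "z \<in> Z" for y z
      using that \<open>Y \<subseteq> carrier A\<close> \<open>Z \<subseteq> carrier A\<close> by (intro h(3)) auto
    then show ?thesis unfolding set_add_def' by (simp add: image_UN)
  qed
  have mult: "\<phi> ` rcoset_mult A I Y Z = rcoset_mult B (\<phi> ` I) (\<phi> ` Y) (\<phi> ` Z)"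
    if "Y \<subseteq> carrier A" "Z \<subseteq> carrier A" for Y Z
  proof -
    have "\<phi> ` (I +>\<^bsub>A\<^esub> (y \<otimes>\<^bsub>A\<^esub> z)) = \<phi> ` I +>\<^bsub>B\<^esub> (\<phi> y \<otimes>\<^bsub>B\<^esub> \<phi> z)" if "y \<in> Y" "z \<in> Z" for y z
    proof -
      have yz: "y \<in> carrier A" "z \<in> carrier A" using that \<open>Y \<subseteq> carrier A\<close> \<open>Z \<subseteq> carrier A\<close> by auto
      then show ?thesis using map[of "y \<otimes>\<^bsub>A\<^esub> z"] by (simp add: quot_map_def h)
    qed
    then show ?thesis by (simp add: rcoset_mult_def image_UN)
  qed
  have scl: "\<phi> ` scl A c ` Y = scl B c ` \<phi> ` Y" and adj: "\<phi> ` adj A ` Y = adj B ` \<phi> ` Y"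
    and nrm: "nrm B ` \<phi> ` Y = nrm A ` Y" if "Y \<subseteq> carrier A" for c Y
  proof -
    have "\<phi> (scl A c y) = scl B c (\<phi> y)" "\<phi> (adj A y) = adj B (\<phi> y)" "nrm B (\<phi> y) = nrm A y"
      if "y \<in> Y" for y using h(5,6) iso(4) that \<open>Y \<subseteq> carrier A\<close> by auto
    then show "\<phi> ` scl A c ` Y = scl B c ` \<phi> ` Y" "\<phi> ` adj A ` Y = adj B ` \<phi> ` Y"
      "nrm B ` \<phi> ` Y = nrm A ` Y"
      unfolding image_image by (intro image_cong refl; simp)+
  qed
  have scl_sub: "scl A c ` Y \<subseteq> carrier A" if "Y \<subseteq> carrier A" for c Y
    using that A.scl_closed by blast
  let ?QA = "quot_alg A I" and ?QB = "quot_alg B (\<phi> ` I)"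
  have car: "Y \<subseteq> carrier A" if "Y \<in> carrier ?QA" for Y
    using that sub by (auto simp: quot_alg_simps)
  have cB: "(image \<phi>) ` carrier ?QA = carrier ?QB"
  proof -
    have "(image \<phi>) ` carrier ?QA = (\<lambda>a. quot_map B (\<phi> ` I) (\<phi> a)) ` carrier A"
      unfolding quot_alg_simps image_image by (rule image_cong[OF refl]) (rule map)
    also have "\<dots> = carrier ?QB" unfolding quot_alg_simps iso(3)[symmetric] image_image ..
    finally show ?thesis .
  qed
  have "star_hom ?QA ?QB (image \<phi>)"
  proof (rule star_homI)
    show "\<phi> ` Y \<in> carrier ?QB" if "Y \<in> carrier ?QA" for Y using that cB by blast
    show "\<phi> ` \<one>\<^bsub>?QA\<^esub> = \<one>\<^bsub>?QB\<^esub>" by (simp add: quot_alg_simps map h)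
    fix Y assume Y: "Y \<in> carrier ?QA"
    show "\<phi> ` scl ?QA c Y = scl ?QB c (\<phi> ` Y)" for c
      using car[OF Y] I by (simp add: quot_alg_simps add scl scl_sub)
    show "\<phi> ` adj ?QA Y = adj ?QB (\<phi> ` Y)"
      using car[OF Y] by (simp add: quot_alg_simps adj)
    fix Z assume Z: "Z \<in> carrier ?QA"
    show "\<phi> ` (Y \<oplus>\<^bsub>?QA\<^esub> Z) = \<phi> ` Y \<oplus>\<^bsub>?QB\<^esub> \<phi> ` Z"
      using car[OF Y] car[OF Z] by (simp add: quot_alg_simps add)
    show "\<phi> ` (Y \<otimes>\<^bsub>?QA\<^esub> Z) = \<phi> ` Y \<otimes>\<^bsub>?QB\<^esub> \<phi> ` Z"
      using car[OF Y] car[OF Z] by (simp add: quot_alg_simps FactRing_def mult)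
  qed
  moreover have "inj_on (image \<phi>) (carrier ?QA)"
    using car inj_on_image_eq_iff[OF iso(2)] by (auto simp: inj_on_def)
  moreover have "\<forall>Y\<in>carrier ?QA. nrm ?QB (\<phi> ` Y) = nrm ?QA Y"
    using car by (auto simp: quot_alg_simps nrm)
  ultimately show "cstar_iso ?QA ?QB (image \<phi>)"
    using cB by (simp add: cstar_iso_def bij_betw_def)
qed

lemma star_hom_finsum:
  assumes A: "star_algebra A" and B: "star_algebra B" and f: "star_hom A B f"
    and "finite K" "\<And>k. k \<in> K \<Longrightarrow> a k \<in> carrier A"
  shows "f (\<Oplus>\<^bsub>A\<^esub>k\<in>K. a k) = (\<Oplus>\<^bsub>B\<^esub>k\<in>K. f (a k))"
proof -
  interpret A: star_algebra A by fact
  interpret B: star_algebra B by fact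
  note h = star_homD[OF f] star_hom_zero_minus[OF A B f]
  show ?thesis using assms(4,5)
  proof (induction K rule: finite_induct)
    case (insert k K)
    then have "a \<in> K \<rightarrow> carrier A" "(\<lambda>k. f (a k)) \<in> K \<rightarrow> carrier B" "a k \<in> carrier A" by (auto simp: h)
    then show ?case using insert by (simp add: h)
  qed (simp add: h)
qed

section \<open>Foundation sets\<close>

text \<open>The fold behind \<open>finprod\<close> is well defined as soon as the factors commute with each other.\<close>

lemma (in monoid) finprod_insert_commuting:
  assumes "finite F" "a \<notin> F" and f: "\<And>x. x \<in> insert a F \<Longrightarrow> f x \<in> carrier G"
    and comm: "\<And>x y. \<lbrakk>x \<in> insert a F; y \<in> insert a F\<rbrakk> \<Longrightarrow> f x \<otimes> f y = f y \<otimes> f x"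
  shows "finprod G f (insert a F) = f a \<otimes> finprod G f F" and "finprod G f F \<in> carrier G"
proof -
  have "f x \<otimes> (f y \<otimes> z) = f y \<otimes> (f x \<otimes> z)"
    if "x \<in> insert a F" "y \<in> insert a F" "z \<in> carrier G" for x y z
    using comm[OF that(1,2)] f[OF that(1)] f[OF that(2)] that(3) by (simp flip: m_assoc)
  then interpret LCD "insert a F" "carrier G" "(\<otimes>) \<circ> f"
    by unfold_locales (use f in auto)
  show "finprod G f (insert a F) = f a \<otimes> finprod G f F"
    using assms(1,2) by (simp add: finprod_def foldD_insert subset_insertI)
  show "finprod G f F \<in> carrier G"
    using assms(1) by (simp add: finprod_def foldD_closed subset_insertI)
qed

lemma (in ring) one_minus_commute:
  assumes "a \<in> carrier R" "b \<in> carrier R" "a \<otimes> b = b \<otimes> a"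
  shows "(\<one> \<ominus> a) \<otimes> (\<one> \<ominus> b) = (\<one> \<ominus> b) \<otimes> (\<one> \<ominus> a)"
  using assms by (simp add: a_minus_def l_distr r_distr l_minus r_minus minus_add a_ac)

lemma (in ideal) finsum_closed_ideal:
  assumes "finite K" "\<And>k. k \<in> K \<Longrightarrow> a k \<in> I" shows "(\<Oplus>k\<in>K. a k) \<in> I"
  using assms
proof (induction K rule: finite_induct)
  case (insert k K)
  then have "a \<in> K \<rightarrow> carrier R" "a k \<in> carrier R" by auto
  then show ?case using insert by simp
qed simp

context semigroup_family
begin

text \<open>The factors of the products over foundation sets.\<close>

abbreviation defect where "defect p \<equiv> 1\<^sub>D \<ominus>\<^bsub>D\<^esub> e (principal P p)"

lemma defect_eq: "\<lbrakk>x \<in> lists X; g \<in> carrier G\<rbrakk> \<Longrightarrow> defect (x, g) = 1\<^sub>D \<ominus>\<^bsub>D\<^esub> e (cyl x)"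
  by (simp add: principal_eq_cyl)

lemma principal_constructible: "p \<in> carrier P \<Longrightarrow> principal P p \<in> constructible P"
  by (simp add: constructible_def del: P_carrier)

lemma defect_closed: "p \<in> carrier P \<Longrightarrow> defect p \<in> carrier D"
  using principal_constructible by blast

lemma defect_commute: "\<lbrakk>p \<in> carrier P; q \<in> carrier P\<rbrakk> \<Longrightarrow> defect p \<cdot> defect q = defect q \<cdot> defect p"
  using principal_constructible[of p] principal_constructible[of q]
  by (intro D.one_minus_commute e_closed) (simp_all add: e_inter Int_commute)

lemma finprod_defect_insert:
  assumes "finite F" "p \<notin> F" "insert p F \<subseteq> carrier P"
  shows "finprod D defect (insert p F) = defect p \<cdot> finprod D defect F" and "finprod D defect F \<in> carrier D"
  using assms by (intro D.finprod_insert_commuting; blast intro: defect_closed defect_commute)+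

text \<open>Expanding the product leaves no mixed terms, since different letters have orthogonal projections.\<close>

lemma letter_defects:
  assumes "finite Y" "Y \<subseteq> X"
  shows "finprod D defect ((\<lambda>x. ([x], \<one>)) ` Y) = 1\<^sub>D \<ominus>\<^bsub>D\<^esub> (\<Oplus>\<^bsub>D\<^esub>x\<in>Y. e (cyl [x]))"
  using assms
proof (induction Y rule: finite_induct)
  case empty
  then show ?case by (simp add: finprod_def a_minus_def)
next
  case (insert a Y)
  let ?F = "(\<lambda>x. ([x], \<one>)) ` Y" and ?s = "\<Oplus>\<^bsub>D\<^esub>x\<in>Y. e (cyl [x])"
  have Y: "(\<lambda>x. e (cyl [x])) \<in> Y \<rightarrow> carrier D" "e (cyl [a]) \<in> carrier D" using insert.prems by auto
  then have s: "?s \<in> carrier D" by simp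
  have "e (cyl [a]) \<cdot> e (cyl [x]) = 0\<^sub>D" if "x \<in> Y" for x
    using that insert by (auto simp: e_inter cyl_inter e_empty)
  then have "(\<Oplus>\<^bsub>D\<^esub>x\<in>Y. e (cyl [a]) \<cdot> e (cyl [x])) = (\<Oplus>\<^bsub>D\<^esub>x\<in>Y. 0\<^sub>D)"
    by (intro D.finsum_cong') auto
  then have 0: "e (cyl [a]) \<cdot> ?s = 0\<^sub>D"
    using Y insert.hyps by (simp add: D.finsum_rdistr)
  have "finprod D defect ((\<lambda>x. ([x], \<one>)) ` insert a Y) = defect ([a], \<one>) \<cdot> finprod D defect ?F"
    unfolding image_insert using insert by (intro finprod_defect_insert(1)) auto
  also have "\<dots> = (1\<^sub>D \<ominus>\<^bsub>D\<^esub> e (cyl [a])) \<cdot> (1\<^sub>D \<ominus>\<^bsub>D\<^esub> ?s)"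
    using insert by (simp add: defect_eq)
  also have "\<dots> = 1\<^sub>D \<ominus>\<^bsub>D\<^esub> (e (cyl [a]) \<oplus>\<^bsub>D\<^esub> ?s)"
    using Y s 0 by (simp add: a_minus_def D.l_distr D.r_distr D.l_minus D.r_minus D.minus_add D.a_ac)
  finally show ?case using insert.hyps Y by simp
qed

text \<open>A nonempty word meets the ideal of its first letter; the empty word meets every ideal, so that at least
  one letter is required.\<close>

lemma foundation_set_letters: "X \<noteq> {} \<Longrightarrow> foundation_set P ((\<lambda>x. ([x], \<one>)) ` X)"
  unfolding foundation_set_def
proof (intro conjI ballI)
  assume "X \<noteq> {}"
  then obtain a where a: "a \<in> X" by blast
  fix p assume p: "p \<in> carrier P"
  obtain x g where xg: "p = (x, g)" "x \<in> lists X" "g \<in> carrier G" using p by (cases p) auto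
  have "\<exists>b\<in>X. cyl x \<inter> cyl [b] \<noteq> {}"
  proof (cases x)
    case Nil
    then show ?thesis using a cyl_nonempty[of "[a]"] by (intro bexI[of _ a]) (simp_all add: cyl_inter)
  next
    case (Cons b y)
    then show ?thesis using xg cyl_nonempty[of x] by (intro bexI[of _ b]) (simp_all add: cyl_inter cyl_nonempty)
  qed
  then show "\<exists>q\<in>(\<lambda>x. ([x], \<one>)) ` X. principal P p \<inter> principal P q \<noteq> {}"
    using xg by (auto simp: principal_eq_cyl)
qed (use finite_alphabet in auto)

text \<open>Some member of \<open>F\<close> has a word comparable with \<open>y\<close>, and since it is not longer than \<open>y\<close> it is a prefix of \<open>y\<close>.\<close>

lemma foundation_set_covers:
  assumes F: "foundation_set P F"
    and y: "y \<in> lists X" and long: "\<And>q. q \<in> F \<Longrightarrow> length (fst q) \<le> length y"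
  shows "\<exists>q\<in>F. cyl y \<subseteq> principal P q"
proof -
  have "(y, \<one>) \<in> carrier P" using y by simp
  then obtain q where q: "q \<in> F" "principal P (y, \<one>) \<inter> principal P q \<noteq> {}"
    using F unfolding foundation_set_def by blast
  obtain z h where zh: "q = (z, h)" by (cases q)
  have "q \<in> carrier P" using F q(1) unfolding foundation_set_def by blast
  then have z: "z \<in> lists X" "h \<in> carrier G" by (simp_all add: zh)
  have "prefix z y"
  proof (cases "prefix y z")
    case True
    then have "y = z"
      using long[OF q(1)] by (simp add: zh) (metis prefix_length_le prefix_order.order_iff_strict not_less prefix_length_less)
    then show ?thesis by simp
  next
    case False
    then show ?thesis using q(2) z y by (auto simp: zh principal_eq_cyl cyl_inter split: if_splits)
  qed
  then have "cyl y \<subseteq> principal P q" using y z by (simp add: zh principal_eq_cyl cyl_subset)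
  then show ?thesis using q(1) by blast
qed

text \<open>The factors commute, so the factor of \<open>q\<close> can be brought to the front, where \<open>e (cyl y)\<close> annihilates it.\<close>

lemma e_finprod_defect_zero:
  assumes F: "foundation_set P F" and y: "y \<in> lists X" and q: "q \<in> F" "cyl y \<subseteq> principal P q"
  shows "e (cyl y) \<cdot> finprod D defect F = 0\<^sub>D"
proof -
  have qc: "q \<in> carrier P" and fin: "finite (F - {q})" and sub: "insert q (F - {q}) \<subseteq> carrier P"
    using F q(1) unfolding foundation_set_def by blast+
  have Fq: "insert q (F - {q}) = F" using q(1) by blast
  note prod = finprod_defect_insert[OF fin _ sub, unfolded Fq]
  have c: "principal P q \<in> constructible P" by (rule principal_constructible[OF qc])
  have "e (cyl y) \<cdot> e (principal P q) = e (cyl y)"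
    using c y q(2) by (simp add: e_inter Int_absorb2)
  then have "e (cyl y) \<cdot> defect q = 0\<^sub>D"
    using c y by (simp add: a_minus_def D.r_distr D.r_minus D.r_neg)
  then have "e (cyl y) \<cdot> (defect q \<cdot> finprod D defect (F - {q})) = 0\<^sub>D"
    using y defect_closed[OF qc] prod(2) by (simp flip: D.m_assoc)
  then show ?thesis using prod(1) by simp
qed

text \<open>The generator \<open>1 - \<Sum>x. e (cyl [x])\<close>, translated to the cylinder of \<open>y\<close>, says how \<open>e (cyl y)\<close> splits into
  the cylinders one letter longer.\<close>

lemma e_cyl_minus_sum:
  assumes y: "y \<in> lists X"
  shows "w (y, \<one>) \<cdot> (1\<^sub>D \<ominus>\<^bsub>D\<^esub> (\<Oplus>\<^bsub>D\<^esub>x\<in>X. e (cyl [x]))) \<cdot> (w (y, \<one>))\<^sup>*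
    = e (cyl y) \<ominus>\<^bsub>D\<^esub> (\<Oplus>\<^bsub>D\<^esub>x\<in>X. e (cyl (y @ [x])))"
proof -
  let ?w = "w (y, \<one>)"
  have w: "?w \<in> carrier D" using y by simp
  have e: "(\<lambda>x. e (cyl [x])) \<in> X \<rightarrow> carrier D" by auto
  have we: "?w \<cdot> e (cyl [x]) \<cdot> ?w\<^sup>* = e (cyl (y @ [x]))" if "x \<in> X" for x
    using that y w_e[of "(y, \<one>)" "cyl [x]"] by (simp add: coset_cyl)
  have "?w \<cdot> (\<Oplus>\<^bsub>D\<^esub>x\<in>X. e (cyl [x])) \<cdot> ?w\<^sup>* = (\<Oplus>\<^bsub>D\<^esub>x\<in>X. ?w \<cdot> e (cyl [x]) \<cdot> ?w\<^sup>*)"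
  proof -
    have "?w \<cdot> (\<Oplus>\<^bsub>D\<^esub>x\<in>X. e (cyl [x])) \<cdot> ?w\<^sup>* = (\<Oplus>\<^bsub>D\<^esub>x\<in>X. ?w \<cdot> e (cyl [x])) \<cdot> ?w\<^sup>*"
      using e w finite_alphabet by (simp add: D.finsum_rdistr)
    also have "\<dots> = (\<Oplus>\<^bsub>D\<^esub>x\<in>X. ?w \<cdot> e (cyl [x]) \<cdot> ?w\<^sup>*)"
      using e w finite_alphabet by (intro D.finsum_ldistr) auto
    finally show ?thesis .
  qed
  also have "\<dots> = (\<Oplus>\<^bsub>D\<^esub>x\<in>X. e (cyl (y @ [x])))"
    using y by (intro D.finsum_cong') (auto simp: we)
  finally show ?thesis
    using w e e_cyl[OF y, of \<one>]
    by (simp add: a_minus_def D.r_distr D.l_distr D.r_minus D.l_minus)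
qed

text \<open>Modulo the ideal, \<open>e (cyl y)\<close> is the sum of the \<open>e (cyl (y @ [x]))\<close>. For words at least as long as all words in
  \<open>F\<close>, the product is annihilated by \<open>e (cyl y)\<close>; descending to shorter words one letter at a time,
  \<open>e (cyl y)\<close> times the product lies in the ideal for every \<open>y\<close>, and the empty word gives the product itself.\<close>

lemma finprod_defect_in_ideal:
  assumes I: "ideal I D" and gen: "1\<^sub>D \<ominus>\<^bsub>D\<^esub> (\<Oplus>\<^bsub>D\<^esub>x\<in>X. e (cyl [x])) \<in> I" and F: "foundation_set P F"
  shows "finprod D defect F \<in> I"
proof -
  interpret I: ideal I D by fact
  let ?c = "finprod D defect F"
  have fin: "finite F" and sub: "F \<subseteq> carrier P" using F by (auto simp: foundation_set_def)
  have c: "?c \<in> carrier D"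
    using fin sub
  proof (induction F rule: finite_induct)
    case (insert p F)
    then show ?case using finprod_defect_insert[of F p] defect_closed[of p] by simp
  qed (simp add: finprod_def)
  define n where "n = Max (insert 0 ((length \<circ> fst) ` F))"
  have n: "length (fst q) \<le> n" if "q \<in> F" for q
    unfolding n_def using fin that by (intro Max_ge) auto
  have "e (cyl y) \<cdot> ?c \<in> I" if "y \<in> lists X" "n - length y = k" for y k
    using that
  proof (induction k arbitrary: y)
    case 0
    then have "\<And>q. q \<in> F \<Longrightarrow> length (fst q) \<le> length y" using n by fastforce
    from foundation_set_covers[OF F 0(1) this] obtain q where "q \<in> F" "cyl y \<subseteq> principal P q" by blast
    then show ?case using e_finprod_defect_zero[OF F 0(1)] by simp
  next
    case (Suc k)
    let ?s = "\<Oplus>\<^bsub>D\<^esub>x\<in>X. e (cyl (y @ [x]))"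
    have e: "(\<lambda>x. e (cyl (y @ [x]))) \<in> X \<rightarrow> carrier D" "e (cyl y) \<in> carrier D" using Suc.prems by auto
    have s: "?s \<in> carrier D" using e by simp
    have "e (cyl y) \<ominus>\<^bsub>D\<^esub> ?s \<in> I"
      unfolding e_cyl_minus_sum[OF Suc.prems(1), symmetric]
      using Suc.prems by (intro I.I_r_closed I.I_l_closed gen) auto
    then have "(e (cyl y) \<ominus>\<^bsub>D\<^esub> ?s) \<cdot> ?c \<in> I" using c by (rule I.I_r_closed)
    moreover have "e (cyl (y @ [x])) \<cdot> ?c \<in> I" if "x \<in> X" for x
      using Suc.prems that by (intro Suc.IH) auto
    then have "?s \<cdot> ?c \<in> I"
      using e c finite_alphabet by (simp add: D.finsum_ldistr I.finsum_closed_ideal)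
    ultimately have "(e (cyl y) \<ominus>\<^bsub>D\<^esub> ?s) \<cdot> ?c \<oplus>\<^bsub>D\<^esub> ?s \<cdot> ?c \<in> I" by (rule I.a_closed)
    moreover have "(e (cyl y) \<ominus>\<^bsub>D\<^esub> ?s) \<cdot> ?c \<oplus>\<^bsub>D\<^esub> ?s \<cdot> ?c = e (cyl y) \<cdot> ?c"
      using e s c by (simp add: a_minus_def D.l_neg D.a_assoc flip: D.l_distr)
    ultimately show ?case by simp
  qed
  from this[of "[]" n] show ?thesis using c by (simp add: cyl_Nil e_carrier)
qed

end

section \<open>The isomorphism theorem\<close>

context self_similar_action
begin

text \<open>A closed ideal contains the generator \<open>1 - \<Sum>x. w x (w x)\<^sup>*\<close> if and only if it contains all products over
  foundation sets. For the empty alphabet this fails: the semigroup is then the group, whose products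
  vanish, while the generator is the unit.\<close>

lemma boundary_ideal_eq:
  assumes X: "X \<noteq> {}"
  shows "boundary_ideal P = gen_closed_ideal (semigroup_alg P)
    {\<one>\<^bsub>semigroup_alg P\<^esub> \<ominus>\<^bsub>semigroup_alg P\<^esub> (\<Oplus>\<^bsub>semigroup_alg P\<^esub>x\<in>X.
      semigroup_w P ([x], \<one>) \<otimes>\<^bsub>semigroup_alg P\<^esub> adj (semigroup_alg P) (semigroup_w P ([x], \<one>)))}"
    (is "_ = gen_closed_ideal ?C {?d}")
proof -
  interpret S: semigroup_family G X act ?C "semigroup_w P" "semigroup_e P" by (rule semigroup_family_semigroup_alg)
  have d: "?d = \<one>\<^bsub>?C\<^esub> \<ominus>\<^bsub>?C\<^esub> (\<Oplus>\<^bsub>?C\<^esub>x\<in>X. semigroup_e P (cyl [x]))"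
    by (intro arg_cong2[where f = "a_minus ?C"] refl S.D.finsum_cong') (auto simp: S.e_cyl)
  have "(\<forall>F. foundation_set P F \<longrightarrow> finprod ?C S.defect F \<in> K) \<longleftrightarrow> ?d \<in> K" if K: "closed_ideal ?C K" for K
  proof
    assume "\<forall>F. foundation_set P F \<longrightarrow> finprod ?C S.defect F \<in> K"
    then show "?d \<in> K"
      using S.foundation_set_letters[OF X] S.letter_defects[OF finite_alphabet subset_refl] unfolding d by metis
  next
    assume "?d \<in> K"
    then show "\<forall>F. foundation_set P F \<longrightarrow> finprod ?C S.defect F \<in> K"
      using K S.finprod_defect_in_ideal unfolding d closed_ideal_def by blast
  qed
  then show ?thesis
    unfolding boundary_ideal_def Let_def gen_closed_ideal_def by (intro arg_cong[where f = Inter]) blast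
qed

lemma iso_cuntz_pimsner_ideal:
  assumes X: "X \<noteq> {}" and \<phi>: "cstar_iso (toeplitz_alg G X act) (semigroup_alg P) \<phi>"
    and \<phi>v: "\<And>x. x \<in> X \<Longrightarrow> \<phi> (toeplitz_v G X act x) = semigroup_w P ([x], \<one>)"
  shows "\<phi> ` cuntz_pimsner_ideal G X act = boundary_ideal P"
proof -
  let ?T = "toeplitz_alg G X act" and ?C = "semigroup_alg P" and ?v = "toeplitz_v G X act"
  interpret T: toeplitz_family G X act ?T ?v "toeplitz_u G X act" by (rule toeplitz_family_toeplitz_alg)
  interpret C: star_algebra ?C by (rule star_algebra_semigroup)
  note h = star_homD[OF cstar_isoD(1)[OF \<phi>]]
    star_hom_zero_minus[OF star_algebra_toeplitz star_algebra_semigroup cstar_isoD(1)[OF \<phi>]]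
  let ?d = "\<one>\<^bsub>?T\<^esub> \<ominus>\<^bsub>?T\<^esub> (\<Oplus>\<^bsub>?T\<^esub>x\<in>X. ?v x \<otimes>\<^bsub>?T\<^esub> adj ?T (?v x))"
  have sum: "(\<Oplus>\<^bsub>?T\<^esub>x\<in>X. ?v x \<otimes>\<^bsub>?T\<^esub> adj ?T (?v x)) \<in> carrier ?T"
    by (intro T.D.finsum_closed) auto
  have "\<phi> (\<Oplus>\<^bsub>?T\<^esub>x\<in>X. ?v x \<otimes>\<^bsub>?T\<^esub> adj ?T (?v x)) = (\<Oplus>\<^bsub>?C\<^esub>x\<in>X. \<phi> (?v x \<otimes>\<^bsub>?T\<^esub> adj ?T (?v x)))"
    by (rule star_hom_finsum[OF star_algebra_toeplitz star_algebra_semigroup cstar_isoD(1)[OF \<phi>] finite_alphabet]) auto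
  also have "\<dots> = (\<Oplus>\<^bsub>?C\<^esub>x\<in>X. semigroup_w P ([x], \<one>) \<otimes>\<^bsub>?C\<^esub> adj ?C (semigroup_w P ([x], \<one>)))"
  proof (rule C.finsum_cong')
    show "(\<lambda>x. semigroup_w P ([x], \<one>) \<otimes>\<^bsub>?C\<^esub> adj ?C (semigroup_w P ([x], \<one>))) \<in> X \<rightarrow> carrier ?C"
      using \<phi>v h(1)[OF T.v_closed] by (auto intro!: C.m_closed C.adj_closed)
  qed (simp_all add: h \<phi>v)
  finally have "\<phi> ` {?d} = {\<one>\<^bsub>?C\<^esub> \<ominus>\<^bsub>?C\<^esub>
      (\<Oplus>\<^bsub>?C\<^esub>x\<in>X. semigroup_w P ([x], \<one>) \<otimes>\<^bsub>?C\<^esub> adj ?C (semigroup_w P ([x], \<one>)))}"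
    using sum by (simp add: h)
  moreover have "\<phi> ` cuntz_pimsner_ideal G X act = gen_closed_ideal ?C (\<phi> ` {?d})"
    unfolding cuntz_pimsner_ideal_def Let_def using sum
    by (intro gen_closed_ideal_image[OF star_algebra_toeplitz star_algebra_semigroup \<phi>]) simp
  ultimately show ?thesis using boundary_ideal_eq[OF X] by simp
qed

lemma cuntz_pimsner_ideal_subset: "cuntz_pimsner_ideal G X act \<subseteq> carrier (toeplitz_alg G X act)"
proof -
  interpret T: toeplitz_family G X act "toeplitz_alg G X act" "toeplitz_v G X act" "toeplitz_u G X act"
    by (rule toeplitz_family_toeplitz_alg)
  show ?thesis
    unfolding cuntz_pimsner_ideal_def Let_def
    by (intro gen_closed_ideal_subset[OF closed_ideal_carrier[OF T.D.ring_axioms]])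
      (auto intro!: T.D.minus_closed T.D.finsum_closed)
qed

end

theorem theorem6p7:
  fixes G :: "('g, 'm) monoid_scheme" and X :: "'x set" and act :: "'g \<Rightarrow> 'x list \<Rightarrow> 'x list"
  defines "P \<equiv> zappa_szep G X act"
  assumes "self_similar_action G X act"
  shows "\<exists>\<phi>. cstar_iso (toeplitz_alg G X act) (semigroup_alg P) \<phi> \<and>
      (\<forall>g\<in>carrier G. \<phi> (toeplitz_u G X act g) = semigroup_w P ([], g)) \<and>
      (\<forall>x\<in>X. \<phi> (toeplitz_v G X act x) = semigroup_w P ([x], \<one>\<^bsub>G\<^esub>)) \<and>
      (X \<noteq> {} \<longrightarrow>
        (\<exists>\<psi>. cstar_iso (cuntz_pimsner_alg G X act) (boundary_quotient P) \<psi> \<and>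
          (\<forall>a\<in>carrier (toeplitz_alg G X act).
            \<psi> (quot_map (toeplitz_alg G X act) (cuntz_pimsner_ideal G X act) a) =
              quot_map (semigroup_alg P) (boundary_ideal P) (\<phi> a))))"
proof -
  interpret self_similar_action G X act by fact
  obtain \<phi> where \<phi>: "cstar_iso (toeplitz_alg G X act) (semigroup_alg P) \<phi>"
    and u: "\<forall>g\<in>carrier G. \<phi> (toeplitz_u G X act g) = semigroup_w P ([], g)"
    and v: "\<forall>x\<in>X. \<phi> (toeplitz_v G X act x) = semigroup_w P ([x], \<one>\<^bsub>G\<^esub>)"
    using toeplitz_iso_semigroup unfolding P_def by blast
  have "\<exists>\<psi>. cstar_iso (cuntz_pimsner_alg G X act) (boundary_quotient P) \<psi> \<and>
      (\<forall>a\<in>carrier (toeplitz_alg G X act).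
        \<psi> (quot_map (toeplitz_alg G X act) (cuntz_pimsner_ideal G X act) a) =
          quot_map (semigroup_alg P) (boundary_ideal P) (\<phi> a))" if X: "X \<noteq> {}"
  proof -
    have "\<phi> ` cuntz_pimsner_ideal G X act = boundary_ideal P"
      unfolding P_def using \<phi> v by (intro iso_cuntz_pimsner_ideal[OF X]) (simp_all add: P_def)
    then show ?thesis
      using quot_alg_iso[OF star_algebra_toeplitz \<phi> cuntz_pimsner_ideal_subset]
      unfolding cuntz_pimsner_alg_def boundary_quotient_def by metis
  qed
  then show ?thesis using \<phi> u v by blast
qed

end
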